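(* Let $\beta\in\{1,2,4\}$. The cumulants $\kappa_l^{(\beta)}$ of the conductance satisfy, for $l\ge3$, the recurrence relation $$A(l)\kappa^{(\beta)}_{l+1}+\eta^{(\beta)}_{1,4}\sum_{i=0}^{l-1}\binom li\kappa^{(\beta)}_{i+1}\kappa^{(\beta)}_{l-i}B(i,l)-l(2l-1)(\alpha-\delta/2+\beta n)\kappa_l^{(\beta)}-l(l-1)(l-2)\kappa^{(\beta)}_{l-1}=\frac{12b_n^{(\beta)}}{\beta}l(l-1)(l-2)\mu^{(\beta)}_{l-3},$$ with initial conditions $$\kappa_1^{(\beta)}=\frac{n\bigl(\alpha+1+\beta(n-1)/2\bigr)}{\alpha+\delta/2+2+\beta(n-1)},$$ $$\kappa_2^{(\beta)}=\frac14\frac{n\bigl(2\alpha+2+\beta(n-1)\bigr)\bigl(\delta+2+\beta(n-1)\bigr)\bigl(\delta+2\alpha+4+\beta(n-2)\bigr)}{\bigl(\alpha+\delta/2+2+\beta(n-1)\bigr)^2\bigl(\alpha+\delta/2+3+\beta(n-1)\bigr)\bigl(2\alpha+\delta+4+\beta(2n-3)\bigr)},$$ $$\kappa_3^{(\beta)}=\frac{2\kappa_2^{(\beta)}\bigl(\delta/2-\alpha+2\beta\kappa_1^{(\beta)}-\beta n\bigr)}{\bigl(\alpha+\delta/2+4+\beta(n-1)\bigr)\bigl(\alpha+\delta/2+2+\beta(n-2)\bigr)}$$ (read as rational functions of $n,\alpha,\delta$ after cancellation of common factors, in case a denominator vanishes). Here $$A(l)=\eta^{(\beta)}_{1,4}l(l-1)(l-2)+\beta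 l(2l-1)-(6-3\beta)(\alpha+\delta/2+\beta n+2-\beta)l-(\alpha+\delta/2+\beta n)(\alpha+\delta/2+\beta n+2-\beta)(l+1),$$ $$B(i,l)=(2-\chi^{(\beta)}_{1,2})(l-i)\Bigl((l-i)(6i-2)+3\Bigr)+(\chi_{1,2}^{(\beta)}-1)(l-i)^2(6i+2),$$ and the "reduced moments" $\mu_l^{(\beta)}$ are obtained from $$\mu_l^{(\beta)}=\sum_{j=0}^{l-1}\binom{l-1}jr^{(\beta)}_{l-j}\mu_j^{(\beta)}\quad(l=1,2,\dots),\qquad\mu_0^{(\beta)}=1,$$ where $r_l^{(\beta)}=\kappa_l^{(\beta)}\bigr|_{n\to n-i(\beta)}+\kappa_l^{(\beta)}\bigr|_{n\to n+i(\beta)}-2\kappa_l^{(\beta)}$.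
   Context: Let $m\ge n\ge 1$ be integers, $\alpha=\frac{\beta}{2}(m-n+1)-1$, and $\delta$ an integer; the pairs considered are $(\beta,\delta)\in\{(1,0),(2,0),(4,0),(4,2),(2,1),(1,-1),(2,-1)\}$. Define $$c_n^{(\beta)}=\int_{[0,1]^n}\prod_{j=1}^nT_j^{\alpha}(1-T_j)^{\delta/2}\prod_{1\le j<k\le n}|T_k-T_j|^\beta\,dT_1\cdots dT_n,$$ $$\mathcal M_n^{(\beta)}(z)=\frac1{c_n^{(\beta)}}\int_{[0,1]^n}\prod_{j=1}^nT_j^\alpha(1-T_j)^{\delta/2}e^{-zT_j}\prod_{1\le j<k\le n}|T_k-T_j|^\beta\,dT_1\cdots dT_n.$$ The cumulants $\kappa_l^{(\beta)}$ of the conductance (depending on $n,\alpha,\delta$) are defined by $\log\mathcal M_n^{(\beta)}(z)=\sum_{l\ge1}\frac{(-1)^l\kappa_l^{(\beta)}}{l!}z^l$. The substitution $n\to n\pm i(\beta)$ is made with $\alpha,\delta$ held fixed; $c_0^{(\beta)}=1$ and all cumulants are $0$ for $n=0$. Set $$b_n^{(1)}=\frac{n(n-1)}{(n+1)(n+2)}\frac{c^{(1)}_{n-2}c^{(1)}_{n+2}}{(c^{(1)}_n)^2},\qquad b_n^{(2)}=0,\qquad b_n^{(4)}=\frac{n}{n+1}\frac{c^{(4)}_{n-1}c^{(4)}_{n+1}}{(c^{(4)}_n)^2},$$ $\eta^{(4)}_{1,4}=4$, $\eta^{(1)}_{1,4}=\eta^{(2)}_{1,4}=1$, $\chi^{(1)}_{1,2}=\chi^{(4)}_{1,2}=1$,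 $\chi^{(2)}_{1,2}=2$, $i(4)=1$, $i(1)=2$. When $\beta=2$, or $\beta=1$ and $n=1$, one has $b_n^{(\beta)}=0$ and the right-hand side of the recurrence is $0$. *)

theory Defs
  imports "HOL-Analysis.Analysis"
begin

(* For n = 0 the product measure is the point mass at the undefined function, so the
   integral is 1. The values of powr at base 0 only matter on a null set. *)
definition jacobi_integral :: "nat \<Rightarrow> real \<Rightarrow> int \<Rightarrow> nat \<Rightarrow> real \<Rightarrow> real" where
  "jacobi_integral \<beta> \<alpha> \<delta> n z =
     (LINT T : ({1..n} \<rightarrow>\<^sub>E {0..1}) | (Pi\<^sub>M {1..n} (\<lambda>_. lborel)).
        (\<Prod>j\<in>{1..n}. T j powr \<alpha> * (1 - T j) powr (of_int \<delta> / 2) * exp (- z * T j)) *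
        (\<Prod>k\<in>{1..n}. \<Prod>j\<in>{1..<k}. \<bar>T k - T j\<bar> ^ \<beta>))"

definition norm_const :: "nat \<Rightarrow> real \<Rightarrow> int \<Rightarrow> nat \<Rightarrow> real" where
  "norm_const \<beta> \<alpha> \<delta> n =
     (LINT T : ({1..n} \<rightarrow>\<^sub>E {0..1}) | (Pi\<^sub>M {1..n} (\<lambda>_. lborel)).
        (\<Prod>j\<in>{1..n}. T j powr \<alpha> * (1 - T j) powr (of_int \<delta> / 2)) *
        (\<Prod>k\<in>{1..n}. \<Prod>j\<in>{1..<k}. \<bar>T k - T j\<bar> ^ \<beta>))"

definition mgf_conductance :: "nat \<Rightarrow> real \<Rightarrow> int \<Rightarrow> nat \<Rightarrow> real \<Rightarrow> real" where
  "mgf_conductance \<beta> \<alpha> \<delta> n z = jacobi_integral \<beta> \<alpha> \<delta> n z / norm_const \<beta> \<alpha> \<delta> n"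

(* (-1)^l \<kappa>_l / l! is the l-th coefficient of the power series of log M at 0,
   i.e. the l-th derivative there divided by l!. *)
definition cumulant :: "nat \<Rightarrow> real \<Rightarrow> int \<Rightarrow> nat \<Rightarrow> nat \<Rightarrow> real" where
  "cumulant \<beta> \<alpha> \<delta> n l =
     (-1) ^ l * (deriv ^^ l) (\<lambda>z. ln (mgf_conductance \<beta> \<alpha> \<delta> n z)) 0"

(* Only i(1) and i(4) are meaningful; the value at 2 is a dummy that is always
   multiplied by b_coeff 2 = 0. *)
definition shift :: "nat \<Rightarrow> nat" where
  "shift \<beta> = (if \<beta> = 4 then 1 else if \<beta> = 1 then 2 else 0)"

(* For \<beta> = 1 and n = 1 the truncated index n - 2 is harmless: the factor n (n - 1) is 0. *)
definition b_coeff :: "nat \<Rightarrow> real \<Rightarrow> int \<Rightarrow> nat \<Rightarrow> real" where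
  "b_coeff \<beta> \<alpha> \<delta> n =
     (if \<beta> = 1 then
        real n * (real n - 1) / ((real n + 1) * (real n + 2)) *
        (norm_const 1 \<alpha> \<delta> (n - 2) * norm_const 1 \<alpha> \<delta> (n + 2) / (norm_const 1 \<alpha> \<delta> n)\<^sup>2)
      else if \<beta> = 4 then
        real n / (real n + 1) *
        (norm_const 4 \<alpha> \<delta> (n - 1) * norm_const 4 \<alpha> \<delta> (n + 1) / (norm_const 4 \<alpha> \<delta> n)\<^sup>2)
      else 0)"

definition eta :: "nat \<Rightarrow> real" where
  "eta \<beta> = (if \<beta> = 4 then 4 else 1)"

definition chi :: "nat \<Rightarrow> real" where
  "chi \<beta> = (if \<beta> = 2 then 2 else 1)"

definition A_coeff :: "nat \<Rightarrow> real \<Rightarrow> int \<Rightarrow> nat \<Rightarrow> nat \<Rightarrow> real" where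
  "A_coeff \<beta> \<alpha> \<delta> n l =
     eta \<beta> * real l * (real l - 1) * (real l - 2) + real \<beta> * real l * (2 * real l - 1)
     - (6 - 3 * real \<beta>) * (\<alpha> + of_int \<delta> / 2 + real \<beta> * real n + 2 - real \<beta>) * real l
     - (\<alpha> + of_int \<delta> / 2 + real \<beta> * real n)
         * (\<alpha> + of_int \<delta> / 2 + real \<beta> * real n + 2 - real \<beta>) * (real l + 1)"

definition B_coeff :: "nat \<Rightarrow> nat \<Rightarrow> nat \<Rightarrow> real" where
  "B_coeff \<beta> i l =
     (2 - chi \<beta>) * (real l - real i) * ((real l - real i) * (6 * real i - 2) + 3)
     + (chi \<beta> - 1) * (real l - real i)\<^sup>2 * (6 * real i + 2)"

definition r_coeff :: "nat \<Rightarrow> real \<Rightarrow> int \<Rightarrow> nat \<Rightarrow> nat \<Rightarrow> real" where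
  "r_coeff \<beta> \<alpha> \<delta> n l =
     cumulant \<beta> \<alpha> \<delta> (n - shift \<beta>) l + cumulant \<beta> \<alpha> \<delta> (n + shift \<beta>) l
     - 2 * cumulant \<beta> \<alpha> \<delta> n l"

fun reduced_moment :: "nat \<Rightarrow> real \<Rightarrow> int \<Rightarrow> nat \<Rightarrow> nat \<Rightarrow> real" where
  "reduced_moment \<beta> \<alpha> \<delta> n 0 = 1"
| "reduced_moment \<beta> \<alpha> \<delta> n (Suc l) =
     (\<Sum>j\<in>{0..l}. real (l choose j) * r_coeff \<beta> \<alpha> \<delta> n (Suc l - j) * reduced_moment \<beta> \<alpha> \<delta> n j)"

definition kappa1_formula :: "nat \<Rightarrow> real \<Rightarrow> int \<Rightarrow> nat \<Rightarrow> real" where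
  "kappa1_formula \<beta> \<alpha> \<delta> n =
     real n * (\<alpha> + 1 + real \<beta> * (real n - 1) / 2)
     / (\<alpha> + of_int \<delta> / 2 + 2 + real \<beta> * (real n - 1))"

definition kappa2_formula :: "nat \<Rightarrow> real \<Rightarrow> int \<Rightarrow> nat \<Rightarrow> real" where
  "kappa2_formula \<beta> \<alpha> \<delta> n =
     1 / 4 *
     (real n * (2 * \<alpha> + 2 + real \<beta> * (real n - 1)) * (of_int \<delta> + 2 + real \<beta> * (real n - 1))
        * (of_int \<delta> + 2 * \<alpha> + 4 + real \<beta> * (real n - 2))
      / ((\<alpha> + of_int \<delta> / 2 + 2 + real \<beta> * (real n - 1))\<^sup>2
        * (\<alpha> + of_int \<delta> / 2 + 3 + real \<beta> * (real n - 1))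
        * (2 * \<alpha> + of_int \<delta> + 4 + real \<beta> * (2 * real n - 3))))"

(* For n = 1 the factor \<alpha> + \<delta>/2 + 2 - \<beta> divides numerator and denominator; where it
   vanishes, the cancelled value is the limit of this expression in \<alpha>. *)
definition kappa3_formula :: "nat \<Rightarrow> real \<Rightarrow> int \<Rightarrow> nat \<Rightarrow> real" where
  "kappa3_formula \<beta> \<alpha> \<delta> n =
     2 * kappa2_formula \<beta> \<alpha> \<delta> n
       * (of_int \<delta> / 2 - \<alpha> + 2 * real \<beta> * kappa1_formula \<beta> \<alpha> \<delta> n - real \<beta> * real n)
     / ((\<alpha> + of_int \<delta> / 2 + 4 + real \<beta> * (real n - 1))
        * (\<alpha> + of_int \<delta> / 2 + 2 + real \<beta> * (real n - 2)))"

end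

theory Submission
  imports Defs
begin

text \<open>
  The \<open>\<beta>\<close>-deformed integral is a determinant (\<open>\<beta> = 2\<close>) or a Pfaffian (\<open>\<beta> = 1, 4\<close>) of moments, and
  inserting a Schur function shifts its row indices.  The three-term exchange relation for Pfaffians
  therefore becomes a bilinear relation between the averages of \<open>s\<^sub>2\<^sub>2\<close>, \<open>s\<^sub>2\<^sub>1\<close>, \<open>s\<^sub>2\<close>, \<open>s\<^sub>1\<^sub>1\<close>, \<open>s\<^sub>1\<close>,
  whose right-hand side is the product of the integrals of sizes \<open>n - i(\<beta>)\<close> and \<open>n + i(\<beta>)\<close>
  (and vanishes for \<open>\<beta> = 2\<close>).
  This is the first Pfaff-KP (KP) equation written without deformation times.
  Integration by parts along the vector fields \<open>x (1 - x)\<close> and \<open>x\<^sup>2 (1 - x)\<close> eliminates the averages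
  involving the second and third power sums, which leaves an ordinary differential equation in \<open>z\<close>
  for \<open>log \<M>\<^sub>n(z)\<close>.  Its Taylor coefficients are the recurrence; the lowest coefficients of the
  constraints are the initial conditions.
\<close>

subsection \<open>Signed deletion sums and Pfaffians\<close>

text \<open>The variable z sees only p1: each z-derivative inserts -p1. The averages of p2, p2^2, p3
  and p1 p3 in the bilinear relation are no z-derivatives of the partition function, and the
  constraints determine them only after multiplication by powers of z. Hence the reduction takes
  place among formal power series in z, and the final equation carries a factor z^3; its right-hand
  side first contributes at l = 3. For \<beta> = 4 every point occupies two rows of a confluent
  Vandermonde determinant, so multiplication by a power sum acts with a factor h = 2. The constant
  12 is the common denominator of the Schur functions in terms of power sums; division by h^2 turns
  it into 12 / \<beta>. Two obstacles shape the details. For \<beta> = 1 the weight has kinks, so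
  integration by parts must tolerate finitely many points without a derivative. And the relation for
  the third cumulant carries the factor c1 - \<beta>, which can vanish when n = 1; there the
  identity p2 = p1^2 supplies a replacement.\<close>

primrec del_sum :: "('a \<Rightarrow> 'a list \<Rightarrow> real) \<Rightarrow> 'a list \<Rightarrow> real" where
  "del_sum h [] = 0"
| "del_sum h (x # xs) = h x xs - del_sum (\<lambda>y ys. h y (x # ys)) xs"

lemma del_sum_cong:
  "(\<And>p y q. xs = p @ y # q \<Longrightarrow> h y (p @ q) = h' y (p @ q)) \<Longrightarrow> del_sum h xs = del_sum h' xs"
proof (induction xs arbitrary: h h')
  case (Cons x xs)
  have "h x xs = h' x xs" using Cons.prems[of "[]" x xs] by simp
  moreover have "del_sum (\<lambda>y ys. h y (x # ys)) xs = del_sum (\<lambda>y ys. h' y (x # ys)) xs"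
  proof (rule Cons.IH)
    fix p y q assume "xs = p @ y # q"
    then show "h y (x # p @ q) = h' y (x # p @ q)" using Cons.prems[of "x # p" y q] by simp
  qed
  ultimately show ?case by simp
qed simp

lemma del_sum_zero [simp]: "del_sum (\<lambda>y ys. 0) xs = 0"
  by (induction xs) auto

lemma del_sum_eq_0:
  "(\<And>p y q. xs = p @ y # q \<Longrightarrow> h y (p @ q) = 0) \<Longrightarrow> del_sum h xs = 0"
  using del_sum_cong[of xs h "\<lambda>_ _. 0"] by simp

lemma del_sum_add: "del_sum (\<lambda>y ys. h y ys + h' y ys) xs = del_sum h xs + del_sum h' xs"
  by (induction xs arbitrary: h h') auto

lemma del_sum_uminus: "del_sum (\<lambda>y ys. - h y ys) xs = - del_sum h xs"
  by (induction xs arbitrary: h) auto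

lemma del_sum_diff: "del_sum (\<lambda>y ys. h y ys - h' y ys) xs = del_sum h xs - del_sum h' xs"
  by (induction xs arbitrary: h h') auto

lemma del_sum_cmult: "del_sum (\<lambda>y ys. c * h y ys) xs = c * del_sum h xs"
  by (induction xs arbitrary: h) (auto simp: algebra_simps)

lemma del_sum_map: "del_sum h (map g xs) = del_sum (\<lambda>y ys. h (g y) (map g ys)) xs"
  by (induction xs arbitrary: h) auto

lemma del_sum_append:
  "del_sum h (xs @ ys) = del_sum (\<lambda>y zs. h y (zs @ ys)) xs
     + (-1) ^ length xs * del_sum (\<lambda>y zs. h y (xs @ zs)) ys"
  by (induction xs arbitrary: h) auto

text \<open>Deleting the earlier of two entries lowers the position of the later one by one, so the
  two orders of deletion come with opposite signs. Determinants inherit their antisymmetry from this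
  by a double expansion, and so do Pfaffians, together with the antisymmetry of the form.\<close>

lemma del_sum_swap:
  "del_sum (\<lambda>y ys. del_sum (\<lambda>z zs. h y z zs) ys) xs
     = - del_sum (\<lambda>y ys. del_sum (\<lambda>z zs. h z y zs) ys) xs"
proof (induction xs arbitrary: h)
  case (Cons x xs)
  show ?case using Cons.IH[of "\<lambda>y z zs. h y z (x # zs)"]
    by (simp add: del_sum_diff)
qed simp

lemma del_sum_sym: "(\<And>y z zs. h y z zs = h z y zs) \<Longrightarrow>
    del_sum (\<lambda>y ys. del_sum (\<lambda>z zs. h y z zs) ys) xs = 0"
  using del_sum_swap[of h xs] by simp

lemma del_sum_commute:
  "del_sum (\<lambda>x xs'. del_sum (\<lambda>y ys'. h x xs' y ys') ys) xs
     = del_sum (\<lambda>y ys'. del_sum (\<lambda>x xs'. h x xs' y ys') xs) ys"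
  by (induction xs arbitrary: h) (auto simp: del_sum_diff)

text \<open>The counter is the number of pairs still to be formed. It serves as fuel, because the
  lists that \<open>del_sum\<close> hands to the recursion are not structurally smaller. On a list
  of odd length one entry stays unmatched and the value is 0, so \<open>pfaffian_Cons\<close> holds
  for both parities.\<close>

primrec pf_aux :: "('a \<Rightarrow> 'a \<Rightarrow> real) \<Rightarrow> nat \<Rightarrow> 'a list \<Rightarrow> real" where
  "pf_aux w 0 xs = (if xs = [] then 1 else 0)"
| "pf_aux w (Suc n) xs =
     (case xs of [] \<Rightarrow> 0 | a # ys \<Rightarrow> del_sum (\<lambda>y zs. w a y * pf_aux w n zs) ys)"

definition pfaffian :: "('a \<Rightarrow> 'a \<Rightarrow> real) \<Rightarrow> 'a list \<Rightarrow> real" where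
  "pfaffian w xs = pf_aux w (length xs div 2) xs"

lemma pfaffian_Nil [simp]: "pfaffian w [] = 1"
  by (simp add: pfaffian_def)

lemma pfaffian_Cons: "pfaffian w (a # xs) = del_sum (\<lambda>y ys. w a y * pfaffian w ys) xs"
proof (cases "xs = []")
  case False
  then have *: "Suc (length xs) div 2 = Suc ((length xs - 1) div 2)"
    by (cases xs) auto
  show ?thesis unfolding pfaffian_def list.size(4) add_Suc_right add_0_right *
    by (simp, rule del_sum_cong) simp
qed (simp add: pfaffian_def)

section \<open>Alternating functions of lists\<close>

definition alternating :: "('a list \<Rightarrow> real) \<Rightarrow> bool" where
  "alternating f \<longleftrightarrow> (\<forall>xs a b ys. f (xs @ a # b # ys) = - f (xs @ b # a # ys))"

lemma alternatingD: "alternating f \<Longrightarrow> f (xs @ a # b # ys) = - f (xs @ b # a # ys)"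
  unfolding alternating_def by blast

lemma alternating_Cons: "alternating f \<Longrightarrow> alternating (\<lambda>xs. f (x # xs))"
  unfolding alternating_def by (metis append_Cons)

lemma alternating_move:
  assumes "alternating f"
  shows "f (xs @ a # ys @ zs) = (-1) ^ length ys * f (xs @ ys @ a # zs)"
proof (induction ys arbitrary: xs)
  case (Cons y ys)
  have "f (xs @ a # (y # ys) @ zs) = - f ((xs @ [y]) @ a # ys @ zs)"
    using alternatingD[OF assms, of xs a y "ys @ zs"] by simp
  also have "\<dots> = - ((-1) ^ length ys * f ((xs @ [y]) @ ys @ a # zs))"
    using Cons.IH[of "xs @ [y]"] by simp
  finally show ?case by simp
qed simp

lemma alternating_repeat:
  assumes "alternating f"
  shows "f (xs @ a # ys @ a # zs) = 0"
proof -
  have "f (xs @ ys @ a # a # zs) = 0"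
    using alternatingD[OF assms, of "xs @ ys" a a zs] by simp
  then show ?thesis using alternating_move[OF assms, of xs a ys "a # zs"] by simp
qed

lemma alternating_not_distinct:
  assumes "alternating f" "\<not> distinct xs"
  shows "f xs = 0"
  using alternating_repeat[OF assms(1)] not_distinct_decomp[OF assms(2)] by force

text \<open>If the exchanged pair is in front, expanding along both entries reduces the claim to
  \<open>del_sum_swap\<close>, and the term pairing a with b changes sign with w. Otherwise expand
  along the first entry: the terms that pair it with a or with b trade places with a sign, and the
  others follow by induction.\<close>

lemma alternating_pfaffian:
  fixes w :: "'a \<Rightarrow> 'a \<Rightarrow> real"
  assumes "\<And>x y. w x y = - w y x"
  shows "alternating (pfaffian w)"
proof -
  have "pfaffian w (xs @ a # b # ys) = - pfaffian w (xs @ b # a # ys)" for xs ys :: "'a list" and a b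
  proof (induction "length xs + length ys" arbitrary: xs ys rule: less_induct)
    case less
    show ?case
    proof (cases xs)
      case Nil
      have *: "del_sum (\<lambda>y zs. w a y * pfaffian w (b # zs)) ys
             = - del_sum (\<lambda>y zs. w b y * pfaffian w (a # zs)) ys"
        using del_sum_swap[of "\<lambda>y z zs. w a y * (w b z * pfaffian w zs)" ys]
        by (simp add: pfaffian_Cons del_sum_cmult mult.left_commute flip: del_sum_cmult)
      show ?thesis using * assms[of a b] unfolding Nil
        by (simp add: pfaffian_Cons[of w a "b # ys"] pfaffian_Cons[of w b "a # ys"])
    next
      case (Cons c us)
      have 1: "del_sum (\<lambda>y zs. w c y * pfaffian w (zs @ a # b # ys)) us
           = - del_sum (\<lambda>y zs. w c y * pfaffian w (zs @ b # a # ys)) us"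
        unfolding del_sum_uminus[symmetric]
      proof (rule del_sum_cong)
        fix p y q assume "us = p @ y # q"
        then have "pfaffian w ((p @ q) @ a # b # ys) = - pfaffian w ((p @ q) @ b # a # ys)"
          by (intro less) (simp add: Cons)
        then show "w c y * pfaffian w ((p @ q) @ a # b # ys) = - (w c y * pfaffian w ((p @ q) @ b # a # ys))"
          by (simp only: mult_minus_right)
      qed
      have 2: "del_sum (\<lambda>y zs. w c y * pfaffian w (us @ a # b # zs)) ys
           = - del_sum (\<lambda>y zs. w c y * pfaffian w (us @ b # a # zs)) ys"
        unfolding del_sum_uminus[symmetric]
      proof (rule del_sum_cong)
        fix p y q assume "ys = p @ y # q"
        then have "pfaffian w (us @ a # b # (p @ q)) = - pfaffian w (us @ b # a # (p @ q))"
          by (intro less) (simp add: Cons)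
        then show "w c y * pfaffian w (us @ a # b # (p @ q)) = - (w c y * pfaffian w (us @ b # a # (p @ q)))"
          by (simp only: mult_minus_right)
      qed
      show ?thesis using 1 2 unfolding Cons
        by (simp add: pfaffian_Cons del_sum_append algebra_simps)
    qed
  qed
  then show ?thesis unfolding alternating_def by blast
qed

lemma pfaffian_snoc:
  assumes w: "\<And>x y. w x y = - w y x" and "odd (length xs)"
  shows "pfaffian w (xs @ [b]) = del_sum (\<lambda>y ys. w y b * pfaffian w ys) xs"
proof -
  have "pfaffian w (xs @ [b]) = - pfaffian w (b # xs)"
    using alternating_move[OF alternating_pfaffian, of w "[]" b xs "[]", OF w] assms(2) by simp
  also have "\<dots> = - del_sum (\<lambda>y ys. - (w y b * pfaffian w ys)) xs"
    unfolding pfaffian_Cons using w[of b] by simp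
  finally show ?thesis unfolding del_sum_uminus by simp
qed

text \<open>Both sides are the double deletion sum of w x y times the Pfaffians of A without x and B
  without y: on the left x # B is expanded along x, on the right A @ [y] along its last entry. The
  odd length of A gives the latter expansion its plus sign.\<close>

lemma pfaffian_exchange:
  assumes w: "\<And>x y. w x y = - w y x" and "odd (length A)"
  shows "del_sum (\<lambda>x A'. pfaffian w A' * pfaffian w (x # B)) A
       = del_sum (\<lambda>y B'. pfaffian w (A @ [y]) * pfaffian w B') B"
proof -
  have "del_sum (\<lambda>x A'. pfaffian w A' * pfaffian w (x # B)) A
     = del_sum (\<lambda>x A'. del_sum (\<lambda>y B'. w x y * pfaffian w A' * pfaffian w B') B) A"
    by (simp add: pfaffian_Cons mult.assoc mult.left_commute[of _ "pfaffian w _"] flip: del_sum_cmult)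
  also have "\<dots> = del_sum (\<lambda>y B'. del_sum (\<lambda>x A'. w x y * pfaffian w A' * pfaffian w B') A) B"
    by (rule del_sum_commute)
  also have "\<dots> = del_sum (\<lambda>y B'. pfaffian w (A @ [y]) * pfaffian w B') B"
    by (simp add: pfaffian_snoc[OF w assms(2)] mult.commute[of _ "pfaffian w _"] flip: del_sum_cmult)
  finally show ?thesis .
qed

text \<open>The exchange relation for I @ [a] and I @ [b, c, d]. Moving an entry of I creates a
  repetition, so only a on one side and b, c, d on the other contribute. With I = 0, ..., m - 1 and
  the next four exponents this becomes the bilinear relation of the ensembles.\<close>

lemma pfaffian_three_term:
  assumes w: "\<And>x y. w x y = - w y x" and ev: "even (length I)"
  shows "pfaffian w I * pfaffian w (I @ [a, b, c, d])
       = pfaffian w (I @ [a, b]) * pfaffian w (I @ [c, d])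
       - pfaffian w (I @ [a, c]) * pfaffian w (I @ [b, d])
       + pfaffian w (I @ [a, d]) * pfaffian w (I @ [b, c])"
proof -
  have alt: "alternating (pfaffian w)" by (rule alternating_pfaffian) (rule w)
  have L: "del_sum (\<lambda>x A'. pfaffian w A' * pfaffian w (x # I @ [b, c, d])) (I @ [a])
      = pfaffian w I * pfaffian w (I @ [a, b, c, d])"
  proof -
    have "del_sum (\<lambda>x zs. pfaffian w (zs @ [a]) * pfaffian w (x # I @ [b, c, d])) I = 0"
    proof (rule del_sum_eq_0)
      fix p y q assume I: "I = p @ y # q"
      have "pfaffian w (y # I @ [b, c, d]) = 0"
        using alternating_repeat[OF alt, of "[]" y p "q @ [b, c, d]"] by (simp add: I)
      then show "pfaffian w ((p @ q) @ [a]) * pfaffian w (y # I @ [b, c, d]) = 0" by simp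
    qed
    moreover have "pfaffian w (a # I @ [b, c, d]) = pfaffian w (I @ [a, b, c, d])"
      using alternating_move[OF alt, of "[]" a I "[b, c, d]"] ev by simp
    ultimately show ?thesis using ev by (simp add: del_sum_append)
  qed
  have R: "del_sum (\<lambda>y B'. pfaffian w ((I @ [a]) @ [y]) * pfaffian w B') (I @ [b, c, d])
      = pfaffian w (I @ [a, b]) * pfaffian w (I @ [c, d])
       - pfaffian w (I @ [a, c]) * pfaffian w (I @ [b, d])
       + pfaffian w (I @ [a, d]) * pfaffian w (I @ [b, c])"
  proof -
    have "del_sum (\<lambda>y zs. pfaffian w ((I @ [a]) @ [y]) * pfaffian w (zs @ [b, c, d])) I = 0"
    proof (rule del_sum_eq_0)
      fix p y q assume I: "I = p @ y # q"
      have "pfaffian w ((I @ [a]) @ [y]) = 0"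
        using alternating_repeat[OF alt, of p y "q @ [a]" "[]"] by (simp add: I)
      then show "pfaffian w ((I @ [a]) @ [y]) * pfaffian w ((p @ q) @ [b, c, d]) = 0" by simp
    qed
    then show ?thesis using ev by (simp add: del_sum_append)
  qed
  show ?thesis using pfaffian_exchange[of w "I @ [a]" "I @ [b, c, d]", OF w] ev L R by simp
qed

lemma pfaffian_map: "pfaffian w (map g xs) = pfaffian (\<lambda>x y. w (g x) (g y)) xs"
proof (induction "length xs" arbitrary: xs rule: less_induct)
  case less
  show ?case
  proof (cases xs)
    case (Cons a ys)
    show ?thesis unfolding Cons list.map pfaffian_Cons del_sum_map
    proof (rule del_sum_cong)
      fix p y q assume "ys = p @ y # q"
      then have "pfaffian w (map g (p @ q)) = pfaffian (\<lambda>x y. w (g x) (g y)) (p @ q)"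
        by (intro less) (simp add: Cons)
      then show "w (g a) (g y) * pfaffian w (map g (p @ q))
          = w (g a) (g y) * pfaffian (\<lambda>x y. w (g x) (g y)) (p @ q)" by simp
    qed
  qed simp
qed

text \<open>A perfect matching has length / 2 pairs, and deleting a pair in both orders
  antisymmetrizes a into c w. This is the combinatorial core of de Bruijn's integration formulas; it
  is applied with c = 2 for \<beta> = 1 and with c = 1 for \<beta> = 4.\<close>

lemma pfaffian_double_expansion:
  assumes a: "\<And>x y. a x y - a y x = c * w x y"
  shows "del_sum (\<lambda>k K. del_sum (\<lambda>m M. a k m * pfaffian w M) K) xs
       = c * (real (length xs) / 2) * pfaffian w xs"
proof (induction "length xs" arbitrary: xs rule: less_induct)
  case less
  show ?case
  proof (cases xs)
    case (Cons x ys)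
    define E where "E = (\<lambda>g. del_sum (\<lambda>k K. del_sum (\<lambda>m M. a k m * g M) K))"
    \<comment> \<open>Expansion along the fixed entry x commutes with the extraction of a pair: the
      third deletion passes the two others and changes sign twice.\<close>
    have comm: "E (\<lambda>M. del_sum (\<lambda>t T. w x t * pfaffian w T) M) ys
        = del_sum (\<lambda>t T. w x t * E (pfaffian w) T) ys"
    proof -
      have "E (\<lambda>M. del_sum (\<lambda>t T. w x t * pfaffian w T) M) ys
         = del_sum (\<lambda>k K. del_sum (\<lambda>m M. del_sum (\<lambda>t T. a k m * w x t * pfaffian w T) M) K) ys"
        by (simp add: E_def mult.assoc flip: del_sum_cmult)
      also have "\<dots> = del_sum (\<lambda>k K. - del_sum (\<lambda>t T. del_sum (\<lambda>m M. a k m * w x t * pfaffian w M) T) K) ys"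
        by (subst del_sum_swap) rule
      also have "\<dots> = del_sum (\<lambda>t T. del_sum (\<lambda>k K. del_sum (\<lambda>m M. a k m * w x t * pfaffian w M) K) T) ys"
        by (subst del_sum_uminus, subst del_sum_swap) simp
      also have "\<dots> = del_sum (\<lambda>t T. w x t * E (pfaffian w) T) ys"
        by (simp add: E_def mult.assoc mult.left_commute[of _ "w x _"] flip: del_sum_cmult)
      finally show ?thesis .
    qed
    have "E (pfaffian w) xs = del_sum (\<lambda>m M. a x m * pfaffian w M) ys
        - del_sum (\<lambda>k K. a k x * pfaffian w K) ys + E (\<lambda>M. pfaffian w (x # M)) ys"
      by (simp add: E_def Cons del_sum_diff)
    \<comment> \<open>The pairs containing x reassemble one copy of the Pfaffian; the remaining
      pairs contribute (length xs - 2) / 2 copies by induction.\<close>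
    also have "del_sum (\<lambda>m M. a x m * pfaffian w M) ys - del_sum (\<lambda>k K. a k x * pfaffian w K) ys
        = c * pfaffian w xs"
      using a by (simp add: Cons pfaffian_Cons mult.assoc flip: del_sum_diff del_sum_cmult left_diff_distrib)
    also have "E (\<lambda>M. pfaffian w (x # M)) ys = del_sum (\<lambda>t T. w x t * E (pfaffian w) T) ys"
      using comm by (simp add: pfaffian_Cons)
    also have "\<dots> = del_sum (\<lambda>t T. c * ((real (length ys) - 1) / 2) * (w x t * pfaffian w T)) ys"
    proof (rule del_sum_cong)
      fix p y q assume ys: "ys = p @ y # q"
      have "E (pfaffian w) (p @ q) = c * (real (length (p @ q)) / 2) * pfaffian w (p @ q)"
        unfolding E_def by (rule less) (use ys Cons in auto)
      then show "w x y * E (pfaffian w) (p @ q)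
          = c * ((real (length ys) - 1) / 2) * (w x y * pfaffian w (p @ q))"
        by (simp add: ys)
    qed
    also have "\<dots> = c * ((real (length ys) - 1) / 2) * pfaffian w xs"
      unfolding del_sum_cmult by (simp add: Cons pfaffian_Cons)
    finally show ?thesis unfolding E_def by (simp add: Cons field_simps)
  qed simp
qed

subsection \<open>Alternants\<close>

text \<open>Laplace expansion along the first row. Rows and columns are labelled by separate lists,
  so that a change of exponents acts on the column list alone. Lists of different lengths give
  0.\<close>

primrec det_list :: "('a \<Rightarrow> 'b \<Rightarrow> real) \<Rightarrow> 'a list \<Rightarrow> 'b list \<Rightarrow> real" where
  "det_list h [] ys = (if ys = [] then 1 else 0)"
| "det_list h (a # xs) ys = del_sum (\<lambda>y zs. h a y * det_list h xs zs) ys"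

lemma alternating_del_sum:
  assumes "alternating g"
  shows "alternating (del_sum (\<lambda>y zs. c y * g zs))"
  unfolding alternating_def
proof (intro allI)
  fix xs ys :: "'a list" and a b
  have g: "g (zs @ a # b # us) = - g (zs @ b # a # us)" for zs us
    by (rule alternatingD[OF assms])
  have "del_sum (\<lambda>y zs. c y * g (zs @ a # b # ys)) xs = - del_sum (\<lambda>y zs. c y * g (zs @ b # a # ys)) xs"
    "del_sum (\<lambda>y zs. c y * g (xs @ a # b # zs)) ys = - del_sum (\<lambda>y zs. c y * g (xs @ b # a # zs)) ys"
    unfolding g[of _ ys] g[of xs] by (simp_all add: del_sum_uminus)
  then show "del_sum (\<lambda>y zs. c y * g zs) (xs @ a # b # ys) = - del_sum (\<lambda>y zs. c y * g zs) (xs @ b # a # ys)"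
    by (simp add: del_sum_append algebra_simps)
qed

lemma alternating_det_list: "alternating (det_list h xs)"
proof (induction xs)
  case (Cons a xs)
  show ?case using alternating_del_sum[OF Cons, of "h a"] by simp
qed (auto simp: alternating_def)

lemma alternating_det_list_rows: "alternating (\<lambda>xs. det_list h xs ys)"
proof -
  have "det_list h (xs @ a # b # us) ys = - det_list h (xs @ b # a # us) ys" for xs a b us
  proof (induction xs arbitrary: ys)
    case Nil
    show ?case
      using del_sum_swap[of "\<lambda>y z zs. h a y * (h b z * det_list h us zs)" ys]
      by (simp add: mult.left_commute flip: del_sum_cmult)
  next
    case (Cons x xs)
    then show ?case by (simp add: del_sum_uminus)
  qed
  then show ?thesis unfolding alternating_def by blast
qed

lemma det_list_map_cols: "det_list h xs (map g ys) = det_list (\<lambda>x y. h x (g y)) xs ys"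
  by (induction xs arbitrary: ys) (auto simp: del_sum_map)

lemma det_list_scale_rows:
  assumes "\<And>x y. x \<in> set xs \<Longrightarrow> h' x y = c x * h x y"
  shows "det_list h' xs ys = prod_list (map c xs) * det_list h xs ys"
  using assms
  by (induction xs arbitrary: ys) (auto simp: mult_ac simp flip: del_sum_cmult)

lemma det_list_col_add:
  assumes "\<And>x. x \<in> set xs \<Longrightarrow> h x y = c * h x y1 + d * h x y2"
  shows "det_list h xs (p @ y # q) = c * det_list h xs (p @ y1 # q) + d * det_list h xs (p @ y2 # q)"
  using assms
proof (induction xs arbitrary: p q)
  case (Cons x xs)
  then have IH: "det_list h xs (p @ y # q) = c * det_list h xs (p @ y1 # q) + d * det_list h xs (p @ y2 # q)" for p q
    by simp
  have *: "del_sum (\<lambda>z zs. h x z * (c * f zs + d * g zs)) us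
      = c * del_sum (\<lambda>z zs. h x z * f zs) us + d * del_sum (\<lambda>z zs. h x z * g zs) us" for f g us
    by (simp add: algebra_simps flip: del_sum_add del_sum_cmult)
  have h: "h x y = c * h x y1 + d * h x y2" using Cons.prems by simp
  show ?case by (simp add: del_sum_append IH * h) (simp add: algebra_simps)
qed simp

context
  fixes h :: "'r \<Rightarrow> real poly \<Rightarrow> real"
  assumes h_add: "\<And>r p q. h r (p + q) = h r p + h r q"
    and h_smult: "\<And>r c p. h r (smult c p) = c * h r p"
begin

lemma det_list_poly_add:
  "det_list h xs (p @ (u + v) # q) = det_list h xs (p @ u # q) + det_list h xs (p @ v # q)"
  using det_list_col_add[of xs h "u + v" 1 u 1 v p q] by (simp add: h_add)

lemma det_list_poly_smult: "det_list h xs (p @ smult c u # q) = c * det_list h xs (p @ u # q)"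
  using det_list_col_add[of xs h "smult c u" c u 0 u p q] by (simp add: h_smult)

lemma det_list_poly_0: "det_list h xs (p @ 0 # q) = 0"
  using det_list_poly_smult[of xs p 0 0 q] by simp

lemma det_list_poly_low_degree:
  assumes "degree s < k \<or> s = 0"
  shows "det_list h xs (map (monom 1) [0..<k] @ s # q) = 0"
proof -
  have "det_list h xs (map (monom 1) [0..<k] @ (\<Sum>i<j. monom (coeff s i) i) # q) = 0" if "j \<le> k" for j
    using that
  proof (induction j)
    case (Suc j)
    have "det_list h xs (map (monom 1) [0..<k] @ monom 1 j # q) = 0"
    proof -
      have "\<not> distinct (map (monom (1::real)) [0..<k] @ monom 1 j # q)" using Suc.prems by auto
      then show ?thesis by (rule alternating_not_distinct[OF alternating_det_list])
    qed
    moreover have "monom (coeff s j) j = smult (coeff s j) (monom 1 j)" by (simp add: smult_monom)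
    ultimately show ?case using Suc by (simp add: det_list_poly_add det_list_poly_smult)
  qed (simp add: det_list_poly_0)
  moreover have "(\<Sum>i<k. monom (coeff s i) i) = s"
  proof (cases "s = 0")
    case False
    then have "(\<Sum>i\<le>k - 1. monom (coeff s i) i) = s"
      using assms by (intro poly_as_sum_of_monoms') auto
    moreover have "{..k - 1} = {..<k}" using assms False by auto
    ultimately show ?thesis by simp
  qed simp
  ultimately show ?thesis by (metis order_refl)
qed

text \<open>The columns are exchanged one at a time. When column k is treated, those before it are
  1, ..., t^(k-1), and q k differs from t^k by a combination of these, which contributes nothing.
  The linear functional h covers evaluation at a point as well as evaluation of the
  derivative.\<close>

lemma det_list_monic:
  assumes "\<And>i. i < n \<Longrightarrow> degree (q i) = i \<and> lead_coeff (q i) = 1"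
  shows "det_list h xs (map (monom 1) [0..<n]) = det_list h xs (map q [0..<n])"
proof -
  have "det_list h xs (map (monom 1) [0..<k] @ map q [k..<n]) = det_list h xs (map q [0..<n])"
    if "k \<le> n" for k
    using that
  proof (induction k)
    case (Suc k)
    define s where "s = q k - monom 1 k"
    have s: "q k = monom 1 k + s" by (simp add: s_def)
    have "degree s < k \<or> s = 0"
    proof (cases "s = 0")
      case False
      have "degree s \<le> k" using assms[of k] Suc.prems
        by (auto simp: s_def degree_monom_eq intro!: degree_diff_le)
      moreover have "coeff s k = 0" using assms[of k] Suc.prems
        by (metis Suc_le_lessD coeff_diff coeff_monom diff_self s_def)
      ultimately show ?thesis using False
        by (metis leading_coeff_0_iff le_neq_implies_less)
    qed simp
    then have "det_list h xs (map (monom 1) [0..<k] @ q k # map q [Suc k..<n])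
       = det_list h xs (map (monom 1) [0..<k] @ monom 1 k # map q [Suc k..<n])"
      unfolding s det_list_poly_add using det_list_poly_low_degree by simp
    moreover have "[k..<n] = k # [Suc k..<n]" using Suc.prems by (simp add: upt_conv_Cons)
    ultimately show ?case using Suc by simp
  qed simp
  from this[of n] show ?thesis by simp
qed

end

section \<open>Vandermonde determinants, simple and confluent\<close>

primrec vandermonde :: "real list \<Rightarrow> real" where
  "vandermonde [] = 1"
| "vandermonde (x # xs) = (\<Prod>y\<leftarrow>xs. y - x) * vandermonde xs"

lemma prod_list_map_power: "(\<Prod>y\<leftarrow>xs. f y ^ n) = (\<Prod>y\<leftarrow>xs. f y :: real) ^ n"
  by (induction xs) (auto simp: power_mult_distrib)

lemma del_sum_first:
  assumes "\<And>y ys. y \<in> set xs \<Longrightarrow> h y ys = 0"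
  shows "del_sum h (x # xs) = h x xs"
  by (simp, rule del_sum_eq_0) (use assms in auto)

lemma map_upt_Suc0: "map f [0..<Suc n] = f 0 # map (\<lambda>i. f (Suc i)) [0..<n]"
  by (simp add: upt_conv_Cons map_Suc_upt[symmetric] del: upt_Suc)

lemma det_list_powers: "det_list (\<lambda>x l. x ^ l) xs [0..<length xs] = vandermonde xs"
proof -
  have eq: "det_list (\<lambda>x l. x ^ l) xs ls = det_list (\<lambda>x q. poly q x) xs (map (monom 1) ls)" for xs ls
    unfolding det_list_map_cols by (simp add: poly_monom)
  have "det_list (\<lambda>x q. poly q x) xs (map (monom 1) [0..<length xs]) = vandermonde xs"
  proof (induction xs)
    case (Cons x xs)
    define n where "n = length xs"
    \<comment> \<open>With the columns 1, t - x, (t - x) t, ... the row of the point x is (1, 0, 0,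
      ...), and beyond the first column every other row y carries the common factor y - x.\<close>
    define q where "q = (\<lambda>i. case i of 0 \<Rightarrow> 1 | Suc j \<Rightarrow> [:- x, 1:] * monom 1 j)"
    have "det_list (\<lambda>x q. poly q x) (x # xs) (map (monom 1) [0..<Suc n])
        = det_list (\<lambda>x q. poly q x) (x # xs) (map q [0..<Suc n])"
    proof (rule det_list_monic)
      fix i assume "i < Suc n"
      show "degree (q i) = i \<and> lead_coeff (q i) = 1"
      proof (cases i)
        case (Suc j)
        have "degree (q i) = i" unfolding Suc q_def
          by (simp add: degree_mult_eq degree_monom_eq del: mult_pCons_left)
        moreover have "lead_coeff (q i) = 1" unfolding Suc q_def nat.case
          by (simp only: lead_coeff_mult) (simp add: degree_monom_eq)
        ultimately show ?thesis by simp
      qed (simp add: q_def)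
    qed simp_all
    also have "\<dots> = det_list (\<lambda>x q. poly q x) xs (map (\<lambda>i. [:- x, 1:] * monom 1 i) [0..<n])"
      unfolding map_upt_Suc0 det_list.simps
      by (subst del_sum_first) (auto simp: q_def)
    also have "\<dots> = (\<Prod>y\<leftarrow>xs. y - x) * det_list (\<lambda>x q. poly q x) xs (map (monom 1) [0..<n])"
      unfolding det_list_map_cols by (rule det_list_scale_rows) (simp add: algebra_simps)
    finally show ?case using Cons by (simp add: n_def)
  qed simp
  then show ?thesis by (simp add: eq)
qed

text \<open>\<open>False\<close> marks the row of values at a point and \<open>True\<close> the row
  of derivatives: the confluent limit of two coinciding points, which yields the fourth power needed
  for \<beta> = 4.\<close>

primrec double_rows :: "'a list \<Rightarrow> ('a \<times> bool) list" where
  "double_rows [] = []"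
| "double_rows (x # xs) = (x, False) # (x, True) # double_rows xs"

text \<open>This is the product rule: multiplying all column functions by s scales the value row by
  s(x), while the derivative row is scaled by s(x) and gains s'(x) times the value row. The gain
  drops out by \<open>del_sum_sym\<close>, which leaves s(x)^2 for each point.\<close>

lemma det_list_scale_double_rows:
  assumes "\<And>x y. x \<in> set xs \<Longrightarrow> h' (x, False) y = c x * h (x, False) y"
    and "\<And>x y. x \<in> set xs \<Longrightarrow> h' (x, True) y = c x * h (x, True) y + d x * h (x, False) y"
  shows "det_list h' (double_rows xs) ys = (\<Prod>x\<leftarrow>xs. (c x)\<^sup>2) * det_list h (double_rows xs) ys"
  using assms
proof (induction xs arbitrary: ys)
  case (Cons x xs)
  define g where "g = det_list h (double_rows xs)"
  define C where "C = (\<Prod>x\<leftarrow>xs. (c x)\<^sup>2)"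
  have IH: "det_list h' (double_rows xs) zs = C * g zs" for zs
    using Cons unfolding g_def C_def by simp
  have z: "del_sum (\<lambda>y ys. del_sum (\<lambda>z zs. h (x, False) y * h (x, False) z * g zs) ys) ys = 0"
    by (rule del_sum_sym) simp
  have "det_list h' (double_rows (x # xs)) ys
      = del_sum (\<lambda>y ys. del_sum (\<lambda>z zs. ((c x)\<^sup>2 * C) * (h (x, False) y * (h (x, True) z * g zs))
          + (c x * d x * C) * (h (x, False) y * h (x, False) z * g zs)) ys) ys"
    using Cons.prems[of x] by (simp add: IH power2_eq_square algebra_simps flip: del_sum_cmult)
  also have "\<dots> = (c x)\<^sup>2 * C * del_sum (\<lambda>y ys. h (x, False) y * del_sum (\<lambda>z zs. h (x, True) z * g zs) ys) ys"
    unfolding del_sum_add del_sum_cmult z by simp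
  finally show ?case by (simp add: g_def C_def)
qed simp

definition confluent_entry :: "real \<times> bool \<Rightarrow> nat \<Rightarrow> real" where
  "confluent_entry r l = (if snd r then real l * fst r ^ (l - 1) else fst r ^ l)"

lemma det_list_confluent:
  "det_list confluent_entry (double_rows xs) [0..<2 * length xs] = vandermonde xs ^ 4"
proof -
  define h where "h = (\<lambda>(r::real \<times> bool) (q::real poly). if snd r then poly (pderiv q) (fst r) else poly q (fst r))"
  have eq: "det_list confluent_entry xs ls = det_list h xs (map (monom 1) ls)" for xs ls
    unfolding det_list_map_cols
    by (rule arg_cong[of _ _ "\<lambda>h. det_list h xs ls"])
      (auto simp: fun_eq_iff h_def confluent_entry_def poly_monom pderiv_monom)
  have "det_list h (double_rows xs) (map (monom 1) [0..<2 * length xs]) = vandermonde xs ^ 4"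
  proof (induction xs)
    case (Cons x xs)
    define n where "n = 2 * length xs"
    define s where "s = [:- x, 1:]\<^sup>2"
    have ps: "poly s y = (y - x)\<^sup>2" "poly (pderiv s) y = 2 * (y - x)" for y
      by (simp_all add: s_def pderiv_power power2_eq_square algebra_simps pderiv_pCons pderiv_mult)
    have "lead_coeff s = 1" unfolding s_def lead_coeff_power by simp
    then have sd: "degree s = 2" "lead_coeff s = 1" "s \<noteq> 0"
      by (auto simp: s_def degree_power_eq)
    then have "coeff s 2 = 1" by metis
    note sd = this sd
    \<comment> \<open>A basis adapted to the double point x: the columns 1 and t - x give its two
      rows an identity block, and s t^j vanishes there to second order. What remains has the factor
      s, hence (y - x)^4 for every other point y.\<close>
    define q where "q = (\<lambda>i. case i of 0 \<Rightarrow> 1 | Suc 0 \<Rightarrow> [:- x, 1:] | Suc (Suc j) \<Rightarrow> s * monom 1 j)"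
    have "det_list h (double_rows (x # xs)) (map (monom 1) [0..<Suc (Suc n)])
        = det_list h (double_rows (x # xs)) (map q [0..<Suc (Suc n)])"
    proof (rule det_list_monic)
      fix i assume "i < Suc (Suc n)"
      consider "i = 0" | "i = 1" | j where "i = Suc (Suc j)" by (metis One_nat_def not0_implies_Suc)
      then show "degree (q i) = i \<and> lead_coeff (q i) = 1"
      proof cases
        case 3
        have "degree (q i) = i" unfolding 3 q_def using sd
          by (simp add: degree_mult_eq degree_monom_eq)
        moreover have "lead_coeff (q i) = 1" unfolding 3 q_def nat.case
          by (simp only: lead_coeff_mult) (use sd in \<open>simp add: degree_monom_eq\<close>)
        ultimately show ?thesis by simp
      qed (auto simp: q_def)
    qed (auto simp: h_def pderiv_add pderiv_smult)
    also have "\<dots> = det_list h (double_rows xs) (map (\<lambda>i. s * monom 1 i) [0..<n])"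
    proof -
      have q: "map q [0..<Suc (Suc n)] = q 0 # q 1 # map (\<lambda>i. s * monom 1 i) [0..<n]"
        unfolding map_upt_Suc0 by (simp add: q_def)
      have v: "h (x, False) (q 1) = 0" "h (x, False) (s * monom 1 i) = 0" "h (x, True) (s * monom 1 i) = 0"
        "h (x, False) (q 0) = 1" "h (x, True) (q 1) = 1" for i
        by (auto simp: h_def q_def pderiv_mult ps pderiv_pCons)
      show ?thesis unfolding q double_rows.simps det_list.simps(2)
        by (subst del_sum_first, use v in force)
          (simp only: v mult_1, subst del_sum_first, use v in force, simp add: v del: One_nat_def)
    qed
    also have "\<dots> = (\<Prod>y\<leftarrow>xs. ((y - x)\<^sup>2)\<^sup>2) * det_list h (double_rows xs) (map (monom 1) [0..<n])"
      unfolding det_list_map_cols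
      by (rule det_list_scale_double_rows[where d = "\<lambda>y. 2 * (y - x)"])
        (auto simp: h_def ps pderiv_mult algebra_simps)
    finally show ?case using Cons
      by (simp add: n_def prod_list_map_power power_mult_distrib flip: power_mult)
  qed simp
  then show ?thesis by (simp add: eq)
qed

text \<open>Multiplication by the power sum p_k in terms of exponents: one exponent at a time is
  raised by k. On alternants this is the Murnaghan-Nakayama rule, with the signs produced by sorting
  the exponents.\<close>

primrec shift_sum :: "nat \<Rightarrow> (nat list \<Rightarrow> real) \<Rightarrow> nat list \<Rightarrow> real" where
  "shift_sum k g [] = 0"
| "shift_sum k g (l # ls) = g ((l + k) # ls) + shift_sum k (\<lambda>M. g (l # M)) ls"

lemma shift_sum_linear:
  "shift_sum k (\<lambda>M. f M - g M) ls = shift_sum k f ls - shift_sum k g ls"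
  "shift_sum k (\<lambda>M. c * f M) ls = c * shift_sum k f ls"
  by (induction ls arbitrary: f g) (auto simp: algebra_simps)

lemma shift_sum_append:
  "shift_sum k g (ls @ ms) = shift_sum k (\<lambda>L. g (L @ ms)) ls + shift_sum k (\<lambda>M. g (ls @ M)) ms"
  by (induction ls arbitrary: g) auto

lemma shift_sum_eq_0:
  assumes "\<And>p l q. ls = p @ l # q \<Longrightarrow> g (p @ (l + k) # q) = 0"
  shows "shift_sum k g ls = 0"
  using assms
proof (induction ls arbitrary: g)
  case (Cons l ls)
  have "g ((l + k) # ls) = 0" using Cons.prems[of "[]" l ls] by simp
  moreover have "shift_sum k (\<lambda>M. g (l # M)) ls = 0"
  proof (rule Cons.IH)
    fix p m q assume "ls = p @ m # q"
    then show "g (l # p @ (m + k) # q) = 0" using Cons.prems[of "l # p" m q] by simp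
  qed
  ultimately show ?case by simp
qed simp

lemma shift_sum_del_sum:
  "shift_sum k (del_sum h) ls = del_sum (\<lambda>l L. h (l + k) L + shift_sum k (h l) L) ls"
proof (induction ls arbitrary: h)
  case (Cons l ls)
  have "shift_sum k (del_sum h) (l # ls)
      = h (l + k) ls - del_sum (\<lambda>y ys. h y ((l + k) # ys)) ls
        + (shift_sum k (h l) ls - shift_sum k (del_sum (\<lambda>y ys. h y (l # ys))) ls)"
    by (simp add: shift_sum_linear)
  also have "\<dots> = del_sum (\<lambda>l L. h (l + k) L + shift_sum k (h l) L) (l # ls)"
    by (simp add: Cons del_sum_add)
  finally show ?case .
qed simp

lemma shift_sum_powers:
  "shift_sum k (det_list (\<lambda>x l. x ^ l) xs) ls = (\<Sum>x\<leftarrow>xs. x ^ k) * det_list (\<lambda>x l. x ^ l) xs ls"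
proof (induction xs arbitrary: ls)
  case Nil
  have "shift_sum k (\<lambda>ls. if ls = [] then 1 else 0) ls = 0"
    by (rule shift_sum_eq_0) simp
  then show ?case by simp
next
  case (Cons x xs)
  show ?case
    by (simp add: shift_sum_del_sum shift_sum_linear Cons power_add algebra_simps del_sum_add
        flip: del_sum_cmult)
qed

text \<open>Each point owns two rows, hence the factor 2. Raising an exponent under the derivative
  also produces k x^(k-1) times the value row; this is symmetric in the two deleted columns and
  cancels. Since 1 \<le> k, the exponent k - 1 is not truncated.\<close>

lemma shift_sum_confluent:
  assumes "1 \<le> k"
  shows "shift_sum k (det_list confluent_entry (double_rows xs)) ls
    = 2 * (\<Sum>x\<leftarrow>xs. x ^ k) * det_list confluent_entry (double_rows xs) ls"
proof (induction xs arbitrary: ls)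
  case Nil
  have "shift_sum k (\<lambda>ls. if ls = [] then 1 else 0) ls = 0"
    by (rule shift_sum_eq_0) simp
  then show ?case by simp
next
  case (Cons x xs)
  define g where "g = det_list confluent_entry (double_rows xs)"
  define s where "s = (\<Sum>x\<leftarrow>xs. x ^ k)"
  have c: "confluent_entry (x, False) l = x ^ l" "confluent_entry (x, True) l = real l * x ^ (l - 1)" for l
    by (simp_all add: confluent_entry_def)
  have d: "real (l + k) * x ^ (l + k - 1) = x ^ k * (real l * x ^ (l - 1)) + real k * x ^ (k - 1) * x ^ l" for l
  proof -
    have "real l * x ^ (l + k - 1) = x ^ k * (real l * x ^ (l - 1))"
      by (cases l) (auto simp: power_add algebra_simps)
    moreover have "x ^ (l + k - 1) = x ^ (k - 1) * x ^ l"
      using assms by (cases k) (auto simp: power_add algebra_simps)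
    ultimately show ?thesis by (simp add: algebra_simps)
  qed
  have z: "del_sum (\<lambda>y ys. del_sum (\<lambda>z zs. x ^ y * x ^ z * g zs) ys) ls = 0"
    by (rule del_sum_sym) simp
  have e: "det_list confluent_entry (double_rows (x # xs))
      = del_sum (\<lambda>l L. x ^ l * del_sum (\<lambda>m M. (real m * x ^ (m - 1)) * g M) L)"
    by (rule ext) (simp add: c g_def)
  have "shift_sum k (det_list confluent_entry (double_rows (x # xs))) ls
     = del_sum (\<lambda>l L. del_sum (\<lambda>m M. (2 * x ^ k + 2 * s) * (x ^ l * (real m * x ^ (m - 1) * g M))
          + real k * x ^ (k - 1) * (x ^ l * x ^ m * g M)) L) ls"
    unfolding e shift_sum_del_sum shift_sum_linear d Cons[folded g_def s_def]
    by (simp add: power_add algebra_simps flip: del_sum_cmult del_sum_add)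
  also have "\<dots> = (2 * x ^ k + 2 * s) * del_sum (\<lambda>l L. x ^ l * del_sum (\<lambda>m M. real m * x ^ (m - 1) * g M) L) ls"
    unfolding del_sum_add del_sum_cmult z by simp
  finally show ?case unfolding e by (simp add: s_def distrib_left)
qed

text \<open>Raising l < m by k lands on another entry of the initial block or in the window m, ...,
  m + k - 1 contained in t, and a repeated exponent makes A vanish. So only the exponents in t can
  move.\<close>

lemma shift_sum_initial:
  assumes "alternating A" and "{m..<m + k} \<subseteq> set t" and "1 \<le> k"
  shows "shift_sum k (\<lambda>L. A (L @ t)) [0..<m] = 0"
proof (rule shift_sum_eq_0)
  fix p l q assume e: "[0..<m] = p @ l # q"
  have len: "length p + length q + 1 = m" using arg_cong[OF e, of length] by simp
  have "l = [0..<m] ! length p" unfolding e by simp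
  then have l: "l = length p" "length p + length q + 1 = m" using len by auto
  have p: "p = [0..<l]" and q: "q = [Suc l..<m]"
    using arg_cong[OF e, of "take l"] arg_cong[OF e, of "drop (Suc l)"] l by (auto simp: take_upt)
  have "\<not> distinct ((p @ (l + k) # q) @ t)"
  proof (cases "l + k < m")
    case True
    then have "l + k \<in> set q" using assms(3) by (auto simp: q)
    then show ?thesis by auto
  next
    case False
    then have "l + k \<in> set t" using assms(2) l by auto
    then show ?thesis by auto
  qed
  then show "A ((p @ (l + k) # q) @ t) = 0" by (rule alternating_not_distinct[OF assms(1)])
qed

text \<open>Let \<open>s\<^sub>\<lambda>\<close> be the alternant with the exponents \<open>0, \<dots>, m + 1\<close> shifted by \<open>\<lambda>\<close>, divided by the
  unshifted one.  The five equations express \<open>s\<^sub>1\<close>, \<open>s\<^sub>2\<close>, \<open>s\<^sub>1\<^sub>1\<close>, \<open>s\<^sub>2\<^sub>1\<close> and \<open>s\<^sub>2\<^sub>2\<close> by power sums.\<close>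

lemma alternant_power_sums:
  fixes A :: "nat list \<Rightarrow> real" and m :: nat
  assumes alt: "alternating A"
    and P: "\<And>k ls. 1 \<le> k \<Longrightarrow> P k * A ls = shift_sum k A ls"
  defines "I \<equiv> [0..<m]"
  shows "P 1 * A (I @ [m, m+1]) = A (I @ [m, m+2])"
    and "((P 1)\<^sup>2 + P 2) * A (I @ [m, m+1]) = 2 * A (I @ [m, m+3])"
    and "((P 1)\<^sup>2 - P 2) * A (I @ [m, m+1]) = 2 * A (I @ [m+1, m+2])"
    and "(P 1 ^ 3 - P 3) * A (I @ [m, m+1]) = 3 * A (I @ [m+1, m+3])"
    and "(P 1 ^ 4 + 3 * (P 2)\<^sup>2 - 4 * (P 1 * P 3)) * A (I @ [m, m+1]) = 12 * A (I @ [m+2, m+3])"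
proof -
  \<comment> \<open>The Pieri rule for p1 and the Murnaghan-Nakayama rule for p2 and p3, in the
    degrees up to four that occur. The auxiliary values s3, s31, s4, s111 and s211 cancel in the
    final combinations.\<close>
  have "\<exists>s2 s11 s21 s22 s111 s3 s31 s4 s211.
      P 1 * A (I @ [m, m+1]) = A (I @ [m, m+2]) \<and> s2 = A (I @ [m, m+3]) \<and> s11 = A (I @ [m+1, m+2])
      \<and> s21 = A (I @ [m+1, m+3]) \<and> s22 = A (I @ [m+2, m+3])
      \<and> P 1 * A (I @ [m, m+2]) = s2 + s11 \<and> P 2 * A (I @ [m, m+1]) = s2 - s11
      \<and> P 1 * s2 = s3 + s21 \<and> P 1 * s11 = s21 + s111 \<and> P 3 * A (I @ [m, m+1]) = s3 - s21 + s111
      \<and> P 1 * s21 = s31 + s22 + s211 \<and> P 1 * s3 = s4 + s31 \<and> P 2 * s2 = s4 + s22 - s211"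
  proof (cases m)
    \<comment> \<open>With only two exponents there are no partitions with three rows, so s111 and
      s211 are 0.\<close>
    case 0
    have anti: "A [b, a] = - A [a, b]" for a b using alternatingD[OF alt, of "[]" b a "[]"] by simp
    have rep: "A [a, a] = 0" for a using anti[of a a] by simp
    note r = rep anti[of 2 1] anti[of 3 1] anti[of 3 2] anti[of 4 1]
    show ?thesis
      by (rule exI[of _ "A [0,3]"], rule exI[of _ "A [1,2]"], rule exI[of _ "A [1,3]"], rule exI[of _ "A [2,3]"],
          rule exI[of _ 0], rule exI[of _ "A [0,4]"], rule exI[of _ "A [1,4]"], rule exI[of _ "A [0,5]"], rule exI[of _ 0])
        (simp add: 0 I_def P r numeral_2_eq_2[symmetric] del: One_nat_def)
  next
    case (Suc M)
    define J where "J = [0..<M]"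
    have I: "I = J @ [M]" by (simp add: I_def J_def Suc)
    \<comment> \<open>Three top exponents suffice: a shift by k is applied only to triples
      containing 0, ..., k - 1, so by \<open>shift_sum_initial\<close> all exponents below M stay
      put.\<close>
    define B where "B = (\<lambda>a b c. A (J @ [M + a, M + b, M + c]))"
    have anti: "B b a c = - B a b c" "B a c b = - B a b c" for a b c
      using alternatingD[OF alt, of J "M + b" "M + a" "[M + c]"]
        alternatingD[OF alt, of "J @ [M + a]" "M + c" "M + b" "[]"] by (simp_all add: B_def)
    have rep: "B a a c = 0" "B a c a = 0" "B a c c = 0" for a c
      using anti(1)[of a a c] anti(2)[of a c c] anti(2)[of a c a] by simp_all
    have sh: "P k * B a b c = B (a + k) b c + B a (b + k) c + B a b (c + k)"
      if "1 \<le> k" "{0..<k} \<subseteq> {a, b, c}" for k a b c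
    proof -
      have "{M..<M + k} \<subseteq> {M + a, M + b, M + c}"
      proof
        fix x assume "x \<in> {M..<M + k}"
        then have "x - M \<in> {0..<k}" by auto
        then have "x - M \<in> {a, b, c}" using that by blast
        then show "x \<in> {M + a, M + b, M + c}" using \<open>x \<in> {M..<M + k}\<close> by auto
      qed
      then have "shift_sum k (\<lambda>L. A (L @ [M + a, M + b, M + c])) J = 0"
        unfolding J_def by (intro shift_sum_initial alt) (use that in auto)
      then show ?thesis using P[of k "J @ [M + a, M + b, M + c]"] that
        by (simp add: B_def shift_sum_append add.assoc)
    qed
    have AB: "A (I @ [m + b, m + c]) = B 0 (b + 1) (c + 1)" for b c
      by (simp add: I B_def Suc)
    have AB0: "A (I @ [m, m + c]) = B 0 1 (c + 1)" for c
      using AB[of 0 c] by simp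
    have *: "P 1 * B 0 1 2 = B 0 1 3" "P 1 * B 0 1 3 = B 0 1 4 + B 0 2 3" "P 2 * B 0 1 2 = B 0 1 4 - B 0 2 3"
      "P 1 * B 0 1 4 = B 0 1 5 + B 0 2 4" "P 1 * B 0 2 3 = B 0 2 4 + B 1 2 3"
      "P 3 * B 0 1 2 = B 0 1 5 - B 0 2 4 + B 1 2 3"
      "P 1 * B 0 2 4 = B 0 2 5 + B 0 3 4 + B 1 2 4" "P 1 * B 0 1 5 = B 0 1 6 + B 0 2 5"
      "P 2 * B 0 1 4 = B 0 1 6 + B 0 3 4 - B 1 2 4"
    proof -
      have iv: "{0..<1} = {0::nat}" "{0..<2} = {0::nat, 1}" "{0..<3} = {0::nat, 1, 2}" by auto
      note r = rep anti(1)[of 2 1] anti(1)[of 3 1] anti(1)[of 3 2] anti(2)[of _ 3 2] anti(2)[of _ 4 2]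
      show "P 1 * B 0 1 2 = B 0 1 3" using sh[of 1 0 1 2] by (simp add: iv r numeral_2_eq_2[symmetric] del: One_nat_def)
      show "P 1 * B 0 1 3 = B 0 1 4 + B 0 2 3" using sh[of 1 0 1 3] by (simp add: iv r del: One_nat_def)
      show "P 2 * B 0 1 2 = B 0 1 4 - B 0 2 3" using sh[of 2 0 1 2] by (simp add: iv r numeral_2_eq_2[symmetric] del: One_nat_def)
      show "P 1 * B 0 1 4 = B 0 1 5 + B 0 2 4" using sh[of 1 0 1 4] by (simp add: iv r del: One_nat_def)
      show "P 1 * B 0 2 3 = B 0 2 4 + B 1 2 3" using sh[of 1 0 2 3] by (simp add: iv r del: One_nat_def)
      show "P 3 * B 0 1 2 = B 0 1 5 - B 0 2 4 + B 1 2 3" using sh[of 3 0 1 2]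
        by (simp add: iv r del: One_nat_def)
      show "P 1 * B 0 2 4 = B 0 2 5 + B 0 3 4 + B 1 2 4" using sh[of 1 0 2 4] by (simp add: iv r del: One_nat_def)
      show "P 1 * B 0 1 5 = B 0 1 6 + B 0 2 5" using sh[of 1 0 1 5] by (simp add: iv r del: One_nat_def)
      show "P 2 * B 0 1 4 = B 0 1 6 + B 0 3 4 - B 1 2 4" using sh[of 2 0 1 4] by (simp add: iv r numeral_2_eq_2[symmetric] del: One_nat_def)
    qed
    show ?thesis unfolding AB AB0
      by (rule exI[of _ "B 0 1 4"], rule exI[of _ "B 0 2 3"], rule exI[of _ "B 0 2 4"], rule exI[of _ "B 0 3 4"],
          rule exI[of _ "B 1 2 3"], rule exI[of _ "B 0 1 5"], rule exI[of _ "B 0 2 5"], rule exI[of _ "B 0 1 6"], rule exI[of _ "B 1 2 4"])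
        (use * in \<open>simp del: One_nat_def\<close>)
  qed
  then obtain s2 s11 s21 s22 s111 s3 s31 s4 s211 where
    e: "P 1 * A (I @ [m, m+1]) = A (I @ [m, m+2])" "s2 = A (I @ [m, m+3])" "s11 = A (I @ [m+1, m+2])"
      "s21 = A (I @ [m+1, m+3])" "s22 = A (I @ [m+2, m+3])"
      "P 1 * A (I @ [m, m+2]) = s2 + s11" "P 2 * A (I @ [m, m+1]) = s2 - s11"
      "P 1 * s2 = s3 + s21" "P 1 * s11 = s21 + s111" "P 3 * A (I @ [m, m+1]) = s3 - s21 + s111"
      "P 1 * s21 = s31 + s22 + s211" "P 1 * s3 = s4 + s31" "P 2 * s2 = s4 + s22 - s211"
    by blast
  show "P 1 * A (I @ [m, m+1]) = A (I @ [m, m+2])" by (rule e)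
  show 2: "((P 1)\<^sup>2 + P 2) * A (I @ [m, m+1]) = 2 * A (I @ [m, m+3])"
    and 3: "((P 1)\<^sup>2 - P 2) * A (I @ [m, m+1]) = 2 * A (I @ [m+1, m+2])"
    unfolding e(2,3)[symmetric] using e(6,7) by (simp_all add: power2_eq_square mult.assoc e(1) distrib_right left_diff_distrib del: One_nat_def)
  show 4: "(P 1 ^ 3 - P 3) * A (I @ [m, m+1]) = 3 * A (I @ [m+1, m+3])"
    unfolding e(4)[symmetric] using e(6-10)
    by (simp add: power3_eq_cube mult.assoc e(1) distrib_left left_diff_distrib del: One_nat_def)
  show "(P 1 ^ 4 + 3 * (P 2)\<^sup>2 - 4 * (P 1 * P 3)) * A (I @ [m, m+1]) = 12 * A (I @ [m+2, m+3])"
  proof -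
    let ?z = "A (I @ [m, m+1])"
    \<comment> \<open>The combination 12 p1 s21 - 6 p1 (p1 s2) + 6 p2 s2, in which the multiples of
      s4, s31 and s211 cancel and 12 s22 is left.\<close>
    have "(P 1 ^ 4 + 3 * (P 2)\<^sup>2 - 4 * (P 1 * P 3)) * ?z
        = 4 * P 1 * ((P 1 ^ 3 - P 3) * ?z) - 3 * (((P 1)\<^sup>2 - P 2) * (((P 1)\<^sup>2 + P 2) * ?z))"
      by (simp add: algebra_simps power2_eq_square power3_eq_cube power4_eq_xxxx)
    also have "\<dots> = 12 * (P 1 * s21) - 6 * (P 1 * (P 1 * s2) - P 2 * s2)"
      unfolding 2 4 e(2,4)[symmetric] by (simp add: algebra_simps power2_eq_square)
    also have "\<dots> = 12 * s22"
      unfolding e(8,11,13) distrib_left e(12) by simp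
    finally show ?thesis by (simp add: e(5))
  qed
qed

section \<open>The sign of the Vandermonde product as a Pfaffian\<close>

lemma alternating_vandermonde: "alternating vandermonde"
proof -
  have "vandermonde (xs @ a # b # ys) = - vandermonde (xs @ b # a # ys)" for xs a b ys
    by (induction xs) (auto simp: algebra_simps)
  then show ?thesis unfolding alternating_def by blast
qed

lemma alternating_eq_0:
  fixes H :: "'a :: linorder list \<Rightarrow> real"
  assumes alt: "alternating H" and 0: "\<And>ys. sorted_wrt (<) ys \<Longrightarrow> length ys = length xs \<Longrightarrow> H ys = 0"
  shows "H xs = 0"
proof -
  have ins: "\<bar>H (p @ insort a s)\<bar> = \<bar>H (p @ a # s)\<bar>" for p a s
  proof (induction s arbitrary: p)
    case (Cons b s)
    show ?case using Cons[of "p @ [b]"] alternatingD[OF alt, of p a b s] by auto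
  qed simp
  have "\<bar>H (p @ sort xs)\<bar> = \<bar>H (p @ xs)\<bar>" for p
  proof (induction xs arbitrary: p)
    case (Cons a xs)
    show ?case using Cons[of "p @ [a]"] ins[of p a "sort xs"] by simp
  qed simp
  from this[of "[]"] have "\<bar>H (sort xs)\<bar> = \<bar>H xs\<bar>" by simp
  moreover have "H (sort xs) = 0"
  proof (cases "distinct (sort xs)")
    case True
    then show ?thesis using 0 by (simp add: strict_sorted_iff del: distinct_sort)
  qed (rule alternating_not_distinct[OF alt])
  ultimately show ?thesis by simp
qed

lemma del_sum_const: "del_sum (\<lambda>_ _. c) xs = (if odd (length xs) then c else 0)"
  by (induction xs) auto

text \<open>Both sides are alternating, and both are 1 on increasing lists, where each expansion of
  the Pfaffian is an alternating sum of an odd number of ones. For \<beta> = 1 this removes the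
  absolute value: the weight becomes an alternant times a Pfaffian.\<close>

lemma sgn_vandermonde_eq_pfaffian:
  assumes "even (length xs)"
  shows "sgn (vandermonde xs) = pfaffian (\<lambda>x y. sgn (y - x)) xs"
proof -
  let ?w = "\<lambda>x y. sgn (y - x) :: real"
  have 1: "vandermonde ys > 0" if "sorted_wrt (<) ys" for ys
    using that
  proof (induction ys)
    case (Cons y ys)
    have "(\<Prod>z\<leftarrow>ys. z - y) > 0" using Cons.prems by (induction ys) auto
    then show ?case using Cons by simp
  qed simp
  have 2: "pfaffian ?w ys = 1" if "sorted_wrt (<) ys" "even (length ys)" for ys
    using that
  proof (induction "length ys" arbitrary: ys rule: less_induct)
    case less
    show ?case
    proof (cases ys)
      case (Cons a us)
      have "pfaffian ?w ys = del_sum (\<lambda>_ _. 1) us"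
        unfolding Cons pfaffian_Cons
      proof (rule del_sum_cong)
        fix p y q assume us: "us = p @ y # q"
        have "pfaffian ?w (p @ q) = 1"
          by (rule less) (use less.prems us Cons in \<open>auto simp: sorted_wrt_append\<close>)
        then show "sgn (y - a) * pfaffian ?w (p @ q) = 1" using less.prems us Cons by simp
      qed
      then show ?thesis using less.prems Cons by (simp add: del_sum_const)
    qed simp
  qed
  have alt: "alternating (\<lambda>ys. sgn (vandermonde ys) - pfaffian ?w ys)"
    unfolding alternating_def
  proof (intro allI)
    fix xs ys :: "real list" and a b
    have "pfaffian ?w (xs @ a # b # ys) = - pfaffian ?w (xs @ b # a # ys)"
      by (rule alternatingD[OF alternating_pfaffian]) (simp add: sgn_if)
    then show "sgn (vandermonde (xs @ a # b # ys)) - pfaffian ?w (xs @ a # b # ys)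
       = - (sgn (vandermonde (xs @ b # a # ys)) - pfaffian ?w (xs @ b # a # ys))"
      using alternatingD[OF alternating_vandermonde, of xs a b ys] by (simp add: sgn_minus)
  qed
  have "sgn (vandermonde xs) - pfaffian ?w xs = 0"
  proof (rule alternating_eq_0[OF alt])
    fix ys :: "real list" assume "sorted_wrt (<) ys" "length ys = length xs"
    then show "sgn (vandermonde ys) - pfaffian ?w ys = 0" using 1[of ys] 2[of ys] assms by simp
  qed
  then show ?thesis by simp
qed

lemma sgn_vandermonde_even:
  assumes "odd (length xs)"
  shows "sgn (vandermonde (x # xs)) = del_sum (\<lambda>y ys. sgn (y - x) * sgn (vandermonde ys)) xs"
proof -
  have "sgn (vandermonde (x # xs)) = pfaffian (\<lambda>x y. sgn (y - x)) (x # xs)"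
    by (rule sgn_vandermonde_eq_pfaffian) (use assms in simp)
  also have "\<dots> = del_sum (\<lambda>y ys. sgn (y - x) * sgn (vandermonde ys)) xs"
    unfolding pfaffian_Cons
    by (rule del_sum_cong) (use assms in \<open>simp add: sgn_vandermonde_eq_pfaffian\<close>)
  finally show ?thesis .
qed

text \<open>A point to the left of all others turns an odd list into an even one without changing the sign.\<close>

lemma sgn_vandermonde_odd:
  assumes "odd (length xs)"
  shows "sgn (vandermonde xs) = del_sum (\<lambda>y ys. sgn (vandermonde ys)) xs"
proof -
  define x where "x = Min (set xs) - 1"
  have x: "y > x" if "y \<in> set xs" for y
  proof -
    have "Min (set xs) \<le> y" using that by simp
    then show ?thesis by (simp add: x_def)
  qed
  have "(\<Prod>y\<leftarrow>ys. y - x) > 0" if "set ys \<subseteq> set xs" for ys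
    using that by (induction ys) (auto simp: x)
  then have "sgn (vandermonde xs) = sgn (vandermonde (x # xs))"
    by (simp add: sgn_mult)
  also have "\<dots> = del_sum (\<lambda>y ys. sgn (vandermonde ys)) xs"
    unfolding sgn_vandermonde_even[OF assms]
    by (rule del_sum_cong) (use x in simp)
  finally show ?thesis .
qed

subsection \<open>Jacobi weights on the cube\<close>

lemma PiM_density:
  fixes w :: "real \<Rightarrow> real"
  assumes "finite I" and [measurable]: "w \<in> borel_measurable borel" and w: "\<And>x. w x \<ge> 0"
    and "sigma_finite_measure (density lborel w)"
  shows "PiM I (\<lambda>_. density lborel w) = density (PiM I (\<lambda>_. lborel)) (\<lambda>x. \<Prod>i\<in>I. w (x i))"
proof -
  interpret W: product_sigma_finite "\<lambda>_. density lborel w" by standard (use assms(4) in \<open>simp add: sigma_finite_measure_def\<close>)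
  interpret L: product_sigma_finite "\<lambda>_. lborel :: real measure" by standard
  have [simp]: "finite I" by fact
  show ?thesis
  proof (rule W.PiM_eqI[symmetric])
    show "sets (density (PiM I (\<lambda>_. lborel)) (\<lambda>x. \<Prod>i\<in>I. w (x i))) = sets (PiM I (\<lambda>_. density lborel w))"
      unfolding sets_density by (rule sets_PiM_cong) auto
  next
    fix A assume "\<And>i. i \<in> I \<Longrightarrow> A i \<in> sets (density lborel w)"
    then have A [measurable]: "\<And>i. i \<in> I \<Longrightarrow> A i \<in> sets borel" by simp
    have PA [measurable]: "Pi\<^sub>E I A \<in> sets (PiM I (\<lambda>_. lborel))"
      by (rule sets_PiM_I_finite) (use A in auto)
    have "emeasure (density (PiM I (\<lambda>_. lborel)) (\<lambda>x. \<Prod>i\<in>I. w (x i))) (Pi\<^sub>E I A)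
      = (\<integral>\<^sup>+x. ennreal (\<Prod>i\<in>I. w (x i)) * indicator (Pi\<^sub>E I A) x \<partial>PiM I (\<lambda>_. lborel))"
      by (rule emeasure_density) measurable
    also have "\<dots> = (\<integral>\<^sup>+x. (\<Prod>i\<in>I. ennreal (w (x i)) * indicator (A i) (x i)) \<partial>PiM I (\<lambda>_. lborel))"
    proof (rule nn_integral_cong)
      fix x :: "'a \<Rightarrow> real" assume "x \<in> space (PiM I (\<lambda>_. lborel))"
      then have "x \<in> extensional I" by (simp add: space_PiM PiE_def)
      then have "indicator (Pi\<^sub>E I A) x = (\<Prod>i\<in>I. indicator (A i) (x i) :: ennreal)"
        by (auto simp: indicator_def PiE_iff prod_zero_iff)
      then show "ennreal (\<Prod>i\<in>I. w (x i)) * indicator (Pi\<^sub>E I A) x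
          = (\<Prod>i\<in>I. ennreal (w (x i)) * indicator (A i) (x i))"
        by (simp add: prod.distrib prod_ennreal w)
    qed
    also have "\<dots> = (\<Prod>i\<in>I. \<integral>\<^sup>+x. ennreal (w x) * indicator (A i) x \<partial>lborel)"
      by (rule L.product_nn_integral_prod) auto
    also have "\<dots> = (\<Prod>i\<in>I. emeasure (density lborel w) (A i))"
      by (intro prod.cong refl emeasure_density[symmetric]) auto
    finally show "emeasure (density (PiM I (\<lambda>_. lborel)) (\<lambda>x. \<Prod>i\<in>I. w (x i))) (Pi\<^sub>E I A)
       = (\<Prod>i\<in>I. emeasure (density lborel w) (A i))" .
  qed fact
qed

definition jacobi_weight :: "real \<Rightarrow> real \<Rightarrow> real \<Rightarrow> real \<Rightarrow> real" where
  "jacobi_weight a d z x = indicator {0<..<1} x * (x powr a * (1 - x) powr d * exp (- z * x))"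

lemma jacobi_weight_nonneg [simp]: "jacobi_weight a d z x \<ge> 0"
  by (simp add: jacobi_weight_def)

lemma jacobi_weight_measurable [measurable]: "jacobi_weight a d z \<in> borel_measurable borel"
  unfolding jacobi_weight_def by measurable

definition in_cube :: "'i set \<Rightarrow> ('i \<Rightarrow> real) \<Rightarrow> bool" where
  "in_cube I x \<longleftrightarrow> (\<forall>i\<in>I. 0 < x i \<and> x i < 1)"

text \<open>The observables are built from coordinates by polynomials, signs, absolute values and
  exponentials, and the measures live on the open cube. Boundedness is demanded only there, so the
  class is closed under these operations and integrability reduces to the rules
  \<open>cube_intros\<close>.\<close>

definition cube_bounded :: "'i set \<Rightarrow> (('i \<Rightarrow> real) \<Rightarrow> real) \<Rightarrow> bool" where
  "cube_bounded I f \<longleftrightarrow> f \<in> borel_measurable (PiM I (\<lambda>_. lborel)) \<and> (\<exists>B. \<forall>x. in_cube I x \<longrightarrow> \<bar>f x\<bar> \<le> B)"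

named_theorems cube_intros

lemma cube_bounded_const [cube_intros]: "cube_bounded I (\<lambda>x. c)"
  by (auto simp: cube_bounded_def)

lemma cube_bounded_component [cube_intros]: "i \<in> I \<Longrightarrow> cube_bounded I (\<lambda>x. x i)"
  unfolding cube_bounded_def
proof (intro conjI exI[of _ 1])
  assume i: "i \<in> I"
  then show "(\<lambda>x. x i) \<in> borel_measurable (PiM I (\<lambda>_. lborel))" by measurable
  show "\<forall>x. in_cube I x \<longrightarrow> \<bar>x i\<bar> \<le> 1" using i by (force simp: in_cube_def)
qed

lemma cube_bounded_add [cube_intros]:
  assumes "cube_bounded I f" "cube_bounded I g"
  shows "cube_bounded I (\<lambda>x. f x + g x)"
proof -
  from assms obtain A B where "\<forall>x. in_cube I x \<longrightarrow> \<bar>f x\<bar> \<le> A" "\<forall>x. in_cube I x \<longrightarrow> \<bar>g x\<bar> \<le> B"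
    by (auto simp: cube_bounded_def)
  then have "\<forall>x. in_cube I x \<longrightarrow> \<bar>f x + g x\<bar> \<le> A + B"
    by (smt (verit))
  then show ?thesis using assms unfolding cube_bounded_def by auto
qed

lemma cube_bounded_mult [cube_intros]:
  assumes "cube_bounded I f" "cube_bounded I g"
  shows "cube_bounded I (\<lambda>x. f x * g x)"
proof -
  from assms obtain A B where AB: "\<And>x. in_cube I x \<Longrightarrow> \<bar>f x\<bar> \<le> A" "\<And>x. in_cube I x \<Longrightarrow> \<bar>g x\<bar> \<le> B"
    by (auto simp: cube_bounded_def)
  have "\<forall>x. in_cube I x \<longrightarrow> \<bar>f x * g x\<bar> \<le> A * B"
    unfolding abs_mult by (intro allI impI mult_mono AB) (use AB(1) abs_ge_zero order_trans in blast)+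
  then show ?thesis using assms unfolding cube_bounded_def by auto
qed

lemma cube_bounded_comp:
  assumes "cube_bounded I f" "g \<in> borel_measurable borel" "\<And>x. in_cube I x \<Longrightarrow> \<bar>g (f x)\<bar> \<le> B"
  shows "cube_bounded I (\<lambda>x. g (f x))"
proof -
  have [measurable]: "f \<in> borel_measurable (PiM I (\<lambda>_. lborel))" "g \<in> borel_measurable borel"
    using assms by (auto simp: cube_bounded_def)
  have "(\<lambda>x. g (f x)) \<in> borel_measurable (PiM I (\<lambda>_. lborel))" by measurable
  then show ?thesis using assms(3) unfolding cube_bounded_def by blast
qed

lemma cube_bounded_sgn [cube_intros]: "cube_bounded I f \<Longrightarrow> cube_bounded I (\<lambda>x. sgn (f x))"
  by (rule cube_bounded_comp[where B = 1]) (auto simp: sgn_if)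

lemma cube_bounded_abs [cube_intros]:
  assumes "cube_bounded I f" shows "cube_bounded I (\<lambda>x. \<bar>f x\<bar>)"
proof -
  from assms obtain B where "\<And>x. in_cube I x \<Longrightarrow> \<bar>f x\<bar> \<le> B" by (auto simp: cube_bounded_def)
  then show ?thesis by (intro cube_bounded_comp[OF assms, where B = B]) auto
qed

lemma cube_bounded_exp [cube_intros]:
  assumes "cube_bounded I f" shows "cube_bounded I (\<lambda>x. exp (f x))"
proof -
  from assms obtain B where "\<And>x. in_cube I x \<Longrightarrow> \<bar>f x\<bar> \<le> B" by (auto simp: cube_bounded_def)
  then show ?thesis by (intro cube_bounded_comp[OF assms, where B = "exp B"]) (auto simp: abs_le_iff)
qed

lemma cube_bounded_uminus [cube_intros]: "cube_bounded I f \<Longrightarrow> cube_bounded I (\<lambda>x. - f x)"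
  using cube_bounded_mult[OF cube_bounded_const[of I "-1"], of f] by simp

lemma cube_bounded_diff [cube_intros]:
  "cube_bounded I f \<Longrightarrow> cube_bounded I g \<Longrightarrow> cube_bounded I (\<lambda>x. f x - g x)"
  using cube_bounded_add[of I f "\<lambda>x. - g x"] by (simp add: cube_bounded_uminus)

lemma cube_bounded_power [cube_intros]: "cube_bounded I f \<Longrightarrow> cube_bounded I (\<lambda>x. f x ^ k)"
  by (induction k) (auto intro!: cube_intros)

lemma cube_bounded_sum [cube_intros]:
  "(\<And>j. j \<in> J \<Longrightarrow> cube_bounded I (f j)) \<Longrightarrow> cube_bounded I (\<lambda>x. \<Sum>j\<in>J. f j x)"
  by (induction J rule: infinite_finite_induct) (auto intro!: cube_intros)

lemma cube_bounded_prod [cube_intros]: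
  "(\<And>j. j \<in> J \<Longrightarrow> cube_bounded I (f j)) \<Longrightarrow> cube_bounded I (\<lambda>x. \<Prod>j\<in>J. f j x)"
  by (induction J rule: infinite_finite_induct) (auto intro!: cube_intros)

locale jacobi_measure =
  fixes a d :: real
  assumes a: "a > -1" and d: "d > -1"
begin

definition nu :: "real \<Rightarrow> real measure" where
  "nu z = density lborel (jacobi_weight a d z)"

lemma sets_nu [measurable_cong, simp]: "sets (nu z) = sets borel"
  by (simp add: nu_def)

lemma space_nu [simp]: "space (nu z) = UNIV"
  by (simp add: nu_def)

lemma integrable_jacobi_weight: "integrable lborel (jacobi_weight a d z)"
proof -
  \<comment> \<open>The Beta integral settles z = 0; on the unit interval the remaining exponential
    factor is at most exp |z|.\<close>
  have "((\<lambda>t. t powr a * (1 - t) powr d) has_integral Beta (a + 1) (d + 1)) {0<..<1}"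
    using has_integral_Beta_real[of "a + 1" "d + 1"] a d by (simp add: has_integral_Icc_iff_Ioo)
  then have "(\<lambda>t. t powr a * (1 - t) powr d) absolutely_integrable_on {0<..<1}"
    by (intro nonnegative_absolutely_integrable_1) (auto simp: integrable_on_def)
  then have "integrable lborel (\<lambda>x. indicator {0<..<1} x * (x powr a * (1 - x) powr d))"
    unfolding absolutely_integrable_on_def set_integrable_def
    by (subst (asm) integrable_completion) (auto simp: scaleR_conv_of_real)
  then have "integrable lborel (\<lambda>x. exp \<bar>z\<bar> * (indicator {0<..<1} x * (x powr a * (1 - x) powr d)))"
    by (rule integrable_mult_right)
  then show ?thesis
  proof (rule Bochner_Integration.integrable_bound)
    show "AE x in lborel. norm (jacobi_weight a d z x)
        \<le> norm (exp \<bar>z\<bar> * (indicator {0<..<1} x * (x powr a * (1 - x) powr d)))"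
    proof (rule AE_I2)
      fix x :: real
      have "- (z * x) \<le> \<bar>z\<bar>" if "0 < x" "x < 1"
      proof -
        have "- (z * x) \<le> \<bar>z * x\<bar>" by simp
        also have "\<dots> \<le> \<bar>z\<bar> * 1" unfolding abs_mult using that by (intro mult_left_mono) auto
        finally show ?thesis by simp
      qed
      then show "norm (jacobi_weight a d z x)
          \<le> norm (exp \<bar>z\<bar> * (indicator {0<..<1} x * (x powr a * (1 - x) powr d)))"
        by (auto simp: jacobi_weight_def indicator_def intro!: mult_mono)
    qed
  qed measurable
qed

lemma finite_measure_nu: "finite_measure (nu z)"
proof
  have "(\<integral>\<^sup>+x. jacobi_weight a d z x \<partial>lborel) < \<infinity>"
    using integrable_jacobi_weight[of z] unfolding integrable_iff_bounded by simp
  then show "emeasure (nu z) (space (nu z)) \<noteq> \<infinity>"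
    unfolding nu_def by (subst emeasure_density) (auto simp: top.not_eq_extremum)
qed

sublocale nu: product_sigma_finite "\<lambda>_. nu z" for z
  by standard (use finite_measure_nu finite_measure.axioms in \<open>auto simp: sigma_finite_measure_def finite_measure_def\<close>)

lemma PiM_nu: "finite I \<Longrightarrow>
    PiM I (\<lambda>_. nu z) = density (PiM I (\<lambda>_. lborel)) (\<lambda>x. \<Prod>i\<in>I. jacobi_weight a d z (x i))"
  unfolding nu_def
  by (rule PiM_density) (use nu.sigma_finite_measures in \<open>auto simp: nu_def\<close>)

lemma sets_PiM_nu [measurable_cong]: "sets (PiM I (\<lambda>_. nu z)) = sets (PiM I (\<lambda>_. lborel))"
  by (rule sets_PiM_cong) auto

lemma AE_in_cube:
  assumes "finite I"
  shows "AE x in PiM I (\<lambda>_. nu z). in_cube I x"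
proof -
  have "AE x in density (PiM I (\<lambda>_. lborel)) (\<lambda>x. \<Prod>i\<in>I. jacobi_weight a d z (x i)). in_cube I x"
  proof (subst AE_density)
    show "AE x in PiM I (\<lambda>_. lborel). 0 < ennreal (\<Prod>i\<in>I. jacobi_weight a d z (x i)) \<longrightarrow> in_cube I x"
    proof (rule AE_I2, rule impI)
      fix x :: "'a \<Rightarrow> real" assume "0 < ennreal (\<Prod>i\<in>I. jacobi_weight a d z (x i))"
      then have "(\<Prod>i\<in>I. jacobi_weight a d z (x i)) \<noteq> 0" by auto
      then show "in_cube I x" using assms
        by (auto simp: in_cube_def jacobi_weight_def indicator_def prod_zero_iff split: if_splits)
    qed
  qed measurable
  then show ?thesis unfolding PiM_nu[OF assms] .
qed

lemma finite_measure_PiM_nu: "finite I \<Longrightarrow> finite_measure (PiM I (\<lambda>_. nu z))"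
proof
  assume "finite I"
  then have "emeasure (PiM I (\<lambda>_. nu z)) (PiE I (\<lambda>i. space (nu z))) = (\<Prod>i\<in>I. emeasure (nu z) (space (nu z)))"
    by (intro nu.emeasure_PiM) auto
  then show "emeasure (PiM I (\<lambda>_. nu z)) (space (PiM I (\<lambda>_. nu z))) \<noteq> \<infinity>"
    unfolding space_PiM using finite_measure.emeasure_finite[OF finite_measure_nu[of z]]
    by (simp add: power_eq_top_ennreal)
qed

lemma integrable_cube_bounded:
  assumes "finite I" "cube_bounded I f"
  shows "integrable (PiM I (\<lambda>_. nu z)) f"
proof -
  obtain B where B: "\<And>x. in_cube I x \<Longrightarrow> \<bar>f x\<bar> \<le> B" and [measurable]: "f \<in> borel_measurable (PiM I (\<lambda>_. lborel))"
    using assms(2) by (auto simp: cube_bounded_def)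
  interpret finite_measure "PiM I (\<lambda>_. nu z)" by (rule finite_measure_PiM_nu) fact
  have "AE x in PiM I (\<lambda>_. nu z). norm (f x) \<le> B"
    using AE_in_cube[OF assms(1), of z] by eventually_elim (simp add: B)
  then show ?thesis by (rule integrable_const_bound) measurable
qed

lemma integral_split_component:
  assumes "finite I" "i \<notin> I" "cube_bounded (insert i I) (\<lambda>x. u (x i) * g x)"
    and "\<And>x y. g (x(i := y)) = g x"
  shows "(\<integral>x. u (x i) * g x \<partial>PiM (insert i I) (\<lambda>_. nu z))
       = (\<integral>y. u y \<partial>nu z) * (\<integral>x. g x \<partial>PiM I (\<lambda>_. nu z))"
proof -
  have "integrable (PiM (insert i I) (\<lambda>_. nu z)) (\<lambda>x. u (x i) * g x)"
    using assms by (intro integrable_cube_bounded) auto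
  then show ?thesis
    by (subst nu.product_integral_insert) (use assms in auto)
qed

text \<open>Fubini for a kernel such as sgn (t - s) that does not factor. The integral over the
  coordinate j is absorbed into the function U of the coordinate i, which is bounded by B times the
  total mass, and then i is split off.\<close>

lemma integral_split_two_components:
  assumes I: "finite I" "i \<notin> I" "j \<notin> I" "i \<noteq> j"
    and u [measurable]: "(\<lambda>(s, t). u s t) \<in> borel_measurable (borel \<Otimes>\<^sub>M borel)"
    and B: "\<And>s t. 0 < s \<Longrightarrow> s < 1 \<Longrightarrow> 0 < t \<Longrightarrow> t < 1 \<Longrightarrow> \<bar>u s t\<bar> \<le> B"
    and g: "\<And>J. I \<subseteq> J \<Longrightarrow> cube_bounded J g"
    and upd: "\<And>x y. g (x(i := y)) = g x" "\<And>x y. g (x(j := y)) = g x"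
  shows "(\<integral>x. u (x i) (x j) * g x \<partial>PiM (insert i (insert j I)) (\<lambda>_. nu z))
       = (\<integral>s. \<integral>t. u s t \<partial>nu z \<partial>nu z) * (\<integral>x. g x \<partial>PiM I (\<lambda>_. nu z))"
proof -
  interpret N: finite_measure "nu z" by (rule finite_measure_nu)
  define U where "U = (\<lambda>s. \<integral>t. u s t \<partial>nu z)"
  have AE1: "AE t in nu z. 0 < t \<and> t < 1"
    unfolding nu_def by (subst AE_density) (auto simp: jacobi_weight_def indicator_def)
  have U_bound: "\<bar>U s\<bar> \<le> B * measure (nu z) UNIV" if "0 < s" "s < 1" for s
  proof -
    have "norm (U s) \<le> (\<integral>t. norm (u s t) \<partial>nu z)" unfolding U_def by (rule integral_norm_bound)
    also have "\<dots> \<le> (\<integral>t. B \<partial>nu z)"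
    proof (rule integral_mono_AE)
      show "AE t in nu z. norm (u s t) \<le> B" using AE1 by eventually_elim (use B that in auto)
      then show "integrable (nu z) (\<lambda>t. norm (u s t))"
        by (intro N.integrable_const_bound[where B = B]) auto
    qed auto
    finally show ?thesis by (simp add: mult.commute)
  qed
  have U_meas [measurable]: "U \<in> borel_measurable borel"
    unfolding U_def
    by (rule sigma_finite_measure.borel_measurable_lebesgue_integral[OF nu.sigma_finite_measures]) simp
  have cb: "cube_bounded (insert i I) (\<lambda>x. U (x i) * g x)"
  proof (intro cube_bounded_mult g)
    have "(\<lambda>x. U (x i)) \<in> borel_measurable (PiM (insert i I) (\<lambda>_. lborel))" by measurable
    then show "cube_bounded (insert i I) (\<lambda>x. U (x i))"
      using U_bound by (auto simp: cube_bounded_def in_cube_def)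
  qed auto
  have "cube_bounded (insert j (insert i I)) (\<lambda>x. u (x i) (x j) * g x)"
  proof (intro cube_bounded_mult g)
    have [measurable]: "i \<in> insert j (insert i I)" "j \<in> insert j (insert i I)" by auto
    have "(\<lambda>x. u (x i) (x j)) \<in> borel_measurable (PiM (insert j (insert i I)) (\<lambda>_. lborel))"
      using measurable_compose[OF _ u, of "\<lambda>x. (x i, x j)" "PiM (insert j (insert i I)) (\<lambda>_. lborel)"]
      by simp
    then show "cube_bounded (insert j (insert i I)) (\<lambda>x. u (x i) (x j))"
      using B by (auto simp: cube_bounded_def in_cube_def)
  qed auto
  then have "integrable (PiM (insert j (insert i I)) (\<lambda>_. nu z)) (\<lambda>x. u (x i) (x j) * g x)"
    using I by (intro integrable_cube_bounded) auto
  then have "(\<integral>x. u (x i) (x j) * g x \<partial>PiM (insert j (insert i I)) (\<lambda>_. nu z))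
     = (\<integral>x. U (x i) * g x \<partial>PiM (insert i I) (\<lambda>_. nu z))"
    by (subst nu.product_integral_insert) (use I upd in \<open>auto simp: U_def\<close>)
  also have "\<dots> = (\<integral>s. U s \<partial>nu z) * (\<integral>x. g x \<partial>PiM I (\<lambda>_. nu z))"
    by (rule integral_split_component) (use I upd cb in auto)
  finally show ?thesis by (simp add: U_def insert_commute)
qed

end

subsection \<open>Integrals of alternants\<close>

text \<open>The unsigned companion of \<open>del_sum\<close>: an alternating factor absorbs the
  signs when the deleted entry is moved to the front. In the integrals below all terms of the sum
  then have the same value.\<close>

primrec pick_sum :: "('a \<Rightarrow> 'a list \<Rightarrow> real) \<Rightarrow> 'a list \<Rightarrow> real" where
  "pick_sum h [] = 0"
| "pick_sum h (x # xs) = h x xs + pick_sum (\<lambda>y ys. h y (x # ys)) xs"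

lemma pick_sum_uminus: "pick_sum (\<lambda>y ys. - h y ys) xs = - pick_sum h xs"
  by (induction xs arbitrary: h) auto

lemma alternating_mult_del_sum:
  assumes "alternating F"
  shows "F xs * del_sum h xs = pick_sum (\<lambda>y ys. F (y # ys) * h y ys) xs"
  using assms
proof (induction xs arbitrary: F h)
  case (Cons x xs)
  have "F (x # y # ys) = - F (y # x # ys)" for y ys
    using alternatingD[OF Cons.prems, of "[]" x y ys] by simp
  then show ?case
    using Cons.IH[OF alternating_Cons[OF Cons.prems, of x], of "\<lambda>y ys. h y (x # ys)"]
    by (simp add: right_diff_distrib pick_sum_uminus)
qed simp

lemma alternating_map: "alternating f \<Longrightarrow> alternating (\<lambda>xs. f (map g xs))"
  unfolding alternating_def map_append list.map by blast

lemma integral_pick_sum: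
  assumes "\<And>p y q. xs = p @ y # q \<Longrightarrow> integrable M (\<lambda>x. f x y (p @ q)) \<and> (\<integral>x. f x y (p @ q) \<partial>M) = c"
  shows "integrable M (\<lambda>x. pick_sum (f x) xs) \<and> (\<integral>x. pick_sum (f x) xs \<partial>M) = real (length xs) * c"
  using assms
proof (induction xs arbitrary: f)
  case (Cons a xs)
  have 1: "integrable M (\<lambda>x. f x a xs) \<and> (\<integral>x. f x a xs \<partial>M) = c"
    using Cons.prems[of "[]" a xs] by simp
  have 2: "integrable M (\<lambda>x. pick_sum (\<lambda>y ys. f x y (a # ys)) xs)
    \<and> (\<integral>x. pick_sum (\<lambda>y ys. f x y (a # ys)) xs \<partial>M) = real (length xs) * c"
  proof (rule Cons.IH)
    fix p y q assume "xs = p @ y # q"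
    then show "integrable M (\<lambda>x. f x y (a # p @ q)) \<and> (\<integral>x. f x y (a # p @ q) \<partial>M) = c"
      using Cons.prems[of "a # p" y q] by simp
  qed
  show ?case using 1 2 by (simp add: algebra_simps)
qed simp

lemma integral_del_sum:
  assumes "\<And>y ys. integrable M (\<lambda>x. f x y ys)"
  shows "integrable M (\<lambda>x. del_sum (f x) xs) \<and> (\<integral>x. del_sum (f x) xs \<partial>M) = del_sum (\<lambda>y ys. \<integral>x. f x y ys \<partial>M) xs"
  using assms
proof (induction xs arbitrary: f)
  case (Cons a xs)
  show ?case using Cons.IH[of "\<lambda>x y ys. f x y (a # ys)"] Cons.prems by simp
qed simp

lemma integral_del_sum_del_sum:
  assumes "\<And>y z zs. integrable M (\<lambda>x. f x y z zs)"
  shows "(\<integral>x. del_sum (\<lambda>y ys. del_sum (f x y) ys) xs \<partial>M)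
       = del_sum (\<lambda>y ys. del_sum (\<lambda>z zs. \<integral>x. f x y z zs \<partial>M) ys) xs"
proof -
  have 1: "integrable M (\<lambda>x. del_sum (f x y) ys)
      \<and> (\<integral>x. del_sum (f x y) ys \<partial>M) = del_sum (\<lambda>z zs. \<integral>x. f x y z zs \<partial>M) ys" for y ys
    by (rule integral_del_sum) (rule assms)
  then have "(\<integral>x. del_sum (\<lambda>y ys. del_sum (f x y) ys) xs \<partial>M)
      = del_sum (\<lambda>y ys. \<integral>x. del_sum (f x y) ys \<partial>M) xs"
    by (intro conjunct2[OF integral_del_sum]) blast
  then show ?thesis using 1 by simp
qed

lemma cube_bounded_del_sum [cube_intros]:
  "(\<And>y ys. cube_bounded I (\<lambda>x. f x y ys)) \<Longrightarrow> cube_bounded I (\<lambda>x. del_sum (f x) xs)"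
  by (induction xs arbitrary: f) (auto intro!: cube_intros)

lemma cube_bounded_det_powers [cube_intros]:
  "set P \<subseteq> I \<Longrightarrow> cube_bounded I (\<lambda>x. det_list (\<lambda>x l. x ^ l) (map x P) ls)"
  by (induction P arbitrary: ls) (auto intro!: cube_intros)

lemma cube_bounded_det_confluent [cube_intros]:
  "set P \<subseteq> I \<Longrightarrow> cube_bounded I (\<lambda>x. det_list confluent_entry (double_rows (map x P)) ls)"
  by (induction P arbitrary: ls) (auto simp: confluent_entry_def intro!: cube_intros)

lemma cube_bounded_vandermonde [cube_intros]:
  "set P \<subseteq> I \<Longrightarrow> cube_bounded I (\<lambda>x. vandermonde (map x P))"
proof (induction P)
  case (Cons p P)
  have "cube_bounded I (\<lambda>x. \<Prod>y\<leftarrow>map x Q. y - x p)" if "set Q \<subseteq> I" for Q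
    using that Cons.prems by (induction Q) (auto intro!: cube_intros)
  then show ?case using Cons by (auto intro!: cube_intros)
qed (auto intro: cube_intros)

lemma map_fun_upd_notin: "i \<notin> set P \<Longrightarrow> map (x(i := y)) P = map x P"
  by (induction P) auto

text \<open>The determinantal counterpart of \<open>pfaffian_double_expansion\<close>: extracting
  any given row and expanding along it returns the whole determinant, once per row.\<close>

lemma det_list_double_expansion:
  "del_sum (\<lambda>k K. del_sum (\<lambda>e E. c e k * det_list c E K) es) ls = real (length es) * det_list c es ls"
proof (induction es arbitrary: ls)
  case (Cons e es)
  have "del_sum (\<lambda>k K. del_sum (\<lambda>e E. c e k * det_list c E K) (e # es)) ls
      = det_list c (e # es) ls
        - del_sum (\<lambda>k K. del_sum (\<lambda>f F. c f k * del_sum (\<lambda>m M. c e m * det_list c F M) K) es) ls"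
    by (simp add: del_sum_diff)
  also have "del_sum (\<lambda>k K. del_sum (\<lambda>f F. c f k * del_sum (\<lambda>m M. c e m * det_list c F M) K) es) ls
      = del_sum (\<lambda>k K. del_sum (\<lambda>m M. c e m * del_sum (\<lambda>f F. c f k * det_list c F M) es) K) ls"
  proof (intro del_sum_cong)
    fix p k q
    have "del_sum (\<lambda>f F. c f k * del_sum (\<lambda>m M. c e m * det_list c F M) (p @ q)) es
        = del_sum (\<lambda>f F. del_sum (\<lambda>m M. c f k * (c e m * det_list c F M)) (p @ q)) es"
      by (simp only: del_sum_cmult)
    also have "\<dots> = del_sum (\<lambda>m M. del_sum (\<lambda>f F. c f k * (c e m * det_list c F M)) es) (p @ q)"
      by (rule del_sum_commute)
    also have "\<dots> = del_sum (\<lambda>m M. c e m * del_sum (\<lambda>f F. c f k * det_list c F M) es) (p @ q)"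
      by (simp add: mult.left_commute flip: del_sum_cmult)
    finally show "del_sum (\<lambda>f F. c f k * del_sum (\<lambda>m M. c e m * det_list c F M) (p @ q)) es
        = del_sum (\<lambda>m M. c e m * del_sum (\<lambda>f F. c f k * det_list c F M) es) (p @ q)" .
  qed
  also have "\<dots> = - del_sum (\<lambda>m M. c e m * del_sum (\<lambda>k K. del_sum (\<lambda>f F. c f k * det_list c F K) es) M) ls"
    by (subst del_sum_swap) (intro arg_cong[of _ _ uminus] del_sum_cong, simp add: del_sum_cmult)
  also have "\<dots> = - real (length es) * det_list c (e # es) ls"
    unfolding Cons mult.left_commute[of _ "real (length es)"] del_sum_cmult by simp
  finally show ?case by (simp add: algebra_simps)
qed simp

section \<open>Integration formulas of de Bruijn and Andreief\<close>

context jacobi_measure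
begin

definition moment :: "real \<Rightarrow> nat \<Rightarrow> real" where
  "moment z k = (\<integral>t. t ^ k \<partial>nu z)"

definition half_moment1 :: "real \<Rightarrow> nat \<Rightarrow> nat \<Rightarrow> real" where
  "half_moment1 z k m = (\<integral>s. \<integral>t. s ^ k * t ^ m * sgn (t - s) \<partial>nu z \<partial>nu z)"

text \<open>Exchanging the variables shows that \<open>half_moment1\<close> is already
  antisymmetric. Antisymmetrizing it in the definition keeps the value and makes the antisymmetry
  immediate.\<close>

definition skew_moment1 :: "real \<Rightarrow> nat \<Rightarrow> nat \<Rightarrow> real" where
  "skew_moment1 z k m = (half_moment1 z k m - half_moment1 z m k) / 2"

definition half_moment4 :: "real \<Rightarrow> nat \<Rightarrow> nat \<Rightarrow> real" where
  "half_moment4 z k m = (\<integral>t. t ^ k * (real m * t ^ (m - 1)) \<partial>nu z)"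

definition skew_moment4 :: "real \<Rightarrow> nat \<Rightarrow> nat \<Rightarrow> real" where
  "skew_moment4 z k m = half_moment4 z k m - half_moment4 z m k"

text \<open>De Bruijn's formula for \<beta> = 1. Expanding the sign along the first point p pairs it
  with some q, and the alternant absorbs the signs, so every q contributes equally. Expanding the
  alternant in the rows of p and q leaves a smaller integral of the same kind, and
  \<open>pfaffian_double_expansion\<close> reassembles the Pfaffian. For N points the count is (N -
  1) (N - 2)! N = N!.\<close>

lemma integral_alternant_sgn_even:
  assumes "distinct P" "length ls = length P" "even (length P)"
  shows "(\<integral>x. det_list (\<lambda>x l. x ^ l) (map x P) ls * sgn (vandermonde (map x P)) \<partial>PiM (set P) (\<lambda>_. nu z))
       = fact (length P) * pfaffian (skew_moment1 z) ls"
  using assms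
proof (induction "length P" arbitrary: P ls rule: less_induct)
  case less
  show ?case
  proof (cases P)
    case Nil
    then show ?thesis using less.prems by (simp add: PiM_empty lebesgue_integral_count_space_finite)
  next
    case (Cons p P')
    let ?M = "PiM (set P) (\<lambda>_. nu z)"
    let ?D = "\<lambda>x Q. det_list (\<lambda>x l. x ^ l) (map x Q)"
    let ?S = "\<lambda>x Q. sgn (vandermonde (map x Q))"
    let ?f = "\<lambda>x q Q. ?D x (p # q # Q) ls * (sgn (x q - x p) * ?S x Q)"
    have odd: "odd (length P')" using less.prems Cons by simp
    have split: "?D x P ls * ?S x P = pick_sum (?f x) P'" for x
    proof -
      have "alternating (\<lambda>Q. ?D x (p # Q) ls)"
      proof -
        have "alternating (\<lambda>Q. det_list (\<lambda>x l. x ^ l) (x p # map x Q) ls)"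
          by (rule alternating_map[OF alternating_Cons[OF alternating_det_list_rows]])
        then show ?thesis by simp
      qed
      moreover have "?S x P = del_sum (\<lambda>q Q. sgn (x q - x p) * ?S x Q) P'"
        using sgn_vandermonde_even[of "map x P'" "x p"] odd
        by (simp add: Cons del_sum_map del: vandermonde.simps)
      ultimately show ?thesis
        using alternating_mult_del_sum[of "\<lambda>Q. ?D x (p # Q) ls" P' "\<lambda>q Q. sgn (x q - x p) * ?S x Q"]
        by (simp only: Cons)
    qed
    have "integrable ?M (\<lambda>x. pick_sum (?f x) P') \<and> (\<integral>x. pick_sum (?f x) P' \<partial>?M)
        = real (length P') * (fact (length P' - 1) * (real (length P) * pfaffian (skew_moment1 z) ls))"
    proof (rule integral_pick_sum)
      fix pre q post assume P': "P' = pre @ q # post"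
      define Q where "Q = pre @ post"
      have Q: "distinct Q" "even (length Q)" "length Q + 2 = length P" "p \<notin> set Q" "q \<notin> set Q" "p \<noteq> q"
        "set P = insert p (insert q (set Q))" "length Q = length P' - 1" "length Q < length P"
        using less.prems Cons P' by (auto simp: Q_def)
      have int: "integrable ?M (\<lambda>x. ?f x q Q)"
        by (rule integrable_cube_bounded, simp, intro cube_intros) (use Q in auto)
      have "(\<integral>x. ?f x q Q \<partial>?M)
        = (\<integral>x. del_sum (\<lambda>k K. del_sum (\<lambda>m M. (x p ^ k * x q ^ m * sgn (x q - x p)) * (?D x Q M * ?S x Q)) K) ls \<partial>?M)"
        by (intro Bochner_Integration.integral_cong refl)
          (simp add: mult_ac flip: del_sum_cmult)
      also have "\<dots> = del_sum (\<lambda>k K. del_sum (\<lambda>m M.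
            (\<integral>x. (x p ^ k * x q ^ m * sgn (x q - x p)) * (?D x Q M * ?S x Q) \<partial>?M)) K) ls"
        by (rule integral_del_sum_del_sum, rule integrable_cube_bounded) (use Q in \<open>auto intro!: cube_intros\<close>)
      also have "\<dots> = del_sum (\<lambda>k K. del_sum (\<lambda>m M. half_moment1 z k m * (\<integral>x. ?D x Q M * ?S x Q \<partial>PiM (set Q) (\<lambda>_. nu z))) K) ls"
        unfolding half_moment1_def Q(7)
        by (subst integral_split_two_components[where B = 1])
          (use Q in \<open>auto intro!: cube_intros mult_le_one power_le_one simp: map_fun_upd_notin abs_mult abs_sgn_eq\<close>)
      also have "\<dots> = del_sum (\<lambda>k K. del_sum (\<lambda>m M. fact (length Q) * (half_moment1 z k m * pfaffian (skew_moment1 z) M)) K) ls"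
      proof (intro del_sum_cong)
        fix p1 k q1 p2 m q2 assume ls: "ls = p1 @ k # q1" and K: "p1 @ q1 = p2 @ m # q2"
        have "length (p2 @ q2) = length Q" using arg_cong[OF K, of length] ls Q less.prems(2) by simp
        then show "half_moment1 z k m * (\<integral>x. ?D x Q (p2 @ q2) * ?S x Q \<partial>PiM (set Q) (\<lambda>_. nu z))
            = fact (length Q) * (half_moment1 z k m * pfaffian (skew_moment1 z) (p2 @ q2))"
          using less.hyps[of Q "p2 @ q2"] Q by simp
      qed
      also have "\<dots> = fact (length Q) * (2 * (real (length ls) / 2) * pfaffian (skew_moment1 z) ls)"
        unfolding del_sum_cmult
        by (subst pfaffian_double_expansion[of _ 2 "skew_moment1 z"]) (auto simp: skew_moment1_def)
      finally show "integrable ?M (\<lambda>x. ?f x q (pre @ post)) \<and> (\<integral>x. ?f x q (pre @ post) \<partial>?M)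
          = fact (length P' - 1) * (real (length P) * pfaffian (skew_moment1 z) ls)"
        using int Q less.prems(2) unfolding Q_def[symmetric] by simp
    qed
    moreover have "real (length P') * (fact (length P' - 1) * (real (length P) * pfaffian (skew_moment1 z) ls))
        = fact (length P) * pfaffian (skew_moment1 z) ls"
    proof -
      have "real (length P') * fact (length P' - 1) = fact (length P')"
        using odd by (subst fact_reduce[of "length P'"]) (auto intro: odd_pos)
      then have "fact (length P) = (real (length P') * fact (length P' - 1)) * real (length P)"
        by (simp add: Cons algebra_simps)
      then show ?thesis by (simp only: mult.assoc)
    qed
    ultimately show ?thesis unfolding split by (simp only:)
  qed
qed

text \<open>An odd number of points needs a border row, here the index \<^const>\<open>None\<close>.\<close>

definition bordered_moment1 :: "real \<Rightarrow> nat option \<Rightarrow> nat option \<Rightarrow> real" where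
  "bordered_moment1 z x y = (case (x, y) of (None, None) \<Rightarrow> 0 | (None, Some l) \<Rightarrow> moment z l
     | (Some k, None) \<Rightarrow> - moment z k | (Some k, Some l) \<Rightarrow> skew_moment1 z k l)"

text \<open>Splitting off one point by \<open>sgn_vandermonde_odd\<close> leaves an even number of
  them. The integral over the removed point is a plain moment and enters through the border
  row.\<close>

lemma integral_alternant_sgn_odd:
  assumes "distinct P" "length ls = length P" "odd (length P)"
  shows "(\<integral>x. det_list (\<lambda>x l. x ^ l) (map x P) ls * sgn (vandermonde (map x P)) \<partial>PiM (set P) (\<lambda>_. nu z))
       = fact (length P) * pfaffian (bordered_moment1 z) (None # map Some ls)"
proof -
  let ?M = "PiM (set P) (\<lambda>_. nu z)"
  let ?D = "\<lambda>x Q. det_list (\<lambda>x l. x ^ l) (map x Q)"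
  let ?S = "\<lambda>x Q. sgn (vandermonde (map x Q))"
  let ?f = "\<lambda>x q Q. ?D x (q # Q) ls * ?S x Q"
  have split: "?D x P ls * ?S x P = pick_sum (?f x) P" for x
  proof -
    have "alternating (\<lambda>Q. ?D x Q ls)"
      by (rule alternating_map[OF alternating_det_list_rows])
    moreover have "?S x P = del_sum (\<lambda>q Q. ?S x Q) P"
      using sgn_vandermonde_odd[of "map x P"] assms(3) by (simp add: del_sum_map)
    ultimately show ?thesis
      using alternating_mult_del_sum[of "\<lambda>Q. ?D x Q ls" P "\<lambda>q Q. ?S x Q"] by simp
  qed
  have "integrable ?M (\<lambda>x. pick_sum (?f x) P) \<and> (\<integral>x. pick_sum (?f x) P \<partial>?M)
      = real (length P) * (fact (length P - 1) * pfaffian (bordered_moment1 z) (None # map Some ls))"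
  proof (rule integral_pick_sum)
    fix pre q post assume P': "P = pre @ q # post"
    define Q where "Q = pre @ post"
    have Q: "distinct Q" "even (length Q)" "length Q + 1 = length P" "q \<notin> set Q"
      "set P = insert q (set Q)" "length Q = length P - 1"
      using assms P' by (auto simp: Q_def)
    have int: "integrable ?M (\<lambda>x. ?f x q Q)"
      by (rule integrable_cube_bounded, simp, intro cube_intros) (use Q in auto)
    have "(\<integral>x. ?f x q Q \<partial>?M) = (\<integral>x. del_sum (\<lambda>k K. x q ^ k * (?D x Q K * ?S x Q)) ls \<partial>?M)"
      by (intro Bochner_Integration.integral_cong refl) (simp add: mult_ac flip: del_sum_cmult)
    also have "\<dots> = del_sum (\<lambda>k K. (\<integral>x. x q ^ k * (?D x Q K * ?S x Q) \<partial>?M)) ls"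
      by (rule conjunct2[OF integral_del_sum], rule integrable_cube_bounded) (use Q in \<open>auto intro!: cube_intros\<close>)
    also have "\<dots> = del_sum (\<lambda>k K. moment z k * (\<integral>x. ?D x Q K * ?S x Q \<partial>PiM (set Q) (\<lambda>_. nu z))) ls"
      unfolding moment_def Q(5)
      by (subst integral_split_component) (use Q in \<open>auto intro!: cube_intros simp: map_fun_upd_notin\<close>)
    also have "\<dots> = del_sum (\<lambda>k K. fact (length Q) * (moment z k * pfaffian (skew_moment1 z) K)) ls"
    proof (intro del_sum_cong)
      fix p1 k q1 assume ls: "ls = p1 @ k # q1"
      then have "length (p1 @ q1) = length Q" using Q assms(2) by simp
      then show "moment z k * (\<integral>x. ?D x Q (p1 @ q1) * ?S x Q \<partial>PiM (set Q) (\<lambda>_. nu z))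
          = fact (length Q) * (moment z k * pfaffian (skew_moment1 z) (p1 @ q1))"
        using integral_alternant_sgn_even[of Q "p1 @ q1"] Q by simp
    qed
    also have "\<dots> = fact (length Q) * pfaffian (bordered_moment1 z) (None # map Some ls)"
      unfolding del_sum_cmult by (simp add: pfaffian_Cons del_sum_map pfaffian_map bordered_moment1_def)
    finally show "integrable ?M (\<lambda>x. ?f x q (pre @ post)) \<and> (\<integral>x. ?f x q (pre @ post) \<partial>?M)
        = fact (length P - 1) * pfaffian (bordered_moment1 z) (None # map Some ls)"
      using int Q unfolding Q_def[symmetric] by simp
  qed
  moreover have "real (length P) * fact (length P - 1) = fact (length P)"
    using assms(3) by (subst fact_reduce[of "length P"]) (auto intro: odd_pos)
  ultimately show ?thesis unfolding split by (simp add: algebra_simps)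
qed

text \<open>Andreief's identity: both alternants are expanded in the row of p, where the two
  monomials multiply to t^(k + e), and \<open>det_list_double_expansion\<close> collects the
  terms.\<close>

lemma integral_alternant_alternant:
  assumes "distinct P" "length ls = length P" "length es = length P"
  shows "(\<integral>x. det_list (\<lambda>x l. x ^ l) (map x P) ls * det_list (\<lambda>x l. x ^ l) (map x P) es \<partial>PiM (set P) (\<lambda>_. nu z))
       = fact (length P) * det_list (\<lambda>e l. moment z (l + e)) es ls"
  using assms
proof (induction P arbitrary: ls es)
  case Nil
  then show ?case by (simp add: PiM_empty lebesgue_integral_count_space_finite)
next
  case (Cons p P)
  let ?M = "PiM (set (p # P)) (\<lambda>_. nu z)"
  let ?D = "\<lambda>x Q. det_list (\<lambda>x l. x ^ l) (map x Q)"
  let ?m = "\<lambda>e l. moment z (l + e)"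
  have "(\<integral>x. ?D x (p # P) ls * ?D x (p # P) es \<partial>?M)
      = (\<integral>x. del_sum (\<lambda>k K. del_sum (\<lambda>e E. x p ^ (k + e) * (?D x P K * ?D x P E)) es) ls \<partial>?M)"
    by (intro Bochner_Integration.integral_cong refl)
      (simp add: power_add mult_ac flip: del_sum_cmult)
  also have "\<dots> = del_sum (\<lambda>k K. (\<integral>x. del_sum (\<lambda>e E. x p ^ (k + e) * (?D x P K * ?D x P E)) es \<partial>?M)) ls"
    by (rule conjunct2[OF integral_del_sum], rule integrable_cube_bounded) (auto intro!: cube_intros)
  also have "\<dots> = del_sum (\<lambda>k K. del_sum (\<lambda>e E. (\<integral>x. x p ^ (k + e) * (?D x P K * ?D x P E) \<partial>?M)) es) ls"
    by (subst conjunct2[OF integral_del_sum], rule integrable_cube_bounded) (auto intro!: cube_intros)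
  also have "\<dots> = del_sum (\<lambda>k K. del_sum (\<lambda>e E. ?m e k * (\<integral>x. ?D x P K * ?D x P E \<partial>PiM (set P) (\<lambda>_. nu z))) es) ls"
    unfolding moment_def list.set
    by (subst integral_split_component) (use Cons in \<open>auto intro!: cube_intros simp: map_fun_upd_notin\<close>)
  also have "\<dots> = del_sum (\<lambda>k K. del_sum (\<lambda>e E. fact (length P) * (?m e k * det_list ?m E K)) es) ls"
  proof (intro del_sum_cong)
    fix p1 k q1 p2 e q2 assume ls: "ls = p1 @ k # q1" and es: "es = p2 @ e # q2"
    show "?m e k * (\<integral>x. ?D x P (p1 @ q1) * ?D x P (p2 @ q2) \<partial>PiM (set P) (\<lambda>_. nu z))
        = fact (length P) * (?m e k * det_list ?m (p2 @ q2) (p1 @ q1))"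
      using Cons.IH[of "p1 @ q1" "p2 @ q2"] Cons.prems ls es by simp
  qed
  also have "\<dots> = fact (length P) * (real (length es) * det_list ?m es ls)"
    unfolding del_sum_cmult by (subst det_list_double_expansion) simp
  finally show ?case using Cons.prems by (simp add: algebra_simps)
qed

text \<open>De Bruijn's formula for \<beta> = 4. One point owns two rows, so a single integration
  already produces an antisymmetric pairing of two exponents.\<close>

lemma integral_confluent_alternant:
  assumes "distinct P" "length ls = 2 * length P"
  shows "(\<integral>x. det_list confluent_entry (double_rows (map x P)) ls \<partial>PiM (set P) (\<lambda>_. nu z))
       = fact (length P) * pfaffian (skew_moment4 z) ls"
  using assms
proof (induction P arbitrary: ls)
  case Nil
  then show ?case by (simp add: PiM_empty lebesgue_integral_count_space_finite)
next
  case (Cons p P)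
  let ?M = "PiM (set (p # P)) (\<lambda>_. nu z)"
  let ?D = "\<lambda>x Q. det_list confluent_entry (double_rows (map x Q))"
  have "(\<integral>x. ?D x (p # P) ls \<partial>?M)
      = (\<integral>x. del_sum (\<lambda>k K. del_sum (\<lambda>m M. (x p ^ k * (real m * x p ^ (m - 1))) * ?D x P M) K) ls \<partial>?M)"
    by (intro Bochner_Integration.integral_cong refl)
      (simp add: confluent_entry_def mult_ac flip: del_sum_cmult)
  also have "\<dots> = del_sum (\<lambda>k K. del_sum (\<lambda>m M. (\<integral>x. (x p ^ k * (real m * x p ^ (m - 1))) * ?D x P M \<partial>?M)) K) ls"
    by (rule integral_del_sum_del_sum, rule integrable_cube_bounded) (auto intro!: cube_intros)
  also have "\<dots> = del_sum (\<lambda>k K. del_sum (\<lambda>m M. half_moment4 z k m * (\<integral>x. ?D x P M \<partial>PiM (set P) (\<lambda>_. nu z))) K) ls"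
    unfolding half_moment4_def list.set
    by (subst integral_split_component[where u = "\<lambda>t. t ^ k * (real m * t ^ (m - 1))" for k m])
      (use Cons in \<open>auto intro!: cube_intros simp: map_fun_upd_notin\<close>)
  also have "\<dots> = del_sum (\<lambda>k K. del_sum (\<lambda>m M. fact (length P) * (half_moment4 z k m * pfaffian (skew_moment4 z) M)) K) ls"
  proof (intro del_sum_cong)
    fix p1 k q1 p2 m q2 assume ls: "ls = p1 @ k # q1" and K: "p1 @ q1 = p2 @ m # q2"
    have "length (p2 @ q2) = 2 * length P" using arg_cong[OF K, of length] ls Cons.prems by simp
    then show "half_moment4 z k m * (\<integral>x. ?D x P (p2 @ q2) \<partial>PiM (set P) (\<lambda>_. nu z))
        = fact (length P) * (half_moment4 z k m * pfaffian (skew_moment4 z) (p2 @ q2))"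
      using Cons.IH[of "p2 @ q2"] Cons.prems by simp
  qed
  also have "\<dots> = fact (length P) * (1 * (real (length ls) / 2) * pfaffian (skew_moment4 z) ls)"
    unfolding del_sum_cmult
    by (subst pfaffian_double_expansion[of _ 1 "skew_moment4 z"]) (auto simp: skew_moment4_def)
  finally show ?case using Cons.prems by (simp add: algebra_simps)
qed

end

subsection \<open>Bilinear identities\<close>

definition power_sum :: "nat \<Rightarrow> nat \<Rightarrow> (nat \<Rightarrow> real) \<Rightarrow> real" where
  "power_sum n k x = (\<Sum>i\<in>{1..n}. x i ^ k)"

lemma cube_bounded_power_sum [cube_intros]: "cube_bounded {1..n} (power_sum n k)"
  unfolding power_sum_def by (intro cube_intros) auto

definition ensemble_weight :: "nat \<Rightarrow> nat \<Rightarrow> (nat \<Rightarrow> real) \<Rightarrow> real" where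
  "ensemble_weight \<beta> n x = \<bar>vandermonde (map x [1..<Suc n])\<bar> ^ \<beta>"

lemma cube_bounded_ensemble_weight [cube_intros]: "cube_bounded {1..n} (ensemble_weight \<beta> n)"
  unfolding ensemble_weight_def by (intro cube_intros) auto

lemma sum_list_power_sum: "(\<Sum>y\<leftarrow>map x [1..<Suc n]. y ^ k) = power_sum n k x"
proof -
  have "{1..<Suc n} = {1..n}" by auto
  then show ?thesis
    unfolding power_sum_def by (simp add: interv_sum_list_conv_sum_set_nat o_def del: upt_Suc)
qed

lemma set_upt_Suc: "set [1..<Suc n] = {1..n}"
  by auto

context jacobi_measure
begin

text \<open>Kept unnormalized, so that the relation between neighbouring sizes is bilinear and free
  of quotients.\<close>

definition ensemble :: "nat \<Rightarrow> nat \<Rightarrow> real \<Rightarrow> ((nat \<Rightarrow> real) \<Rightarrow> real) \<Rightarrow> real" where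
  "ensemble \<beta> n z g = (\<integral>x. g x * ensemble_weight \<beta> n x \<partial>PiM {1..n} (\<lambda>_. nu z))"

lemma integrable_ensemble:
  "cube_bounded {1..n} g \<Longrightarrow> integrable (PiM {1..n} (\<lambda>_. nu z)) (\<lambda>x. g x * ensemble_weight \<beta> n x)"
  by (intro integrable_cube_bounded cube_intros) auto

lemma ensemble_linear:
  assumes "cube_bounded {1..n} f" "cube_bounded {1..n} g"
  shows "ensemble \<beta> n z (\<lambda>x. f x + g x) = ensemble \<beta> n z f + ensemble \<beta> n z g"
    and "ensemble \<beta> n z (\<lambda>x. f x - g x) = ensemble \<beta> n z f - ensemble \<beta> n z g"
  unfolding ensemble_def
  using integrable_ensemble[OF assms(1), of z \<beta>] integrable_ensemble[OF assms(2), of z \<beta>]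
  by (simp_all add: distrib_right left_diff_distrib mult.assoc)

lemma ensemble_cmult: "ensemble \<beta> n z (\<lambda>x. c * g x) = c * ensemble \<beta> n z g"
  unfolding ensemble_def by (simp add: mult.assoc)

lemma skew_moment1_antisym: "skew_moment1 z k m = - skew_moment1 z m k"
  by (simp add: skew_moment1_def field_simps)

text \<open>A common frame for all \<beta>: \<open>K\<close> is the factor of the weight outside the
  alternant, \<open>h\<close> the multiplicity with which power sums shift exponents, and
  \<open>pre\<close> the list of fixed border indices. The left-hand side is 12 (s22 s0 - s1 s21 +
  s2 s11) for the averages, s0 being that of 1; the 12 clears the denominators 12, 3 and 2 * 2 from
  \<open>alternant_power_sums\<close>.\<close>

lemma ensemble_bilinear_identity:
  fixes A :: "(nat \<Rightarrow> real) \<Rightarrow> nat list \<Rightarrow> real"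
  assumes alt: "\<And>x. alternating (A x)"
    and sh: "\<And>x k ls. 1 \<le> k \<Longrightarrow> h * power_sum n k x * A x ls = shift_sum k (A x) ls"
    and wt: "\<And>x. A x [0..<m + 2] * K x = ensemble_weight \<beta> n x"
    and int: "\<And>ls. length ls = m + 2 \<Longrightarrow>
        (\<integral>x. A x ls * K x \<partial>PiM {1..n} (\<lambda>_. nu z)) = c * pfaffian w (pre @ map f ls)"
    and w: "\<And>x y. w x y = - w y x" and ev: "even (length pre + m)"
  defines "W \<equiv> ensemble \<beta> n z" and "p \<equiv> power_sum n"
  shows "(h ^ 4 * W (\<lambda>x. p 1 x ^ 4) + 3 * h\<^sup>2 * W (\<lambda>x. p 2 x ^ 2) - 4 * h\<^sup>2 * W (\<lambda>x. p 1 x * p 3 x)) * W (\<lambda>x. 1)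
      - 4 * h * W (p 1) * (h ^ 3 * W (\<lambda>x. p 1 x ^ 3) - h * W (p 3))
      + 3 * (h\<^sup>2 * W (\<lambda>x. p 1 x ^ 2) + h * W (p 2)) * (h\<^sup>2 * W (\<lambda>x. p 1 x ^ 2) - h * W (p 2))
     = 12 * c\<^sup>2 * pfaffian w (pre @ map f [0..<m]) * pfaffian w (pre @ map f [0..<m + 4])"
proof -
  define I where "I = [0..<m]"
  define Q where "Q = (\<lambda>ls. pfaffian w (pre @ map f (I @ ls)))"
  have I2: "[0..<m + 2] = I @ [m, m + 1]" and I4: "[0..<m + 4] = I @ [m, m + 1, m + 2, m + 3]"
    by (simp_all add: I_def numeral_eq_Suc)
  \<comment> \<open>An observable that turns the unshifted alternant into s times a shifted one
    averages to a Pfaffian with shifted indices.\<close>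
  have WA: "W g = s * c * Q ls" if "\<And>x. g x * A x (I @ [m, m + 1]) = s * A x (I @ ls)" "length ls = 2" for g s ls
  proof -
    have "W g = (\<integral>x. s * (A x (I @ ls) * K x) \<partial>PiM {1..n} (\<lambda>_. nu z))"
      unfolding W_def ensemble_def
      by (intro Bochner_Integration.integral_cong refl)
        (metis that(1) I2 wt mult.assoc)
    also have "\<dots> = s * (\<integral>x. A x (I @ ls) * K x \<partial>PiM {1..n} (\<lambda>_. nu z))"
      by (rule integral_mult_right_zero)
    also have "\<dots> = s * c * Q ls"
      using that(2) by (subst int) (simp_all add: I_def Q_def)
    finally show ?thesis .
  qed
  have cb: "cube_bounded {1..n} (p k)" for k unfolding p_def by (intro cube_intros)
  note lin = ensemble_linear[where \<beta> = \<beta> and n = n and z = z, folded W_def]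
  note cm = ensemble_cmult[where \<beta> = \<beta> and n = n and z = z, folded W_def]
  have s: "(h * p 1 x) * A x (I @ [m, m + 1]) = A x (I @ [m, m + 2])"
      "((h * p 1 x)\<^sup>2 + h * p 2 x) * A x (I @ [m, m + 1]) = 2 * A x (I @ [m, m + 3])"
      "((h * p 1 x)\<^sup>2 - h * p 2 x) * A x (I @ [m, m + 1]) = 2 * A x (I @ [m + 1, m + 2])"
      "((h * p 1 x) ^ 3 - h * p 3 x) * A x (I @ [m, m + 1]) = 3 * A x (I @ [m + 1, m + 3])"
      "((h * p 1 x) ^ 4 + 3 * (h * p 2 x)\<^sup>2 - 4 * (h * p 1 x * (h * p 3 x))) * A x (I @ [m, m + 1])
        = 12 * A x (I @ [m + 2, m + 3])" for x
    using alternant_power_sums[of "A x" "\<lambda>k. h * p k x" m, OF alt] sh unfolding p_def I_def by blast+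
  have W0: "W (\<lambda>x. 1) = 1 * c * Q [m, m + 1]" by (rule WA) auto
  have W1: "h * W (p 1) = 1 * c * Q [m, m + 2]"
  proof -
    have "W (\<lambda>x. h * p 1 x) = 1 * c * Q [m, m + 2]" by (rule WA) (use s(1) in auto)
    then show ?thesis by (simp add: cm)
  qed
  have W2: "h\<^sup>2 * W (\<lambda>x. p 1 x ^ 2) + h * W (p 2) = 2 * c * Q [m, m + 3]"
  proof -
    have "W (\<lambda>x. h\<^sup>2 * p 1 x ^ 2 + h * p 2 x) = 2 * c * Q [m, m + 3]"
      by (rule WA) (use s(2) in \<open>auto simp: power_mult_distrib\<close>)
    moreover have "W (\<lambda>x. h\<^sup>2 * p 1 x ^ 2 + h * p 2 x) = W (\<lambda>x. h\<^sup>2 * p 1 x ^ 2) + W (\<lambda>x. h * p 2 x)"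
      by (rule lin(1)) (intro cube_intros cb)+
    moreover have "W (\<lambda>x. h\<^sup>2 * p 1 x ^ 2) = h\<^sup>2 * W (\<lambda>x. p 1 x ^ 2)" "W (\<lambda>x. h * p 2 x) = h * W (p 2)"
      by (rule cm)+
    ultimately show ?thesis by simp
  qed
  have W3: "h\<^sup>2 * W (\<lambda>x. p 1 x ^ 2) - h * W (p 2) = 2 * c * Q [m + 1, m + 2]"
  proof -
    have "W (\<lambda>x. h\<^sup>2 * p 1 x ^ 2 - h * p 2 x) = 2 * c * Q [m + 1, m + 2]"
      by (rule WA) (use s(3) in \<open>auto simp: power_mult_distrib\<close>)
    moreover have "W (\<lambda>x. h\<^sup>2 * p 1 x ^ 2 - h * p 2 x) = W (\<lambda>x. h\<^sup>2 * p 1 x ^ 2) - W (\<lambda>x. h * p 2 x)"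
      by (rule lin(2)) (intro cube_intros cb)+
    moreover have "W (\<lambda>x. h\<^sup>2 * p 1 x ^ 2) = h\<^sup>2 * W (\<lambda>x. p 1 x ^ 2)" "W (\<lambda>x. h * p 2 x) = h * W (p 2)"
      by (rule cm)+
    ultimately show ?thesis by simp
  qed
  have W4: "h ^ 3 * W (\<lambda>x. p 1 x ^ 3) - h * W (p 3) = 3 * c * Q [m + 1, m + 3]"
  proof -
    have "W (\<lambda>x. h ^ 3 * p 1 x ^ 3 - h * p 3 x) = 3 * c * Q [m + 1, m + 3]"
      by (rule WA) (use s(4) in \<open>auto simp: power_mult_distrib\<close>)
    moreover have "W (\<lambda>x. h ^ 3 * p 1 x ^ 3 - h * p 3 x) = W (\<lambda>x. h ^ 3 * p 1 x ^ 3) - W (\<lambda>x. h * p 3 x)"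
      by (rule lin(2)) (intro cube_intros cb)+
    moreover have "W (\<lambda>x. h ^ 3 * p 1 x ^ 3) = h ^ 3 * W (\<lambda>x. p 1 x ^ 3)" "W (\<lambda>x. h * p 3 x) = h * W (p 3)"
      by (rule cm)+
    ultimately show ?thesis by simp
  qed
  have W5: "h ^ 4 * W (\<lambda>x. p 1 x ^ 4) + 3 * h\<^sup>2 * W (\<lambda>x. p 2 x ^ 2) - 4 * h\<^sup>2 * W (\<lambda>x. p 1 x * p 3 x)
      = 12 * c * Q [m + 2, m + 3]"
  proof -
    let ?a = "\<lambda>x. h ^ 4 * p 1 x ^ 4" and ?b = "\<lambda>x. 3 * h\<^sup>2 * p 2 x ^ 2" and ?c = "\<lambda>x. 4 * h\<^sup>2 * (p 1 x * p 3 x)"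
    have "W (\<lambda>x. ?a x + ?b x - ?c x) = 12 * c * Q [m + 2, m + 3]"
      by (rule WA) (use s(5) in \<open>auto simp: power_mult_distrib power2_eq_square algebra_simps\<close>)
    moreover have "W (\<lambda>x. ?a x + ?b x - ?c x) = W (\<lambda>x. ?a x + ?b x) - W ?c"
      by (rule lin(2)) (intro cube_intros cb)+
    moreover have "W (\<lambda>x. ?a x + ?b x) = W ?a + W ?b"
      by (rule lin(1)) (intro cube_intros cb)+
    moreover have "W ?a = h ^ 4 * W (\<lambda>x. p 1 x ^ 4)" "W ?b = 3 * h\<^sup>2 * W (\<lambda>x. p 2 x ^ 2)"
      "W ?c = 4 * h\<^sup>2 * W (\<lambda>x. p 1 x * p 3 x)"
      by (rule cm)+
    ultimately show ?thesis by simp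
  qed
  have "pfaffian w (pre @ map f I) * Q [m, m + 1, m + 2, m + 3]
      = Q [m, m + 1] * Q [m + 2, m + 3] - Q [m, m + 2] * Q [m + 1, m + 3] + Q [m, m + 3] * Q [m + 1, m + 2]"
    using pfaffian_three_term[of w "pre @ map f I" "f m" "f (m + 1)" "f (m + 2)" "f (m + 3)", OF w] ev
    by (simp add: Q_def I_def)
  moreover have "4 * h * W (p 1) = 4 * (1 * c * Q [m, m + 2])" unfolding W1[symmetric] by simp
  moreover have "pfaffian w (pre @ map f (I @ [m, m + 1, m + 2, m + 3])) = Q [m, m + 1, m + 2, m + 3]"
    by (simp only: Q_def)
  ultimately show ?thesis unfolding W0 W2 W3 W4 W5 I4 I_def[symmetric] by algebra
qed

lemma ensemble_one_even:
  assumes "even n"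
  shows "ensemble (Suc 0) n z (\<lambda>x. 1) = fact n * pfaffian (skew_moment1 z) [0..<n]"
proof -
  have "ensemble (Suc 0) n z (\<lambda>x. 1) = (\<integral>x. det_list (\<lambda>x l. x ^ l) (map x [1..<Suc n]) [0..<n]
      * sgn (vandermonde (map x [1..<Suc n])) \<partial>PiM (set [1..<Suc n]) (\<lambda>_. nu z))"
    unfolding ensemble_def ensemble_weight_def set_upt_Suc
    by (intro Bochner_Integration.integral_cong refl)
      (use det_list_powers[of "map _ [1..<Suc n]"] in \<open>simp add: abs_sgn del: upt_Suc\<close>)
  also have "\<dots> = fact n * pfaffian (skew_moment1 z) [0..<n]"
    using integral_alternant_sgn_even[of "[1..<Suc n]" "[0..<n]" z] assms by (simp del: upt_Suc)
  finally show ?thesis .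
qed

lemma ensemble_one_odd:
  assumes "odd n"
  shows "ensemble (Suc 0) n z (\<lambda>x. 1) = fact n * pfaffian (bordered_moment1 z) (None # map Some [0..<n])"
proof -
  have "ensemble (Suc 0) n z (\<lambda>x. 1) = (\<integral>x. det_list (\<lambda>x l. x ^ l) (map x [1..<Suc n]) [0..<n]
      * sgn (vandermonde (map x [1..<Suc n])) \<partial>PiM (set [1..<Suc n]) (\<lambda>_. nu z))"
    unfolding ensemble_def ensemble_weight_def set_upt_Suc
    by (intro Bochner_Integration.integral_cong refl)
      (use det_list_powers[of "map _ [1..<Suc n]"] in \<open>simp add: abs_sgn del: upt_Suc\<close>)
  also have "\<dots> = fact n * pfaffian (bordered_moment1 z) (None # map Some [0..<n])"
    using integral_alternant_sgn_odd[of "[1..<Suc n]" "[0..<n]" z] assms by (simp del: upt_Suc)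
  finally show ?thesis .
qed

lemma ensemble_one_quaternion:
  "ensemble 4 n z (\<lambda>x. 1) = fact n * pfaffian (skew_moment4 z) [0..<2 * n]"
proof -
  have "ensemble 4 n z (\<lambda>x. 1) = (\<integral>x. det_list confluent_entry (double_rows (map x [1..<Suc n])) [0..<2 * n]
      \<partial>PiM (set [1..<Suc n]) (\<lambda>_. nu z))"
    unfolding ensemble_def ensemble_weight_def set_upt_Suc
    by (intro Bochner_Integration.integral_cong refl)
      (use det_list_confluent[of "map _ [1..<Suc n]"] in \<open>simp del: upt_Suc\<close>)
  also have "\<dots> = fact n * pfaffian (skew_moment4 z) [0..<2 * n]"
    using integral_confluent_alternant[of "[1..<Suc n]" "[0..<2 * n]" z] by (simp del: upt_Suc)
  finally show ?thesis .
qed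

definition plucker_defect :: "nat \<Rightarrow> nat \<Rightarrow> real \<Rightarrow> real \<Rightarrow> real" where
  "plucker_defect \<beta> n h z = (let W = ensemble \<beta> n z; p = power_sum n in
      (h ^ 4 * W (\<lambda>x. p 1 x ^ 4) + 3 * h\<^sup>2 * W (\<lambda>x. p 2 x ^ 2) - 4 * h\<^sup>2 * W (\<lambda>x. p 1 x * p 3 x)) * W (\<lambda>x. 1)
      - 4 * h * W (p 1) * (h ^ 3 * W (\<lambda>x. p 1 x ^ 3) - h * W (p 3))
      + 3 * (h\<^sup>2 * W (\<lambda>x. p 1 x ^ 2) + h * W (p 2)) * (h\<^sup>2 * W (\<lambda>x. p 1 x ^ 2) - h * W (p 2)))"

text \<open>The alternant has 2n exponents, so removing or adding two of them changes n by one. The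
  rational factor is (n!)^2 / ((n - 1)! (n + 1)!).\<close>

lemma plucker_defect_quaternion:
  assumes "1 \<le> n"
  shows "plucker_defect 4 n 2 z
     = 12 * (real n / (real n + 1)) * (ensemble 4 (n - 1) z (\<lambda>x. 1) * ensemble 4 (n + 1) z (\<lambda>x. 1))"
proof -
  obtain n' where n: "n = Suc n'" using assms by (cases n) auto
  define m where "m = 2 * n'"
  have m: "m + 2 = 2 * n" "m + 4 = 2 * (n + 1)" "m = 2 * (n - 1)" by (simp_all add: m_def n)
  let ?A = "\<lambda>x. det_list confluent_entry (double_rows (map x [1..<Suc n]))"
  have "plucker_defect 4 n 2 z
      = 12 * (fact n)\<^sup>2 * pfaffian (skew_moment4 z) ([] @ map id [0..<m]) * pfaffian (skew_moment4 z) ([] @ map id [0..<m + 4])"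
    unfolding plucker_defect_def Let_def
  proof (rule ensemble_bilinear_identity[where A = ?A and K = "\<lambda>_. 1"])
    show "alternating (?A x)" for x by (rule alternating_det_list)
    show "2 * power_sum n k x * ?A x ls = shift_sum k (?A x) ls" if "1 \<le> k" for x k ls
      unfolding shift_sum_confluent[OF that] sum_list_power_sum ..
    show "?A x [0..<m + 2] * 1 = ensemble_weight 4 n x" for x
      using det_list_confluent[of "map x [1..<Suc n]"] unfolding m(1) ensemble_weight_def by (simp del: upt_Suc)
    show "(\<integral>x. ?A x ls * 1 \<partial>PiM {1..n} (\<lambda>_. nu z)) = fact n * pfaffian (skew_moment4 z) ([] @ map id ls)"
      if "length ls = m + 2" for ls
      using integral_confluent_alternant[of "[1..<Suc n]" ls z] that m(1)
      unfolding set_upt_Suc by (simp del: upt_Suc)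
  qed (auto simp: skew_moment4_def m_def)
  also have "\<dots> = 12 * (real n / (real n + 1)) * (ensemble 4 (n - 1) z (\<lambda>x. 1) * ensemble 4 (n + 1) z (\<lambda>x. 1))"
    unfolding ensemble_one_quaternion m(2) unfolding m(3) by (simp add: n power2_eq_square field_simps)
  finally show ?thesis .
qed

text \<open>With one exponent per point, removing or adding two of them changes n by two, and the
  rational factor is (n!)^2 / ((n - 2)! (n + 2)!). All three sizes have the same parity, which
  selects the plain or the bordered Pfaffian.\<close>

lemma plucker_defect_orthogonal:
  assumes "2 \<le> n"
  shows "plucker_defect (Suc 0) n 1 z = 12 * (real n * (real n - 1) / ((real n + 1) * (real n + 2)))
     * (ensemble (Suc 0) (n - 2) z (\<lambda>x. 1) * ensemble (Suc 0) (n + 2) z (\<lambda>x. 1))"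
proof -
  define m where "m = n - 2"
  have m: "m + 2 = n" "m + 4 = n + 2" using assms by (simp_all add: m_def)
  have fact: "fact (n + 2) = (real n + 2) * (real n + 1) * fact n" "fact n = real n * (real n - 1) * fact m"
    using m(1) by (auto simp: algebra_simps)
  have ratio: "12 * (fact n)\<^sup>2 * P * Q = 12 * (real n * (real n - 1) / ((real n + 1) * (real n + 2)))
      * ((fact m * P) * (fact (n + 2) * Q))" for P Q
  proof -
    have "(real n * (real n - 1) / ((real n + 1) * (real n + 2))) * (G * ((real n + 2) * (real n + 1) * F))
        = (real n * (real n - 1) * G) * F" for F G
      by (simp add: divide_simps)
    from this[of "fact m" "fact n"]
    have "(real n * (real n - 1) / ((real n + 1) * (real n + 2))) * (fact m * fact (n + 2)) = (fact n)\<^sup>2"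
      unfolding fact(1) fact(2)[symmetric] by (simp only: power2_eq_square)
    then have "12 * (fact n)\<^sup>2 * P * Q
        = 12 * (real n * (real n - 1) / ((real n + 1) * (real n + 2)) * (fact m * fact (n + 2))) * P * Q"
      by (simp only:)
    then show ?thesis by (simp only: mult_ac)
  qed
  let ?A = "\<lambda>x. det_list (\<lambda>x l. x ^ l) (map x [1..<Suc n])"
  let ?K = "\<lambda>x. sgn (vandermonde (map x [1..<Suc n]))"
  have alt: "alternating (?A x)" for x by (rule alternating_det_list)
  have sh: "1 * power_sum n k x * ?A x ls = shift_sum k (?A x) ls" for x k ls
    unfolding shift_sum_powers sum_list_power_sum by simp
  have wt: "?A x [0..<m + 2] * ?K x = ensemble_weight (Suc 0) n x" for x
    using det_list_powers[of "map x [1..<Suc n]"] unfolding m ensemble_weight_def by (simp add: abs_sgn del: upt_Suc)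
  show ?thesis
  proof (cases "even n")
    case True
    have "plucker_defect (Suc 0) n 1 z
        = 12 * (fact n)\<^sup>2 * pfaffian (skew_moment1 z) ([] @ map id [0..<m]) * pfaffian (skew_moment1 z) ([] @ map id [0..<m + 4])"
      unfolding plucker_defect_def Let_def
    proof (rule ensemble_bilinear_identity[where A = ?A and K = ?K])
      show "(\<integral>x. ?A x ls * ?K x \<partial>PiM {1..n} (\<lambda>_. nu z)) = fact n * pfaffian (skew_moment1 z) ([] @ map id ls)"
        if "length ls = m + 2" for ls
        using integral_alternant_sgn_even[of "[1..<Suc n]" ls z] that m(1) True
        unfolding set_upt_Suc by (simp del: upt_Suc)
    qed (use alt sh wt True m_def in \<open>auto intro: skew_moment1_antisym simp del: upt_Suc\<close>)
    also have "\<dots> = 12 * (real n * (real n - 1) / ((real n + 1) * (real n + 2)))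
       * (ensemble (Suc 0) (n - 2) z (\<lambda>x. 1) * ensemble (Suc 0) (n + 2) z (\<lambda>x. 1))"
      unfolding ratio m_def[symmetric] using True m_def
      by (subst (1 2) ensemble_one_even) (simp_all only: m append_Nil list.map_id, auto)
    finally show ?thesis .
  next
    case False
    have "plucker_defect (Suc 0) n 1 z
        = 12 * (fact n)\<^sup>2 * pfaffian (bordered_moment1 z) ([None] @ map Some [0..<m])
          * pfaffian (bordered_moment1 z) ([None] @ map Some [0..<m + 4])"
      unfolding plucker_defect_def Let_def
    proof (rule ensemble_bilinear_identity[where A = ?A and K = ?K])
      show "(\<integral>x. ?A x ls * ?K x \<partial>PiM {1..n} (\<lambda>_. nu z)) = fact n * pfaffian (bordered_moment1 z) ([None] @ map Some ls)"
        if "length ls = m + 2" for ls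
        using integral_alternant_sgn_odd[of "[1..<Suc n]" ls z] that m(1) False
        unfolding set_upt_Suc by (simp del: upt_Suc)
      show "bordered_moment1 z x y = - bordered_moment1 z y x" for x y
        by (cases x; cases y) (simp_all add: bordered_moment1_def skew_moment1_def field_simps)
    qed (use alt sh wt False m in \<open>auto simp del: upt_Suc\<close>)
    also have "\<dots> = 12 * (real n * (real n - 1) / ((real n + 1) * (real n + 2)))
       * (ensemble (Suc 0) (n - 2) z (\<lambda>x. 1) * ensemble (Suc 0) (n + 2) z (\<lambda>x. 1))"
      unfolding ratio m_def[symmetric] using False m_def assms
      by (subst (1 2) ensemble_one_odd) (simp_all only: m append_Cons append_Nil, auto)
    finally show ?thesis .
  qed
qed

text \<open>A determinant is the Pfaffian of an off-diagonal block form.  This brings the unitary case under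
  the three-term relation, where the left-hand side vanishes because its first factor is unbalanced.\<close>

definition hankel_form :: "real \<Rightarrow> nat + nat \<Rightarrow> nat + nat \<Rightarrow> real" where
  "hankel_form z x y = (case (x, y) of (Inl l, Inr e) \<Rightarrow> - moment z (l + e) | (Inr e, Inl l) \<Rightarrow> moment z (l + e) | _ \<Rightarrow> 0)"

text \<open>Labels of the same kind pair to 0, so only matchings between the two blocks survive.
  Each \<open>Inl\<close> partner has to pass the remaining \<open>Inr\<close> labels, which
  accounts for the sign.\<close>

lemma pfaffian_hankel_form:
  "pfaffian (hankel_form z) (map Inr es @ map Inl ls)
     = (-1) ^ (\<Sum>i<length es. i) * det_list (\<lambda>e l. moment z (l + e)) es ls"
proof (induction es arbitrary: ls)
  case Nil
  show ?case
  proof (cases ls)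
    case (Cons l ls)
    have "del_sum (\<lambda>y ys. hankel_form z (Inl l) y * pfaffian (hankel_form z) ys) (map Inl ls) = 0"
      by (rule del_sum_eq_0) (auto simp: hankel_form_def map_eq_append_conv)
    then show ?thesis by (simp add: Cons pfaffian_Cons)
  qed simp
next
  case (Cons e es)
  have z: "del_sum (\<lambda>y zs. hankel_form z (Inr e) (Inr y) * pfaffian (hankel_form z) (map Inr zs @ map Inl ls)) es = 0"
    by (rule del_sum_eq_0) (simp add: hankel_form_def)
  have h: "hankel_form z (Inr e) (Inl l) = moment z (l + e)" for l by (simp add: hankel_form_def)
  show ?case
    by (simp add: pfaffian_Cons del_sum_append z del_sum_map h Cons mult.left_commute[of "moment z _"]
        del_sum_cmult power_add)
qed

lemma plucker_defect_unitary: "plucker_defect 2 (m + 2) 1 z = 0"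
proof -
  let ?n = "m + 2"
  let ?A = "\<lambda>x. det_list (\<lambda>x l. x ^ l) (map x [1..<Suc ?n])"
  let ?K = "\<lambda>x. det_list (\<lambda>x l. x ^ l) (map x [1..<Suc ?n]) [0..<?n]"
  define s where "s = ((-1) ^ (\<Sum>i<?n. i) :: real)"
  have s: "s * s = 1" by (simp add: s_def flip: power_mult_distrib)
  have "plucker_defect 2 ?n 1 z
      = 12 * (s * fact ?n)\<^sup>2 * pfaffian (hankel_form z) (map Inr [0..<?n] @ map Inl [0..<m])
          * pfaffian (hankel_form z) (map Inr [0..<?n] @ map Inl [0..<m + 4])"
    unfolding plucker_defect_def Let_def
  proof (rule ensemble_bilinear_identity[where A = ?A and K = ?K])
    show "alternating (?A x)" for x by (rule alternating_det_list)
    show "1 * power_sum ?n k x * ?A x ls = shift_sum k (?A x) ls" for x k ls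
      unfolding shift_sum_powers sum_list_power_sum by simp
    show "?A x [0..<m + 2] * ?K x = ensemble_weight 2 ?n x" for x
      using det_list_powers[of "map x [1..<Suc ?n]"]
      unfolding ensemble_weight_def by (simp add: power2_eq_square del: upt_Suc)
    show "(\<integral>x. ?A x ls * ?K x \<partial>PiM {1..?n} (\<lambda>_. nu z))
        = s * fact ?n * pfaffian (hankel_form z) (map Inr [0..<?n] @ map Inl ls)"
      if "length ls = m + 2" for ls
    proof -
      have "(\<integral>x. ?A x ls * ?K x \<partial>PiM {1..?n} (\<lambda>_. nu z))
          = fact ?n * det_list (\<lambda>e l. moment z (l + e)) [0..<?n] ls"
        using integral_alternant_alternant[of "[1..<Suc ?n]" ls "[0..<?n]" z] that
        unfolding set_upt_Suc by (simp del: upt_Suc)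
      moreover have "pfaffian (hankel_form z) (map Inr [0..<?n] @ map Inl ls)
          = s * det_list (\<lambda>e l. moment z (l + e)) [0..<?n] ls"
        unfolding pfaffian_hankel_form s_def by simp
      ultimately show ?thesis using s by (simp add: mult.commute mult.left_commute)
    qed
    show "hankel_form z x y = - hankel_form z y x" for x y
      by (auto simp: hankel_form_def split: sum.splits)
  qed auto
  moreover have "pfaffian (hankel_form z) (map Inr [0..<?n] @ map Inl [0..<m]) = 0"
  proof -
    have "det_list c es ls = 0" if "length es \<noteq> length ls" for c :: "nat \<Rightarrow> nat \<Rightarrow> real" and es ls
      using that
    proof (induction es arbitrary: ls)
      case (Cons e es)
      show ?case unfolding det_list.simps
        by (rule del_sum_eq_0) (use Cons in auto)
    qed auto
    from this[of "[0..<?n]" "[0..<m]"] show ?thesis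
      unfolding pfaffian_hankel_form by (simp del: upt_Suc)
  qed
  ultimately show ?thesis by simp
qed

text \<open>For one point p_k = p_1^k, and each of the three products has a vanishing factor; in the
  first one this is 1 + 3 - 4 = 0.\<close>

lemma plucker_defect_single: "plucker_defect \<beta> (Suc 0) 1 z = 0"
proof -
  have p: "power_sum (Suc 0) k = (\<lambda>x. x 1 ^ k)" for k by (simp add: power_sum_def fun_eq_iff)
  have "(\<lambda>x::nat \<Rightarrow> real. x 1 * x 1 ^ 3) = (\<lambda>x. x 1 ^ 4)" "(\<lambda>x::nat \<Rightarrow> real. (x 1 ^ 2) ^ 2) = (\<lambda>x. x 1 ^ 4)"
    by (auto simp: fun_eq_iff power4_eq_xxxx power3_eq_cube power2_eq_square)
  then show ?thesis unfolding plucker_defect_def Let_def p by simp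
qed

end

subsection \<open>Integration by parts\<close>

text \<open>Indexed by a set, so that any coordinate can be split off, whatever its place in the
  order.\<close>

definition vandermonde_set :: "nat set \<Rightarrow> (nat \<Rightarrow> real) \<Rightarrow> real" where
  "vandermonde_set I x = (\<Prod>k\<in>I. \<Prod>i\<in>{i\<in>I. i < k}. \<bar>x k - x i\<bar>)"

lemma vandermonde_set_insert:
  assumes "finite I" "j \<notin> I"
  shows "vandermonde_set (insert j I) x = (\<Prod>i\<in>I. \<bar>x j - x i\<bar>) * vandermonde_set I x"
proof -
  have 1: "{i \<in> insert j I. i < j} = {i \<in> I. i < j}" by auto
  have 2: "(\<Prod>i\<in>{i \<in> insert j I. i < k}. \<bar>x k - x i\<bar>)
      = (if j < k then \<bar>x j - x k\<bar> else 1) * (\<Prod>i\<in>{i\<in>I. i < k}. \<bar>x k - x i\<bar>)" if "k \<in> I" for k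
  proof (cases "j < k")
    case True
    then have "{i \<in> insert j I. i < k} = insert j {i \<in> I. i < k}" by auto
    then show ?thesis using True assms by (simp add: abs_minus_commute)
  next
    case False
    then have "{i \<in> insert j I. i < k} = {i \<in> I. i < k}" by auto
    then show ?thesis using False by simp
  qed
  have "vandermonde_set (insert j I) x
      = (\<Prod>i\<in>{i\<in>I. i < j}. \<bar>x j - x i\<bar>) * ((\<Prod>k\<in>I. if j < k then \<bar>x j - x k\<bar> else 1) * vandermonde_set I x)"
    unfolding vandermonde_set_def prod.insert[OF assms] 1 prod.distrib[symmetric]
    by (rule arg_cong[OF prod.cong]) (use 2 in auto)
  also have "(\<Prod>k\<in>I. if j < k then \<bar>x j - x k\<bar> else 1) = (\<Prod>k\<in>{k\<in>I. j < k}. \<bar>x j - x k\<bar>)"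
    using assms by (simp add: prod.inter_filter)
  also have "(\<Prod>i\<in>{i\<in>I. i < j}. \<bar>x j - x i\<bar>) * ((\<Prod>k\<in>{k\<in>I. j < k}. \<bar>x j - x k\<bar>) * vandermonde_set I x)
      = (\<Prod>i\<in>{i\<in>I. i < j} \<union> {k\<in>I. j < k}. \<bar>x j - x i\<bar>) * vandermonde_set I x"
    using assms by (subst prod.union_disjoint) auto
  also have "{i\<in>I. i < j} \<union> {k\<in>I. j < k} = I" using assms(2) by (auto, metis linorder_neqE_nat)
  finally show ?thesis .
qed

lemma vandermonde_snoc: "vandermonde (xs @ [y]) = vandermonde xs * (\<Prod>z\<leftarrow>xs. y - z)"
  by (induction xs) (auto simp: algebra_simps)

lemma abs_vandermonde: "\<bar>vandermonde (map x [1..<Suc n])\<bar> = vandermonde_set {1..n} x"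
proof (induction n)
  case (Suc n)
  have "\<bar>\<Prod>z\<leftarrow>map x [1..<Suc n]. x (Suc n) - z\<bar> = (\<Prod>i\<in>{1..n}. \<bar>x (Suc n) - x i\<bar>)"
  proof -
    have "(\<Prod>z\<leftarrow>map x [1..<Suc n]. x (Suc n) - z) = (\<Prod>i\<in>set [1..<Suc n]. x (Suc n) - x i)"
      by (simp add: o_def prod.distinct_set_conv_list del: upt_Suc set_upt)
    then show ?thesis unfolding set_upt_Suc by (simp add: abs_prod)
  qed
  moreover have "{1..Suc n} = insert (Suc n) {1..n}" by auto
  moreover have "map x [1..<Suc (Suc n)] = map x [1..<Suc n] @ [x (Suc n)]" by simp
  ultimately show ?case using Suc
    by (simp only: vandermonde_snoc abs_mult) (subst vandermonde_set_insert, auto)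
qed (simp add: vandermonde_set_def)

lemma ensemble_weight_set: "ensemble_weight \<beta> n x = vandermonde_set {1..n} x ^ \<beta>"
  unfolding ensemble_weight_def abs_vandermonde ..

lemma ensemble_weight_split:
  assumes "j \<in> {1..n}"
  shows "ensemble_weight \<beta> n x
     = (\<Prod>i\<in>{1..n} - {j}. \<bar>x j - x i\<bar> ^ \<beta>) * vandermonde_set ({1..n} - {j}) x ^ \<beta>"
proof -
  have "{1..n} = insert j ({1..n} - {j})" using assms by auto
  then have "vandermonde_set {1..n} x = (\<Prod>i\<in>{1..n} - {j}. \<bar>x j - x i\<bar>) * vandermonde_set ({1..n} - {j}) x"
    by (metis vandermonde_set_insert finite_Diff finite_atLeastAtMost Diff_iff singletonI)
  then show ?thesis unfolding ensemble_weight_set by (simp add: power_mult_distrib prod_power_distrib)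
qed

lemma vandermonde_set_upd: "j \<notin> I \<Longrightarrow> vandermonde_set I (x(j := t)) = vandermonde_set I x"
  unfolding vandermonde_set_def by (intro prod.cong refl) auto

lemma ensemble_weight_upd:
  assumes "j \<in> {1..n}"
  shows "ensemble_weight \<beta> n (x(j := t))
     = (\<Prod>i\<in>{1..n} - {j}. \<bar>t - x i\<bar> ^ \<beta>) * vandermonde_set ({1..n} - {j}) x ^ \<beta>"
  unfolding ensemble_weight_split[OF assms]
  by (simp add: vandermonde_set_upd)

lemma cube_bounded_vandermonde_set [cube_intros]:
  "J \<subseteq> I \<Longrightarrow> cube_bounded I (vandermonde_set J)"
  unfolding vandermonde_set_def by (intro cube_intros) auto

lemma DERIV_abs_power:
  assumes "t \<noteq> (c::real)"
  shows "((\<lambda>t. \<bar>t - c\<bar> ^ \<beta>) has_real_derivative \<bar>t - c\<bar> ^ \<beta> * (real \<beta> / (t - c))) (at t)"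
proof (cases \<beta>)
  case (Suc b)
  have "((\<lambda>t. \<bar>t - c\<bar>) has_real_derivative sgn (t - c)) (at t)"
  proof (rule has_field_derivative_transform_within_open)
    show "((\<lambda>u. sgn (t - c) * (u - c)) has_real_derivative sgn (t - c)) (at t)"
      by (auto intro!: derivative_eq_intros)
    show "open (if t < c then {..<c} else {c<..})" by simp
    show "sgn (t - c) * (u - c) = \<bar>u - c\<bar>" if "u \<in> (if t < c then {..<c} else {c<..})" for u
      using that assms by (auto simp: sgn_if split: if_splits)
  qed (use assms in auto)
  then have "((\<lambda>t. \<bar>t - c\<bar> ^ \<beta>) has_real_derivative real \<beta> * (sgn (t - c) * \<bar>t - c\<bar> ^ (\<beta> - Suc 0))) (at t)"
    by (rule DERIV_power)
  moreover have "real \<beta> * (sgn (t - c) * \<bar>t - c\<bar> ^ (\<beta> - Suc 0)) = \<bar>t - c\<bar> ^ \<beta> * (real \<beta> / (t - c))"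
    using assms by (auto simp: Suc sgn_if field_simps)
  ultimately show ?thesis by simp
qed simp

lemma DERIV_prod_abs_power:
  assumes "finite J" "\<And>i. i \<in> J \<Longrightarrow> t \<noteq> (c i :: real)"
  shows "((\<lambda>t. \<Prod>i\<in>J. \<bar>t - c i\<bar> ^ \<beta>) has_real_derivative
     (\<Prod>i\<in>J. \<bar>t - c i\<bar> ^ \<beta>) * (\<Sum>i\<in>J. real \<beta> / (t - c i))) (at t)"
  using assms
proof (induction J rule: finite_induct)
  case (insert j J)
  have "((\<lambda>t. \<bar>t - c j\<bar> ^ \<beta> * (\<Prod>i\<in>J. \<bar>t - c i\<bar> ^ \<beta>)) has_real_derivative
      \<bar>t - c j\<bar> ^ \<beta> * (real \<beta> / (t - c j)) * (\<Prod>i\<in>J. \<bar>t - c i\<bar> ^ \<beta>)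
      + (\<Prod>i\<in>J. \<bar>t - c i\<bar> ^ \<beta>) * (\<Sum>i\<in>J. real \<beta> / (t - c i)) * \<bar>t - c j\<bar> ^ \<beta>) (at t)"
    by (rule DERIV_mult) (use insert DERIV_abs_power in auto)
  then show ?case using insert by (simp add: algebra_simps)
qed simp

text \<open>Since 1 \<le> \<beta>, the factor |x j - x i|^\<beta> absorbs the pole of the
  logarithmic derivative. For \<beta> = 1 a bounded jump remains; at the tie itself the quotient is
  0 by the convention for division by 0.\<close>

lemma cube_bounded_weight_quotient:
  assumes "j \<in> {1..n}" "1 \<le> \<beta>"
  shows "cube_bounded {1..n} (\<lambda>x. ensemble_weight \<beta> n x * (\<Sum>i\<in>{1..n} - {j}. real \<beta> / (x j - x i)))"
proof -
  have "cube_bounded {1..n} (\<lambda>x. \<bar>x j - x i\<bar> ^ \<beta> * (1 / (x j - x i)))" if i: "i \<in> {1..n} - {j}" for i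
  proof (rule cube_bounded_comp[where g = "\<lambda>u. \<bar>u\<bar> ^ \<beta> * (1 / u)" and B = 1])
    show "cube_bounded {1..n} (\<lambda>x. x j - x i)" using assms i by (intro cube_intros) auto
    fix x :: "nat \<Rightarrow> real" assume "in_cube {1..n} x"
    then have "0 < x j" "x j < 1" "0 < x i" "x i < 1" using assms(1) i by (auto simp: in_cube_def)
    then have "\<bar>x j - x i\<bar> \<le> 1" by linarith
    moreover have "\<bar>\<bar>u\<bar> ^ \<beta> * (1 / u)\<bar> = (if u = 0 then 0 else \<bar>u\<bar> ^ (\<beta> - 1))" for u :: real
      using assms(2) by (cases \<beta>) (auto simp: abs_mult power_abs)
    ultimately show "\<bar>\<bar>x j - x i\<bar> ^ \<beta> * (1 / (x j - x i))\<bar> \<le> 1" by (simp add: power_le_one)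
  qed measurable
  then have "cube_bounded {1..n} (\<lambda>x. \<Sum>i\<in>{1..n} - {j}. real \<beta> * ((\<bar>x j - x i\<bar> ^ \<beta> * (1 / (x j - x i)))
      * ((\<Prod>l\<in>{1..n} - {j} - {i}. \<bar>x j - x l\<bar> ^ \<beta>) * vandermonde_set ({1..n} - {j}) x ^ \<beta>)))"
    by (intro cube_bounded_sum cube_bounded_mult[OF cube_bounded_const cube_bounded_mult])
      (blast, intro cube_intros, use assms in auto)
  moreover have "(\<Sum>i\<in>{1..n} - {j}. real \<beta> * ((\<bar>x j - x i\<bar> ^ \<beta> * (1 / (x j - x i)))
      * ((\<Prod>l\<in>{1..n} - {j} - {i}. \<bar>x j - x l\<bar> ^ \<beta>) * vandermonde_set ({1..n} - {j}) x ^ \<beta>)))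
      = ensemble_weight \<beta> n x * (\<Sum>i\<in>{1..n} - {j}. real \<beta> / (x j - x i))" for x
    unfolding sum_distrib_left
  proof (rule sum.cong[OF refl])
    fix i assume i: "i \<in> {1..n} - {j}"
    have "(\<Prod>l\<in>{1..n} - {j}. \<bar>x j - x l\<bar> ^ \<beta>) = \<bar>x j - x i\<bar> ^ \<beta> * (\<Prod>l\<in>{1..n} - {j} - {i}. \<bar>x j - x l\<bar> ^ \<beta>)"
      by (rule prod.remove) (use i in auto)
    then show "real \<beta> * ((\<bar>x j - x i\<bar> ^ \<beta> * (1 / (x j - x i)))
      * ((\<Prod>l\<in>{1..n} - {j} - {i}. \<bar>x j - x l\<bar> ^ \<beta>) * vandermonde_set ({1..n} - {j}) x ^ \<beta>))
      = ensemble_weight \<beta> n x * (real \<beta> / (x j - x i))"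
      unfolding ensemble_weight_split[OF assms(1)] by simp
  qed
  ultimately show ?thesis by simp
qed

text \<open>Adding the terms for (j, i) and (i, j) turns v (x j) / (x j - x i) into the divided
  difference D of v. At ties, where the quotient carries no information, the factor V
  vanishes.\<close>

lemma symmetrized_sum:
  fixes x :: "nat \<Rightarrow> real" and V :: real
  assumes "finite I" and dd: "\<And>s t. (s - t) * D s t = v s - v t" and D: "\<And>s t. D s t = D t s"
    and V: "\<And>i j. i \<in> I \<Longrightarrow> j \<in> I \<Longrightarrow> i \<noteq> j \<Longrightarrow> x i = x j \<Longrightarrow> V = 0"
  shows "(\<Sum>j\<in>I. v (x j) * (V * (\<Sum>i\<in>I - {j}. c / (x j - x i)))) = c / 2 * V * (\<Sum>j\<in>I. \<Sum>i\<in>I - {j}. D (x j) (x i))"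
proof -
  let ?f = "\<lambda>j i. v (x j) * V * c / (x j - x i)"
  have 1: "(\<Sum>j\<in>I. v (x j) * (V * (\<Sum>i\<in>I - {j}. c / (x j - x i)))) = (\<Sum>j\<in>I. \<Sum>i\<in>I - {j}. ?f j i)"
    by (simp add: sum_distrib_left mult.assoc)
  have 2: "(\<Sum>j\<in>I. \<Sum>i\<in>I - {j}. ?f j i) = (\<Sum>i\<in>I. \<Sum>j\<in>I - {i}. ?f j i)"
  proof -
    have e: "(\<Sum>i\<in>I - {j}. g i) = (\<Sum>i\<in>I. if i = j then 0 else g i)" for j and g :: "nat \<Rightarrow> real"
      using assms(1) by (simp add: sum.If_cases Diff_eq Collect_neg_eq[symmetric] flip: singleton_conv)
    show ?thesis unfolding e by (subst sum.swap) (intro sum.cong refl, auto)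
  qed
  have "2 * (\<Sum>j\<in>I. \<Sum>i\<in>I - {j}. ?f j i) = (\<Sum>j\<in>I. \<Sum>i\<in>I - {j}. ?f j i) + (\<Sum>i\<in>I. \<Sum>j\<in>I - {i}. ?f j i)"
    using 2 by simp
  also have "\<dots> = (\<Sum>j\<in>I. \<Sum>i\<in>I - {j}. ?f j i + ?f i j)"
    by (simp add: sum.distrib)
  also have "\<dots> = (\<Sum>j\<in>I. \<Sum>i\<in>I - {j}. c * V * D (x j) (x i))"
  proof (intro sum.cong refl)
    fix j i assume ji: "j \<in> I" "i \<in> I - {j}"
    show "?f j i + ?f i j = c * V * D (x j) (x i)"
    proof (cases "x j = x i")
      case True
      then have "V = 0" using V[of j i] ji by auto
      then show ?thesis by simp
    next
      case False
      have "?f i j = - (v (x i) * V * c / (x j - x i))"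
        by (metis minus_diff_eq minus_divide_right)
      then have "?f j i + ?f i j = (v (x j) - v (x i)) * (V * c) / (x j - x i)"
        by (simp add: left_diff_distrib diff_divide_distrib mult.assoc)
      also have "\<dots> = c * V * D (x j) (x i)"
        unfolding dd[symmetric] using False by simp
      finally show ?thesis .
    qed
  qed
  also have "\<dots> = c * V * (\<Sum>j\<in>I. \<Sum>i\<in>I - {j}. D (x j) (x i))"
    by (simp add: sum_distrib_left mult.assoc)
  finally have "(\<Sum>j\<in>I. \<Sum>i\<in>I - {j}. ?f j i) = c * V * (\<Sum>j\<in>I. \<Sum>i\<in>I - {j}. D (x j) (x i)) / 2"
    by linarith
  then show ?thesis unfolding 1 by simp
qed

context jacobi_measure
begin

text \<open>The integrand times the weight is the derivative of t^(a+1) (1-t)^(d+1) exp(-z t) q(t):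
  the extra factor t (1 - t) makes the boundary terms vanish for all exponents above -1. The set
  \<open>S\<close> holds the kinks of q, such as those of |t - c|; continuity of q carries the
  fundamental theorem across them.\<close>

lemma jacobi_integration_by_parts:
  assumes "finite S" and q: "continuous_on UNIV q"
    and q': "\<And>t. 0 < t \<Longrightarrow> t < 1 \<Longrightarrow> t \<notin> S \<Longrightarrow> (q has_real_derivative q' t) (at t)"
    and [measurable]: "q' \<in> borel_measurable borel"
    and B: "\<And>t. 0 < t \<Longrightarrow> t < 1 \<Longrightarrow> \<bar>q' t\<bar> \<le> B"
  shows "(\<integral>t. ((a + 1) * (1 - t) - (d + 1) * t - z * (t * (1 - t))) * q t + t * (1 - t) * q' t \<partial>nu z) = 0"
proof -
  define F where "F = (\<lambda>t. ((a + 1) * (1 - t) - (d + 1) * t - z * (t * (1 - t))) * q t + t * (1 - t) * q' t)"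
  define h where "h = (\<lambda>t. t powr (a + 1) * (1 - t) powr (d + 1) * exp (- z * t) * q t)"
  have [measurable]: "q \<in> borel_measurable borel" using q by (rule borel_measurable_continuous_onI)
  have [measurable]: "F \<in> borel_measurable borel" unfolding F_def by measurable
  have "((\<lambda>t. jacobi_weight a d z t * F t) has_integral (h 1 - h 0)) {0..1}"
  proof (rule fundamental_theorem_of_calculus_interior_strong[OF assms(1)])
    show "continuous_on {0..1} h" unfolding h_def
      by (intro continuous_intros continuous_on_powr' continuous_on_subset[OF q]) (use a d in auto)
    fix t :: real assume t: "t \<in> {0<..<1} - S"
    have p: "((\<lambda>t. t powr (a + 1)) has_real_derivative (a + 1) * t powr a) (at t)"
      using has_real_derivative_powr[of t "a + 1"] t by simp
    have p2: "((\<lambda>t. (1 - t) powr (d + 1)) has_real_derivative - (d + 1) * (1 - t) powr d) (at t)"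
    proof -
      have "((\<lambda>t. 1 - t) has_real_derivative -1) (at t)" by (auto intro!: derivative_eq_intros)
      then have "((\<lambda>t. (1 - t) powr (d + 1)) has_real_derivative (d + 1) * (1 - t) powr (d + 1 - 1) * -1) (at t)"
        by (rule DERIV_chain2[OF has_real_derivative_powr, rotated]) (use t in simp)
      then show ?thesis by (simp add: algebra_simps)
    qed
    have p3: "((\<lambda>t. exp (- z * t)) has_real_derivative exp (- z * t) * (- z)) (at t)"
      by (auto intro!: derivative_eq_intros)
    have pw: "t powr (a + 1) = t * t powr a" "(1 - t) powr (d + 1) = (1 - t) * (1 - t) powr d"
      using t by (simp_all add: powr_add mult.commute)
    have "(h has_real_derivative ((((a + 1) * t powr a * (1 - t) powr (d + 1) + - (d + 1) * (1 - t) powr d * t powr (a + 1)) * exp (- z * t)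
         + exp (- z * t) * (- z) * (t powr (a + 1) * (1 - t) powr (d + 1))) * q t
        + q' t * (t powr (a + 1) * (1 - t) powr (d + 1) * exp (- z * t)))) (at t)"
      unfolding h_def by (rule DERIV_mult[OF DERIV_mult[OF DERIV_mult[OF p p2] p3] q']) (use t in auto)
    then have "(h has_real_derivative jacobi_weight a d z t * F t) (at t)"
      by (rule DERIV_cong) (unfold pw, use t in \<open>simp add: jacobi_weight_def F_def algebra_simps\<close>)
    then show "(h has_vector_derivative jacobi_weight a d z t * F t) (at t)"
      by (simp add: has_real_derivative_iff_has_vector_derivative)
  qed simp
  moreover have "h 1 = 0" "h 0 = 0" using a d by (simp_all add: h_def)
  ultimately have hk: "((\<lambda>t. jacobi_weight a d z t * F t) has_integral 0) {0..1}" by simp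
  have "compact (q ` {0..1})" by (intro compact_continuous_image continuous_on_subset[OF q]) auto
  then obtain C where C: "\<And>t. 0 \<le> t \<Longrightarrow> t \<le> 1 \<Longrightarrow> \<bar>q t\<bar> \<le> C"
    using compact_imp_bounded bounded_iff by (metis atLeastAtMost_iff imageI real_norm_def)
  have FB: "\<bar>F t\<bar> \<le> (\<bar>a + 1\<bar> + \<bar>d + 1\<bar> + \<bar>z\<bar>) * C + B" if t: "0 < t" "t < 1" for t
  proof -
    have x: "\<bar>(a + 1) * (1 - t)\<bar> \<le> \<bar>a + 1\<bar> * 1" "\<bar>(d + 1) * t\<bar> \<le> \<bar>d + 1\<bar> * 1" "\<bar>z * (t * (1 - t))\<bar> \<le> \<bar>z\<bar> * (1 * 1)"
      unfolding abs_mult using t by (intro mult_left_mono mult_mono; simp)+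
    have "\<bar>(a + 1) * (1 - t) - (d + 1) * t - z * (t * (1 - t))\<bar> \<le> \<bar>a + 1\<bar> + \<bar>d + 1\<bar> + \<bar>z\<bar>"
    proof -
      have "\<bar>u - v - w\<bar> \<le> A + B + C" if "\<bar>u\<bar> \<le> A" "\<bar>v\<bar> \<le> B" "\<bar>w\<bar> \<le> C" for u v w A B C :: real
        using that by linarith
      from this[OF x] show ?thesis by simp
    qed
    then have "\<bar>((a + 1) * (1 - t) - (d + 1) * t - z * (t * (1 - t))) * q t\<bar> \<le> (\<bar>a + 1\<bar> + \<bar>d + 1\<bar> + \<bar>z\<bar>) * C"
      unfolding abs_mult by (intro mult_mono) (use C[of t] t in auto)
    moreover have "\<bar>t * (1 - t) * q' t\<bar> \<le> 1 * B"
      unfolding abs_mult using t B[of t] by (intro mult_mono) (auto intro: mult_le_one)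
    ultimately show ?thesis unfolding F_def by linarith
  qed
  interpret N: finite_measure "nu z" by (rule finite_measure_nu)
  have AE1: "AE t in nu z. 0 < t \<and> t < 1"
    unfolding nu_def by (subst AE_density) (auto simp: jacobi_weight_def indicator_def)
  have "AE t in nu z. norm (F t) \<le> (\<bar>a + 1\<bar> + \<bar>d + 1\<bar> + \<bar>z\<bar>) * C + B"
    using AE1 by eventually_elim (use FB in auto)
  then have "integrable (nu z) F" by (rule N.integrable_const_bound) measurable
  then have int: "integrable lborel (\<lambda>t. jacobi_weight a d z t * F t)"
    unfolding nu_def by (subst (asm) integrable_density) auto
  have "((\<lambda>t. jacobi_weight a d z t * F t) has_integral (\<integral>t. jacobi_weight a d z t * F t \<partial>lborel)) UNIV"
    by (rule has_integral_integral_lborel[OF int])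
  moreover have "((\<lambda>t. jacobi_weight a d z t * F t) has_integral 0) UNIV"
    by (rule has_integral_on_superset[OF hk]) (auto simp: jacobi_weight_def)
  ultimately have "(\<integral>t. jacobi_weight a d z t * F t \<partial>lborel) = 0" by (rule has_integral_unique)
  moreover have "(\<integral>t. F t \<partial>nu z) = (\<integral>t. jacobi_weight a d z t * F t \<partial>lborel)"
    unfolding nu_def by (subst integral_density) auto
  ultimately show ?thesis unfolding F_def by simp
qed

text \<open>For almost every position of the other points the one-variable formula applies to the
  coordinate j, with their coordinates as exceptional set. Fubini then gives the claim.\<close>

lemma ensemble_integration_by_parts:
  assumes j: "j \<in> {1..n}" and "1 \<le> \<beta>"
    and G: "cube_bounded {1..n} G" "cube_bounded {1..n} G'"
    and deriv: "\<And>x t. ((\<lambda>t. G (x(j := t))) has_real_derivative G' (x(j := t))) (at t)"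
  shows "integrable (PiM {1..n} (\<lambda>_. nu z)) (\<lambda>x. ((a + 1) * (1 - x j) - (d + 1) * x j - z * (x j * (1 - x j))) * (G x * ensemble_weight \<beta> n x)
       + x j * (1 - x j) * (G' x * ensemble_weight \<beta> n x
           + G x * (ensemble_weight \<beta> n x * (\<Sum>i\<in>{1..n} - {j}. real \<beta> / (x j - x i)))))" (is "integrable ?M ?\<Phi>")
    and "(\<integral>x. ((a + 1) * (1 - x j) - (d + 1) * x j - z * (x j * (1 - x j))) * (G x * ensemble_weight \<beta> n x)
       + x j * (1 - x j) * (G' x * ensemble_weight \<beta> n x
           + G x * (ensemble_weight \<beta> n x * (\<Sum>i\<in>{1..n} - {j}. real \<beta> / (x j - x i)))) \<partial>PiM {1..n} (\<lambda>_. nu z)) = 0" (is "_ = 0")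
proof -
  let ?q' = "\<lambda>x. G' x * ensemble_weight \<beta> n x
           + G x * (ensemble_weight \<beta> n x * (\<Sum>i\<in>{1..n} - {j}. real \<beta> / (x j - x i)))"
  let ?J = "{1..n} - {j}"
  have I: "{1..n} = insert j ?J" using j by auto
  have qb: "cube_bounded {1..n} ?q'"
    by (rule cube_bounded_add[OF cube_bounded_mult[OF G(2) cube_bounded_ensemble_weight]
          cube_bounded_mult[OF G(1) cube_bounded_weight_quotient[OF assms(1,2)]]])
  have "cube_bounded {1..n} ?\<Phi>"
    by (rule cube_bounded_add[OF cube_bounded_mult[OF _ cube_bounded_mult[OF G(1) cube_bounded_ensemble_weight]]
          cube_bounded_mult[OF _ qb]]; intro cube_intros j)
  then show int: "integrable ?M ?\<Phi>" by (intro integrable_cube_bounded) auto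
  obtain B where B: "\<And>x. in_cube {1..n} x \<Longrightarrow> \<bar>?q' x\<bar> \<le> B" and qm: "?q' \<in> borel_measurable (PiM {1..n} (\<lambda>_. lborel))"
    using qb unfolding cube_bounded_def by auto
  have "(\<integral>x. ?\<Phi> x \<partial>PiM (insert j ?J) (\<lambda>_. nu z)) = (\<integral>x. (\<integral>t. ?\<Phi> (x(j := t)) \<partial>nu z) \<partial>PiM ?J (\<lambda>_. nu z))"
    by (rule nu.product_integral_insert) (use int I in auto)
  also have "\<dots> = 0"
  proof (rule integral_eq_zero_AE)
    have "AE x in PiM ?J (\<lambda>_. nu z). in_cube ?J x" "AE x in PiM ?J (\<lambda>_. nu z). x \<in> space (PiM ?J (\<lambda>_. nu z))"
      by (rule AE_in_cube) auto
    then show "AE x in PiM ?J (\<lambda>_. nu z). (\<integral>t. ?\<Phi> (x(j := t)) \<partial>nu z) = 0"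
    proof eventually_elim
      case (elim x)
      define q where "q = (\<lambda>t. G (x(j := t)) * ensemble_weight \<beta> n (x(j := t)))"
      have "(\<integral>t. ((a + 1) * (1 - t) - (d + 1) * t - z * (t * (1 - t))) * q t + t * (1 - t) * ?q' (x(j := t)) \<partial>nu z) = 0"
      proof (rule jacobi_integration_by_parts)
        show "finite (x ` ?J)" by simp
        have "continuous_on UNIV (\<lambda>t. G (x(j := t)))"
          using deriv DERIV_isCont continuous_at_imp_continuous_on by blast
        then show "continuous_on UNIV q" unfolding q_def ensemble_weight_upd[OF j]
          by (intro continuous_intros)
        show "(q has_real_derivative ?q' (x(j := t))) (at t)" if "t \<notin> x ` ?J" for t
        proof -
          have "((\<lambda>t. \<Prod>i\<in>?J. \<bar>t - x i\<bar> ^ \<beta>) has_real_derivative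
               (\<Prod>i\<in>?J. \<bar>t - x i\<bar> ^ \<beta>) * (\<Sum>i\<in>?J. real \<beta> / (t - x i))) (at t)"
            by (rule DERIV_prod_abs_power) (use that in auto)
          from DERIV_mult[OF deriv[of x t] DERIV_cmult_right[OF this, of "vandermonde_set ?J x ^ \<beta>"]]
          have "(q has_real_derivative (G' (x(j := t)) * ensemble_weight \<beta> n (x(j := t)) +
              (\<Prod>i\<in>?J. \<bar>t - x i\<bar> ^ \<beta>) * (\<Sum>i\<in>?J. real \<beta> / (t - x i)) * vandermonde_set ?J x ^ \<beta> * G (x(j := t)))) (at t)"
            unfolding q_def ensemble_weight_upd[OF j] .
          moreover have "(\<Sum>i\<in>?J. real \<beta> / ((x(j := t)) j - (x(j := t)) i)) = (\<Sum>i\<in>?J. real \<beta> / (t - x i))"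
            by (rule sum.cong) auto
          ultimately show ?thesis unfolding ensemble_weight_upd[OF j] by (simp add: algebra_simps)
        qed
        show "(\<lambda>t. ?q' (x(j := t))) \<in> borel_measurable borel"
        proof -
          have "x \<in> space (PiM ?J (\<lambda>_. lborel))" using elim by (simp add: space_PiM)
          from measurable_component_update[OF this, of j]
          have "(\<lambda>t. x(j := t)) \<in> measurable lborel (PiM {1..n} (\<lambda>_. lborel))" using I by simp
          from measurable_compose[OF this qm] show ?thesis by simp
        qed
        show "\<bar>?q' (x(j := t))\<bar> \<le> B" if "0 < t" "t < 1" for t
          by (rule B) (use elim that in \<open>auto simp: in_cube_def\<close>)
      qed
      then show ?case by (simp add: q_def)
    qed
  qed
  finally show "(\<integral>x. ?\<Phi> x \<partial>?M) = 0" using I by simp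
qed

end

section \<open>Sums of divided differences and the loop equations\<close>

lemma sum_off_diagonal:
  fixes h :: "nat \<Rightarrow> nat \<Rightarrow> real"
  assumes "finite I"
  shows "(\<Sum>j\<in>I. \<Sum>i\<in>I - {j}. h j i) = (\<Sum>j\<in>I. \<Sum>i\<in>I. h j i) - (\<Sum>j\<in>I. h j j)"
  using assms by (simp add: sum_diff1 flip: sum_subtractf)

lemma sum_off_diagonal_1:
  "(\<Sum>j\<in>{1..n}. \<Sum>i\<in>{1..n} - {j}. 1 - x j - x i) = real n * (real n - 1) - 2 * (real n - 1) * power_sum n 1 x"
proof -
  let ?S = "\<Sum>i\<in>{1..n}. x i"
  have i: "(\<Sum>i\<in>{1..n}. 1 - x j - x i) = real n - real n * x j - ?S" for j
    by (simp only: sum_subtractf) simp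
  have o: "(\<Sum>j\<in>{1..n}. real n - real n * x j - ?S) = real n * real n - real n * ?S - real n * ?S"
    by (simp add: sum_subtractf sum_distrib_left)
  have d: "(\<Sum>j\<in>{1..n}. 1 - x j - x j) = real n - ?S - ?S"
    by (simp only: sum_subtractf) simp
  show ?thesis
    by (simp only: power_sum_def power_one_right sum_off_diagonal[OF finite_atLeastAtMost] i o d)
      (simp add: algebra_simps)
qed

lemma sum_off_diagonal_2:
  "(\<Sum>j\<in>{1..n}. \<Sum>i\<in>{1..n} - {j}. x j + x i - (x j)\<^sup>2 - x j * x i - (x i)\<^sup>2)
     = 2 * (real n - 1) * power_sum n 1 x - 2 * (real n - 1) * power_sum n 2 x
       - ((power_sum n 1 x)\<^sup>2 - power_sum n 2 x)"
proof -
  let ?S = "\<Sum>i\<in>{1..n}. x i" and ?Q = "\<Sum>i\<in>{1..n}. (x i)\<^sup>2"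
  have i: "(\<Sum>i\<in>{1..n}. x j + x i - (x j)\<^sup>2 - x j * x i - (x i)\<^sup>2)
      = real n * x j + ?S - real n * (x j)\<^sup>2 - x j * ?S - ?Q" for j
    by (simp add: sum_subtractf sum.distrib sum_distrib_left)
  have o: "(\<Sum>j\<in>{1..n}. real n * x j + ?S - real n * (x j)\<^sup>2 - x j * ?S - ?Q)
      = real n * ?S + real n * ?S - real n * ?Q - ?S * ?S - real n * ?Q"
    by (simp add: sum_subtractf sum.distrib flip: sum_distrib_left sum_distrib_right)
  have d: "(\<Sum>j\<in>{1..n}. x j + x j - (x j)\<^sup>2 - x j * x j - (x j)\<^sup>2) = ?S + ?S - ?Q - ?Q - ?Q"
    by (simp only: sum_subtractf sum.distrib power2_eq_square)
  show ?thesis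
    by (simp only: power_sum_def power_one_right sum_off_diagonal[OF finite_atLeastAtMost] i o d)
      (simp add: algebra_simps power2_eq_square)
qed

lemma sum_collect_0:
  fixes A B C W :: "nat \<Rightarrow> real"
  shows "(\<Sum>j\<in>I. A j * (g * v) + B j * (C j * v + g * W j))
    = (\<Sum>j\<in>I. A j) * (g * v) + (\<Sum>j\<in>I. B j * C j) * v + g * (\<Sum>j\<in>I. B j * W j)"
  unfolding sum_distrib_left sum_distrib_right sum.distrib[symmetric]
  by (rule sum.cong) (auto simp: algebra_simps)

lemma sum_collect_1:
  fixes A B X W :: "nat \<Rightarrow> real"
  shows "(\<Sum>j\<in>I. A j * (X j * v) + B j * (1 * v + X j * W j))
    = (\<Sum>j\<in>I. A j * X j + B j) * v + (\<Sum>j\<in>I. B j * X j * W j)"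
  unfolding sum_distrib_right sum.distrib[symmetric]
  by (rule sum.cong) (auto simp: algebra_simps)

lemma ensemble_weight_tie:
  assumes "i \<in> {1..n}" "j \<in> {1..n}" "i \<noteq> j" "x i = x j" "1 \<le> \<beta>"
  shows "ensemble_weight \<beta> n x = 0"
  unfolding ensemble_weight_split[OF assms(1)] using assms by (auto intro!: bexI[of _ j])

context jacobi_measure
begin

text \<open>In the first loop equation at z = 0 with test function 1, this is the constant term and
  \<open>loop_c1\<close> the coefficient of -p1; the mean conductance is therefore their
  quotient.\<close>

definition loop_c0 :: "nat \<Rightarrow> nat \<Rightarrow> real" where
  "loop_c0 \<beta> n = real n * (a + 1 + real \<beta> * (real n - 1) / 2)"

definition loop_c1 :: "nat \<Rightarrow> nat \<Rightarrow> real" where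
  "loop_c1 \<beta> n = a + d + 2 + real \<beta> * (real n - 1)"

text \<open>The vector field x (1 - x) with a test function G. The divided difference of t (1 - t)
  is 1 - s - t, and its double sum supplies the \<beta>-parts of \<open>loop_c0\<close> and
  \<open>loop_c1\<close>.\<close>

lemma loop_equation_0:
  assumes b: "1 \<le> \<beta>"
    and G: "cube_bounded {1..n} G" "\<And>j. j \<in> {1..n} \<Longrightarrow> cube_bounded {1..n} (G' j)"
    and deriv: "\<And>j x t. j \<in> {1..n} \<Longrightarrow> ((\<lambda>t. G (x(j := t))) has_real_derivative G' j (x(j := t))) (at t)"
  shows "ensemble \<beta> n z (\<lambda>x. (loop_c0 \<beta> n - (z + loop_c1 \<beta> n) * power_sum n 1 x + z * power_sum n 2 x) * G x
      + (\<Sum>j\<in>{1..n}. x j * (1 - x j) * G' j x)) = 0"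
proof -
  let ?V = "ensemble_weight \<beta> n"
  let ?\<Phi> = "\<lambda>j x. ((a + 1) * (1 - x j) - (d + 1) * x j - z * (x j * (1 - x j))) * (G x * ?V x)
       + x j * (1 - x j) * (G' j x * ?V x + G x * (?V x * (\<Sum>i\<in>{1..n} - {j}. real \<beta> / (x j - x i))))"
  note ibp = ensemble_integration_by_parts[OF _ b G(1) G(2) deriv]
  have "(\<integral>x. (\<Sum>j\<in>{1..n}. ?\<Phi> j x) \<partial>PiM {1..n} (\<lambda>_. nu z)) = (\<Sum>j\<in>{1..n}. \<integral>x. ?\<Phi> j x \<partial>PiM {1..n} (\<lambda>_. nu z))"
    by (rule Bochner_Integration.integral_sum) (rule ibp(1))
  also have "\<dots> = 0" by (rule sum.neutral) (use ibp(2) in blast)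
  finally have 0: "(\<integral>x. (\<Sum>j\<in>{1..n}. ?\<Phi> j x) \<partial>PiM {1..n} (\<lambda>_. nu z)) = 0" .
  have "(\<Sum>j\<in>{1..n}. ?\<Phi> j x) = ((loop_c0 \<beta> n - (z + loop_c1 \<beta> n) * power_sum n 1 x + z * power_sum n 2 x) * G x
      + (\<Sum>j\<in>{1..n}. x j * (1 - x j) * G' j x)) * ?V x" for x
  proof -
    have sym: "(\<Sum>j\<in>{1..n}. x j * (1 - x j) * (?V x * (\<Sum>i\<in>{1..n} - {j}. real \<beta> / (x j - x i))))
        = real \<beta> / 2 * ?V x * (\<Sum>j\<in>{1..n}. \<Sum>i\<in>{1..n} - {j}. 1 - x j - x i)"
      by (rule symmetrized_sum[where v = "\<lambda>t. t * (1 - t)" and D = "\<lambda>s t. 1 - s - t"])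
        (use ensemble_weight_tie b in \<open>auto simp: algebra_simps\<close>)
    have 1: "(\<Sum>j\<in>{1..n}. (a + 1) * (1 - x j) - (d + 1) * x j - z * (x j * (1 - x j)))
        = (a + 1) * (real n - power_sum n 1 x) - (d + 1) * power_sum n 1 x - z * (power_sum n 1 x - power_sum n 2 x)"
      by (simp add: power_sum_def sum_subtractf sum.distrib sum_distrib_left power2_eq_square right_diff_distrib)
    have "(\<Sum>j\<in>{1..n}. ?\<Phi> j x)
      = (\<Sum>j\<in>{1..n}. (a + 1) * (1 - x j) - (d + 1) * x j - z * (x j * (1 - x j))) * (G x * ?V x)
        + (\<Sum>j\<in>{1..n}. x j * (1 - x j) * G' j x) * ?V x
        + G x * (\<Sum>j\<in>{1..n}. x j * (1 - x j) * (?V x * (\<Sum>i\<in>{1..n} - {j}. real \<beta> / (x j - x i))))"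
      by (rule sum_collect_0)
    then show ?thesis unfolding 1 sym sum_off_diagonal_1
      by (simp add: loop_c0_def loop_c1_def field_simps)
  qed
  then show ?thesis using 0 unfolding ensemble_def by simp
qed

text \<open>The vector field x^2 (1 - x): the test function x j supplies the additional factor. The
  divided difference of t^2 (1 - t) is s + t - s^2 - s t - t^2, whose mixed term is the source of
  the square of p1.\<close>

lemma loop_equation_1:
  assumes b: "1 \<le> \<beta>"
  shows "ensemble \<beta> n z (\<lambda>x. (a + 2 + real \<beta> * (real n - 1)) * power_sum n 1 x
      - (loop_c1 \<beta> n + 1 - real \<beta> / 2 + z) * power_sum n 2 x + z * power_sum n 3 x
      - real \<beta> / 2 * (power_sum n 1 x)\<^sup>2) = 0"
proof -
  let ?V = "ensemble_weight \<beta> n"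
  let ?\<Phi> = "\<lambda>j x. ((a + 1) * (1 - x j) - (d + 1) * x j - z * (x j * (1 - x j))) * (x j * ?V x)
       + x j * (1 - x j) * (1 * ?V x + x j * (?V x * (\<Sum>i\<in>{1..n} - {j}. real \<beta> / (x j - x i))))"
  have ibp: "integrable (PiM {1..n} (\<lambda>_. nu z)) (?\<Phi> j) \<and> (\<integral>x. ?\<Phi> j x \<partial>PiM {1..n} (\<lambda>_. nu z)) = 0"
    if "j \<in> {1..n}" for j
  proof -
    have c: "cube_bounded {1..n} (\<lambda>x. x j)" using that by (rule cube_bounded_component)
    have d: "((\<lambda>t. (x(j := t)) j) has_real_derivative 1) (at t)" for x :: "nat \<Rightarrow> real" and t
      by simp
    show ?thesis
      using ensemble_integration_by_parts[OF that b c cube_bounded_const d] by blast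
  qed
  have "(\<integral>x. (\<Sum>j\<in>{1..n}. ?\<Phi> j x) \<partial>PiM {1..n} (\<lambda>_. nu z)) = (\<Sum>j\<in>{1..n}. \<integral>x. ?\<Phi> j x \<partial>PiM {1..n} (\<lambda>_. nu z))"
    by (rule Bochner_Integration.integral_sum) (use ibp in blast)
  also have "\<dots> = 0" by (rule sum.neutral) (use ibp in blast)
  finally have 0: "(\<integral>x. (\<Sum>j\<in>{1..n}. ?\<Phi> j x) \<partial>PiM {1..n} (\<lambda>_. nu z)) = 0" .
  have "(\<Sum>j\<in>{1..n}. ?\<Phi> j x) = ((a + 2 + real \<beta> * (real n - 1)) * power_sum n 1 x
      - (loop_c1 \<beta> n + 1 - real \<beta> / 2 + z) * power_sum n 2 x + z * power_sum n 3 x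
      - real \<beta> / 2 * (power_sum n 1 x)\<^sup>2) * ?V x" for x
  proof -
    have sym: "(\<Sum>j\<in>{1..n}. x j * (1 - x j) * x j * (?V x * (\<Sum>i\<in>{1..n} - {j}. real \<beta> / (x j - x i))))
        = real \<beta> / 2 * ?V x * (\<Sum>j\<in>{1..n}. \<Sum>i\<in>{1..n} - {j}. x j + x i - (x j)\<^sup>2 - x j * x i - (x i)\<^sup>2)"
      by (rule symmetrized_sum[where v = "\<lambda>t. t * (1 - t) * t" and D = "\<lambda>s t. s + t - s\<^sup>2 - s * t - t\<^sup>2"])
        (use ensemble_weight_tie b in \<open>auto simp: algebra_simps power2_eq_square\<close>)
    have 1: "(\<Sum>j\<in>{1..n}. ((a + 1) * (1 - x j) - (d + 1) * x j - z * (x j * (1 - x j))) * x j + x j * (1 - x j))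
        = (a + 1) * (power_sum n 1 x - power_sum n 2 x) - (d + 1) * power_sum n 2 x
          - z * (power_sum n 2 x - power_sum n 3 x) + power_sum n 1 x - power_sum n 2 x"
      unfolding power_sum_def sum_subtractf[symmetric] sum_distrib_left sum.distrib[symmetric]
      by (rule sum.cong) (auto simp: power2_eq_square power3_eq_cube algebra_simps)
    have "(\<Sum>j\<in>{1..n}. ?\<Phi> j x)
      = (\<Sum>j\<in>{1..n}. ((a + 1) * (1 - x j) - (d + 1) * x j - z * (x j * (1 - x j))) * x j + x j * (1 - x j)) * ?V x
        + (\<Sum>j\<in>{1..n}. x j * (1 - x j) * x j * (?V x * (\<Sum>i\<in>{1..n} - {j}. real \<beta> / (x j - x i))))"
      by (rule sum_collect_1)
    then show ?thesis unfolding 1 sym sum_off_diagonal_2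
      by (simp add: loop_c1_def field_simps)
  qed
  then show ?thesis using 0 unfolding ensemble_def by simp
qed

text \<open>Loop equations solved for the terms with z: the first field with test functions 1 and
  p2, then the second field. The factor z stays on the left, since z = 0 is the point of
  expansion.\<close>

lemma virasoro_constraints:
  fixes \<beta> n :: nat and z :: real
  defines "E \<equiv> ensemble \<beta> n z" and "p \<equiv> power_sum n" and "c0 \<equiv> loop_c0 \<beta> n" and "c1 \<equiv> loop_c1 \<beta> n"
  assumes b: "1 \<le> \<beta>"
  shows "z * E (p 2) = (z + c1) * E (p 1) - c0 * E (\<lambda>x. 1)"
    and "z * E (\<lambda>x. p 2 x ^ 2) = (z + c1) * E (\<lambda>x. p 1 x * p 2 x) - (c0 + 2) * E (p 2) + 2 * E (p 3)"
    and "z * E (p 3) = (z + c1 + 1 - real \<beta> / 2) * E (p 2) - (a + 2 + real \<beta> * (real n - 1)) * E (p 1)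
       + real \<beta> / 2 * E (\<lambda>x. p 1 x ^ 2)"
proof -
  have cb: "cube_bounded {1..n} (p k)" for k unfolding p_def by (rule cube_bounded_power_sum)
  note lin = ensemble_linear[where \<beta> = \<beta> and n = n and z = z, folded E_def]
    ensemble_cmult[where \<beta> = \<beta> and n = n and z = z, folded E_def]
  have "E (\<lambda>x. c0 * 1 - (z + c1) * p 1 x + z * p 2 x) = 0"
    using loop_equation_0[OF b, of n "\<lambda>x. 1" "\<lambda>j x. 0" z]
    by (simp add: cube_intros E_def p_def c0_def c1_def)
  moreover have "E (\<lambda>x. c0 * 1 - (z + c1) * p 1 x + z * p 2 x) = E (\<lambda>x. c0 * 1) - E (\<lambda>x. (z + c1) * p 1 x) + E (\<lambda>x. z * p 2 x)"
    by (subst lin(1), (intro cube_intros cb)+, subst lin(2), (intro cube_intros cb)+, rule refl)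
  ultimately show "z * E (p 2) = (z + c1) * E (p 1) - c0 * E (\<lambda>x. 1)"
    unfolding lin(3) by simp
  have "E (\<lambda>x. (a + 2 + real \<beta> * (real n - 1)) * p 1 x - (c1 + 1 - real \<beta> / 2 + z) * p 2 x + z * p 3 x
      - real \<beta> / 2 * (p 1 x)\<^sup>2) = 0"
    using loop_equation_1[OF b, of n z] by (simp add: E_def p_def c1_def)
  moreover have "E (\<lambda>x. (a + 2 + real \<beta> * (real n - 1)) * p 1 x - (c1 + 1 - real \<beta> / 2 + z) * p 2 x + z * p 3 x
      - real \<beta> / 2 * (p 1 x)\<^sup>2)
     = E (\<lambda>x. (a + 2 + real \<beta> * (real n - 1)) * p 1 x) - E (\<lambda>x. (c1 + 1 - real \<beta> / 2 + z) * p 2 x) + E (\<lambda>x. z * p 3 x)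
      - E (\<lambda>x. real \<beta> / 2 * (p 1 x)\<^sup>2)"
    by (subst lin(2), (intro cube_intros cb)+, subst lin(1), (intro cube_intros cb)+, subst lin(2), (intro cube_intros cb)+, rule refl)
  ultimately show "z * E (p 3) = (z + c1 + 1 - real \<beta> / 2) * E (p 2) - (a + 2 + real \<beta> * (real n - 1)) * E (p 1)
       + real \<beta> / 2 * E (\<lambda>x. p 1 x ^ 2)"
    unfolding lin(3) by (simp add: algebra_simps)
  have upd: "p k (x(j := t)) = t ^ k + (\<Sum>i\<in>{1..n} - {j}. x i ^ k)" if "j \<in> {1..n}" for k x j t
    unfolding p_def power_sum_def using that by (subst sum.remove[of _ j]) auto
  have "E (\<lambda>x. (c0 - (z + c1) * p 1 x + z * p 2 x) * p 2 x + (\<Sum>j\<in>{1..n}. x j * (1 - x j) * (2 * x j))) = 0"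
    unfolding E_def c0_def c1_def p_def
  proof (rule loop_equation_0[OF b], fold p_def)
    show "((\<lambda>t. p 2 (x(j := t))) has_real_derivative 2 * (x(j := t)) j) (at t)" if "j \<in> {1..n}" for j x t
      unfolding upd[OF that] by (auto intro!: derivative_eq_intros)
    show "cube_bounded {1..n} (p 2)" by (rule cb)
    show "cube_bounded {1..n} (\<lambda>x. 2 * x j)" if "j \<in> {1..n}" for j
      using that by (intro cube_intros)
  qed
  moreover have "(\<Sum>j\<in>{1..n}. x j * (1 - x j) * (2 * x j)) = 2 * p 2 x - 2 * p 3 x" for x
    unfolding p_def power_sum_def sum_distrib_left sum_subtractf[symmetric]
    by (rule sum.cong) (auto simp: power2_eq_square power3_eq_cube algebra_simps)
  ultimately have "E (\<lambda>x. (c0 - (z + c1) * p 1 x + z * p 2 x) * p 2 x + (2 * p 2 x - 2 * p 3 x)) = 0"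
    by simp
  then have "E (\<lambda>x. (c0 + 2) * p 2 x - (z + c1) * (p 1 x * p 2 x) + z * p 2 x ^ 2 - 2 * p 3 x) = 0"
    by (simp add: algebra_simps power2_eq_square)
  moreover have "E (\<lambda>x. (c0 + 2) * p 2 x - (z + c1) * (p 1 x * p 2 x) + z * p 2 x ^ 2 - 2 * p 3 x)
     = E (\<lambda>x. (c0 + 2) * p 2 x) - E (\<lambda>x. (z + c1) * (p 1 x * p 2 x)) + E (\<lambda>x. z * p 2 x ^ 2) - E (\<lambda>x. 2 * p 3 x)"
    by (subst lin(2), (intro cube_intros cb)+, subst lin(1), (intro cube_intros cb)+, subst lin(2), (intro cube_intros cb)+, rule refl)
  ultimately show "z * E (\<lambda>x. p 2 x ^ 2) = (z + c1) * E (\<lambda>x. p 1 x * p 2 x) - (c0 + 2) * E (p 2) + 2 * E (p 3)"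
    unfolding lin(3) by simp
qed

end

subsection \<open>Power series\<close>

lemma fps_nth_real_expansion:
  fixes f :: "real \<Rightarrow> real"
  shows "f has_fps_expansion F \<Longrightarrow> fps_nth F n = (deriv ^^ n) f 0 / fact n"
proof (induction n arbitrary: f F)
  case 0
  then show ?case
    by (auto simp: has_fps_expansion_def eval_fps_at_0 dest: eventually_nhds_x_imp_x)
next
  case (Suc n)
  have "fps_nth (fps_deriv F) n = (deriv ^^ n) (deriv f) 0 / fact n"
    by (rule Suc.IH) (rule has_fps_expansion_deriv[OF Suc.prems])
  then have "real (Suc n) * fps_nth F (Suc n) = (deriv ^^ Suc n) f 0 / fact n"
    by (simp add: funpow_Suc_right del: funpow.simps)
  then have "fps_nth F (Suc n) = (deriv ^^ Suc n) f 0 / fact n / real (Suc n)"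
    by (metis nonzero_mult_div_cancel_left nat.distinct(1) of_nat_eq_0_iff)
  then show ?case by (simp only: divide_divide_eq_left fact_Suc mult.commute)
qed

lemma has_fps_expansion_unique_real:
  fixes f :: "real \<Rightarrow> real"
  shows "f has_fps_expansion F \<Longrightarrow> f has_fps_expansion G \<Longrightarrow> F = G"
  by (auto simp: fps_eq_iff fps_nth_real_expansion)

lemma funpow_deriv_cong:
  fixes f g :: "real \<Rightarrow> real"
  assumes "eventually (\<lambda>x. f x = g x) (nhds 0)"
  shows "(deriv ^^ n) f 0 = (deriv ^^ n) g 0"
proof -
  have "eventually (\<lambda>x. (deriv ^^ n) f x = (deriv ^^ n) g x) (nhds 0)"
    using assms
  proof (induction n arbitrary: f g)
    case (Suc n)
    have "eventually (\<lambda>x. deriv f x = deriv g x) (nhds 0)"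
      using eventually_eventually[THEN iffD2, OF Suc.prems]
      by eventually_elim (rule deriv_cong_ev, auto)
    from Suc.IH[OF this] show ?case by (simp add: funpow_Suc_right del: funpow.simps)
  qed simp
  then show ?thesis by (rule eventually_nhds_x_imp_x)
qed

text \<open>Near 0, where M stays positive, the derivative of ln M is M' / M. A quotient of series
  suffices from there on, and no series is ever composed with the logarithm.\<close>

lemma deriv_ln_coeff:
  fixes M :: "real \<Rightarrow> real"
  assumes M: "M has_fps_expansion F" and "M 0 > 0"
  shows "(deriv ^^ Suc k) (\<lambda>z. ln (M z)) 0 = fact k * fps_nth (fps_deriv F / F) k"
proof -
  have F0: "fps_nth F 0 = M 0" using fps_nth_real_expansion[OF M, of 0] by simp
  have "eventually (\<lambda>z. z \<in> eball 0 (fps_conv_radius F)) (nhds 0)"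
    using M by (intro eventually_nhds_in_open) (auto simp: has_fps_expansion_def zero_ereal_def)
  moreover have "eventually (\<lambda>z. eventually (\<lambda>w. eval_fps F w = M w) (nhds z)) (nhds 0)"
    using M by (auto simp: has_fps_expansion_def eventually_eventually)
  moreover have "eventually (\<lambda>z. M z > 0) (nhds 0)"
  proof -
    have "isCont M 0" using has_fps_expansion_imp_continuous[OF M, of UNIV] by simp
    then have "(M \<longlongrightarrow> M 0) (nhds 0)"
      by (metis isCont_def tendsto_at_iff_tendsto_nhds)
    then show ?thesis using assms(2) by (rule order_tendstoD)
  qed
  ultimately have "eventually (\<lambda>z. deriv (\<lambda>z. ln (M z)) z = deriv M z / M z) (nhds 0)"
  proof eventually_elim
    case (elim z)
    have "(eval_fps F has_field_derivative eval_fps (fps_deriv F) z) (at z)"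
      by (rule has_field_derivative_eval_fps) (use elim in simp)
    then have "(M has_real_derivative eval_fps (fps_deriv F) z) (at z)"
      by (subst (asm) DERIV_cong_ev[OF refl _ refl]) (use elim in auto)
    then have "(M has_real_derivative deriv M z) (at z)" by (simp add: DERIV_imp_deriv)
    from DERIV_ln_divide[OF elim(3)] this
    have "((\<lambda>z. ln (M z)) has_real_derivative 1 / M z * deriv M z) (at z)" by (rule DERIV_chain2)
    then show ?case by (simp add: DERIV_imp_deriv)
  qed
  then have "(deriv ^^ k) (deriv (\<lambda>z. ln (M z))) 0 = (deriv ^^ k) (\<lambda>z. deriv M z / M z) 0"
    by (rule funpow_deriv_cong)
  also have "(\<lambda>z. deriv M z / M z) has_fps_expansion (fps_deriv F / F)"
    by (intro has_fps_expansion_divide' has_fps_expansion_deriv M) (use F0 assms(2) in simp)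
  from fps_nth_real_expansion[OF this, of k]
  have "(deriv ^^ k) (\<lambda>z. deriv M z / M z) 0 = fact k * fps_nth (fps_deriv F / F) k" by simp
  finally show ?thesis by (simp add: funpow_Suc_right del: funpow.simps)
qed

text \<open>Y is the logarithmic derivative of F, and e2, e3, e22 are the normalized averages of p2,
  p3, p2^2. Hirota's form F F'''' - 4 F' F''' + 3 F''^2 equals F^2 (Y''' + 6 Y'^2), and the terms
  with e3 collapse to the derivative of e3. The constraints provide only X e2 = U and X^2 e3 = V, so
  the identity L = R is multiplied by X^3 before they are inserted.\<close>

lemma hirota_reduction:
  fixes F Y e2 e3 e22 :: "real fps" and h c0 c1 a' b :: real
  defines "X \<equiv> fps_X :: real fps" and "C \<equiv> fps_const :: real \<Rightarrow> real fps"
  assumes F: "F \<noteq> 0" and Y: "fps_deriv F = Y * F"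
    and r1: "X * e2 = - (X + C c1) * Y - C c0"
    and r2: "X * e22 = - (X + C c1) * (fps_deriv e2 + Y * e2) - (C c0 + 2) * e2 + 2 * e3"
    and r3: "X * e3 = (X + C d) * e2 + C a' * Y + C b * (fps_deriv Y + Y ^ 2)"
    and kp: "(C h ^ 4 * fps_deriv (fps_deriv (fps_deriv (fps_deriv F))) + 3 * C h ^ 2 * (e22 * F)
        + 4 * C h ^ 2 * ((fps_deriv e3 + Y * e3) * F)) * F
      + 4 * C h * fps_deriv F * (- (C h ^ 3) * fps_deriv (fps_deriv (fps_deriv F)) - C h * (e3 * F))
      + 3 * (C h ^ 2 * fps_deriv (fps_deriv F) + C h * (e2 * F)) * (C h ^ 2 * fps_deriv (fps_deriv F) - C h * (e2 * F))
     = C h ^ 2 * (R * F ^ 2)"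
    and "h \<noteq> 0"
  defines "U \<equiv> - (X + C c1) * Y - C c0"
  defines "V \<equiv> (X + C d) * U + C a' * X * Y + C b * X * (fps_deriv Y + Y ^ 2)"
  shows "C h ^ 2 * X ^ 3 * (fps_deriv (fps_deriv (fps_deriv Y)) + 6 * (fps_deriv Y) ^ 2)
      + 3 * (- (X + C c1) * (X * fps_deriv U - U) - 2 * X * U + 2 * V) + 4 * (X * fps_deriv V - 2 * V)
     = X ^ 3 * R"
proof -
  let ?D = "fps_deriv :: real fps \<Rightarrow> real fps"
  have F2: "?D (?D F) = (?D Y + Y ^ 2) * F"
    by (simp add: Y power2_eq_square algebra_simps)
  have F3: "?D (?D (?D F)) = (?D (?D Y) + 3 * Y * ?D Y + Y ^ 3) * F"
    unfolding F2 by (simp add: Y power2_eq_square power3_eq_cube algebra_simps)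
  have F4: "?D (?D (?D (?D F))) = (?D (?D (?D Y)) + 4 * Y * ?D (?D Y) + 3 * (?D Y) ^ 2 + 6 * Y ^ 2 * ?D Y + Y ^ 4) * F"
    unfolding F3 by (simp add: Y power2_eq_square power3_eq_cube power4_eq_xxxx algebra_simps)
  have U: "X * e2 = U" using r1 by (simp add: U_def)
  have V: "X ^ 2 * e3 = V"
  proof -
    have "X ^ 2 * e3 = X * (X * e3)" by (simp add: power2_eq_square)
    also have "\<dots> = (X + C d) * (X * e2) + C a' * X * Y + C b * X * (fps_deriv Y + Y ^ 2)"
      unfolding r3 by (simp add: algebra_simps)
    finally show ?thesis unfolding U V_def .
  qed
  have XD: "?D X = 1" by (simp add: X_def)
  have DU: "X * ?D U - U = X ^ 2 * ?D e2"
    unfolding U[symmetric] by (simp add: XD power2_eq_square algebra_simps)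
  have DV: "X * ?D V - 2 * V = X ^ 3 * ?D e3"
    unfolding V[symmetric] by (simp add: XD power2_eq_square power3_eq_cube algebra_simps)
  have r22: "X * (e22 - e2 ^ 2) = - (X + C c1) * ?D e2 - 2 * e2 + 2 * e3"
  proof -
    have "X * (e22 - e2 ^ 2) = X * e22 - (X * e2) * e2" by (simp add: power2_eq_square algebra_simps)
    then show ?thesis unfolding r2 r1 by (simp add: algebra_simps)
  qed
  define L where "L = C h ^ 2 * (?D (?D (?D Y)) + 6 * (?D Y) ^ 2) + 3 * (e22 - e2 ^ 2) + 4 * ?D e3"
  have "C h ^ 2 * F ^ 2 * L = C h ^ 2 * (R * F ^ 2)"
    unfolding kp[symmetric] unfolding F4 unfolding F3 unfolding F2 unfolding Y L_def
    by (simp add: power2_eq_square power3_eq_cube power4_eq_xxxx algebra_simps)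
  moreover have "C h ^ 2 * F ^ 2 \<noteq> 0" using F \<open>h \<noteq> 0\<close> by (simp add: C_def)
  ultimately have "L = R" by (simp add: mult.assoc mult.left_commute)
  then have "X ^ 3 * L = X ^ 3 * R" by simp
  moreover have "X ^ 3 * L = C h ^ 2 * X ^ 3 * (?D (?D (?D Y)) + 6 * (?D Y) ^ 2)
      + 3 * (X ^ 2 * (X * (e22 - e2 ^ 2))) + 4 * (X ^ 3 * ?D e3)"
    unfolding L_def by (simp add: power2_eq_square power3_eq_cube algebra_simps)
  moreover have "X ^ 2 * (X * (e22 - e2 ^ 2)) = - (X + C c1) * (X ^ 2 * ?D e2) - 2 * X * (X * e2) + 2 * (X ^ 2 * e3)"
    unfolding r22 by (simp add: power2_eq_square algebra_simps)
  ultimately show ?thesis unfolding DU DV U V by simp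
qed

text \<open>The coefficient B is not symmetric under the exchange of i and j = l - 1 - i, but the
  sum sees only a symmetrization: up to the factor l - i it is 6 i j + (2 l - 1) chi. The first part
  matches Y'^2, the second Y^2, and eta chi = \<beta> treats the three values of \<beta> at
  once.\<close>

lemma cumulant_convolution:
  fixes \<kappa> :: "nat \<Rightarrow> real" and y :: "nat \<Rightarrow> real"
  assumes \<kappa>: "\<And>k. \<kappa> (Suc k) = (-1) ^ Suc k * fact k * y k"
    and \<beta>: "\<beta> \<in> {1, 2, 4}" and l: "1 \<le> l"
  shows "eta \<beta> * (\<Sum>i\<in>{0..l-1}. real (l choose i) * \<kappa> (i + 1) * \<kappa> (l - i) * B_coeff \<beta> i l)
    = (-1) ^ (l + 1) * fact l * (6 * eta \<beta> * (\<Sum>i\<in>{0..l-1}. real i * y i * (real (l - 1 - i) * y (l - 1 - i)))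
        + (2 * real l - 1) * real \<beta> * (\<Sum>i\<in>{0..l-1}. y i * y (l - 1 - i)))"
proof -
  define Q where "Q = (\<lambda>i j :: nat. (2 - chi \<beta>) * ((real j + 1) * (6 * real i - 2) + 3)
     + (chi \<beta> - 1) * (real j + 1) * (6 * real i + 2))"
  define g where "g = (\<lambda>i. Q i (l - 1 - i) * (y i * y (l - 1 - i)))"
  define s where "s = ((-1) ^ (l + 1) * fact l :: real)"
  have tm: "real (l choose i) * \<kappa> (i + 1) * \<kappa> (l - i) * B_coeff \<beta> i l = s * g i" if "i \<in> {0..l-1}" for i
  proof -
    define j where "j = l - 1 - i"
    have il: "l = Suc (i + j)" "i < l" "l - i = Suc j" "i \<le> l" using that l by (auto simp: j_def)
    have B: "B_coeff \<beta> i l = (real j + 1) * Q i j"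
      unfolding B_coeff_def Q_def using il by (simp add: power2_eq_square algebra_simps)
    have ch: "real (l choose i) = fact l / (fact i * ((real j + 1) * fact j))"
      using binomial_fact[OF il(4), where 'a = real] unfolding il(3) by (simp add: add.commute)
    have sg: "(-1::real) ^ Suc i * (-1) ^ Suc j = (-1) ^ (l + 1)"
      unfolding il(1) by (simp add: power_add)
    have "real (l choose i) * \<kappa> (i + 1) * \<kappa> (l - i) * B_coeff \<beta> i l
        = fact l / (fact i * ((real j + 1) * fact j)) * ((-1) ^ Suc i * fact i * y i)
          * ((-1) ^ Suc j * fact j * y j) * ((real j + 1) * Q i j)"
      unfolding B ch il(3) by (simp only: \<kappa> Suc_eq_plus1[symmetric])
    also have "\<dots> = ((-1) ^ Suc i * (-1) ^ Suc j) * fact l * (Q i j * (y i * y j))"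
      by (simp add: field_simps add_nonneg_eq_0_iff del: power_Suc)
    finally show ?thesis unfolding sg s_def g_def j_def[symmetric] by (simp add: mult.assoc)
  qed
  have "(\<Sum>i\<in>{0..l-1}. g i) = (\<Sum>i\<in>{0..l-1}. Q (l - 1 - i) i * (y i * y (l - 1 - i)))"
  proof -
    have "(\<Sum>i\<in>{0..l-1}. g i) = (\<Sum>i\<in>{0..l-1}. g (l - 1 + 0 - i))" by (rule sum.atLeastAtMost_rev)
    also have "\<dots> = (\<Sum>i\<in>{0..l-1}. Q (l - 1 - i) i * (y i * y (l - 1 - i)))"
    proof (rule sum.cong[OF refl])
      fix i assume "i \<in> {0..l-1}"
      then have "l - 1 - (l - 1 - i) = i" by auto
      then show "g (l - 1 + 0 - i) = Q (l - 1 - i) i * (y i * y (l - 1 - i))"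
        by (simp only: g_def add_0_right mult.commute)
    qed
    finally show ?thesis .
  qed
  then have "2 * (\<Sum>i\<in>{0..l-1}. g i) = (\<Sum>i\<in>{0..l-1}. g i) + (\<Sum>i\<in>{0..l-1}. Q (l - 1 - i) i * (y i * y (l - 1 - i)))"
    by simp
  also have "\<dots> = (\<Sum>i\<in>{0..l-1}. (Q i (l - 1 - i) + Q (l - 1 - i) i) * (y i * y (l - 1 - i)))"
    by (simp add: g_def sum.distrib[symmetric] distrib_right)
  also have "\<dots> = (\<Sum>i\<in>{0..l-1}. 12 * (real i * y i * (real (l - 1 - i) * y (l - 1 - i)))
      + 2 * ((2 * real l - 1) * chi \<beta>) * (y i * y (l - 1 - i)))"
  proof (rule sum.cong[OF refl])
    fix i assume i: "i \<in> {0..l-1}"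
    define j where "j = l - 1 - i"
    have il: "l = Suc (i + j)" using i l by (auto simp: j_def)
    have QQ: "Q i j + Q j i = 12 * real i * real j + 2 * ((2 * real l - 1) * chi \<beta>)"
      using \<beta> unfolding Q_def il chi_def by (auto simp: algebra_simps)
    show "(Q i (l - 1 - i) + Q (l - 1 - i) i) * (y i * y (l - 1 - i))
      = 12 * (real i * y i * (real (l - 1 - i) * y (l - 1 - i))) + 2 * ((2 * real l - 1) * chi \<beta>) * (y i * y (l - 1 - i))"
      unfolding j_def[symmetric] QQ by (simp add: algebra_simps)
  qed
  also have "\<dots> = 12 * (\<Sum>i\<in>{0..l-1}. real i * y i * (real (l - 1 - i) * y (l - 1 - i)))
      + 2 * ((2 * real l - 1) * chi \<beta>) * (\<Sum>i\<in>{0..l-1}. y i * y (l - 1 - i))"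
    by (simp only: sum.distrib sum_distrib_left)
  finally have g: "(\<Sum>i\<in>{0..l-1}. g i) = 6 * (\<Sum>i\<in>{0..l-1}. real i * y i * (real (l - 1 - i) * y (l - 1 - i)))
      + (2 * real l - 1) * chi \<beta> * (\<Sum>i\<in>{0..l-1}. y i * y (l - 1 - i))" by simp
  have "(\<Sum>i\<in>{0..l-1}. real (l choose i) * \<kappa> (i + 1) * \<kappa> (l - i) * B_coeff \<beta> i l) = s * (\<Sum>i\<in>{0..l-1}. g i)"
    unfolding sum_distrib_left by (rule sum.cong[OF refl]) (rule tm)
  moreover have "eta \<beta> * (s * (6 * u + (2 * real l - 1) * chi \<beta> * v))
      = s * (6 * eta \<beta> * u + (2 * real l - 1) * real \<beta> * v)" for u v
  proof -
    have "eta \<beta> * chi \<beta> = real \<beta>" using \<beta> by (auto simp: eta_def chi_def)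
    then have "(2 * real l - 1) * real \<beta> * v = eta \<beta> * ((2 * real l - 1) * chi \<beta> * v)" by simp
    then show ?thesis by (simp only: distrib_left mult_ac)
  qed
  ultimately show ?thesis unfolding g s_def[symmetric] by simp
qed

lemma fps_X_deriv_nth: "fps_nth (fps_X * fps_deriv (f::real fps)) m = real m * fps_nth f m"
  by (cases m) auto

lemma fps_square_nth: "fps_nth ((f::real fps)\<^sup>2) m = (\<Sum>i\<in>{0..m}. fps_nth f i * fps_nth f (m - i))"
  by (simp add: power2_eq_square fps_mult_nth)

text \<open>Comparison of the coefficients of X^l. Multiplication by (-1)^(l+1) l! converts y l, y
  (l - 1) and y (l - 2) into the terms with the cumulants of order l + 1, l and l - 1. With 3 \<le>
  l all index shifts caused by X^3 are genuine.\<close>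

lemma recurrence_from_ode:
  fixes Y R :: "real fps" and \<alpha> \<rho> :: real and \<delta> :: int and \<beta> n :: nat and \<kappa> :: "nat \<Rightarrow> real"
  defines "c0 \<equiv> real n * (\<alpha> + 1 + real \<beta> * (real n - 1) / 2)"
    and "c1 \<equiv> \<alpha> + of_int \<delta> / 2 + 2 + real \<beta> * (real n - 1)"
  defines "U \<equiv> - (fps_X + fps_const c1) * Y - fps_const c0"
  defines "V \<equiv> (fps_X + fps_const (c1 + 1 - real \<beta> / 2)) * U
      + fps_const (\<alpha> + 2 + real \<beta> * (real n - 1)) * fps_X * Y
      + fps_const (real \<beta> / 2) * fps_X * (fps_deriv Y + Y ^ 2)"
  assumes ode: "fps_const (eta \<beta>) * fps_X ^ 3 * (fps_deriv (fps_deriv (fps_deriv Y)) + 6 * (fps_deriv Y) ^ 2)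
      + 3 * (- (fps_X + fps_const c1) * (fps_X * fps_deriv U - U) - 2 * fps_X * U + 2 * V)
      + 4 * (fps_X * fps_deriv V - 2 * V)
     = fps_X ^ 3 * (fps_const \<rho> * R)"
    and \<kappa>: "\<And>k. \<kappa> (Suc k) = (-1) ^ Suc k * fact k * fps_nth Y k"
    and \<mu>: "\<And>k. \<mu> k = (-1) ^ k * fact k * fps_nth R k"
    and \<beta>: "\<beta> \<in> {1, 2, 4}" and l: "3 \<le> l"
  shows "A_coeff \<beta> \<alpha> \<delta> n l * \<kappa> (l + 1)
            + eta \<beta> * (\<Sum>i\<in>{0..l-1}. real (l choose i) * \<kappa> (i + 1) * \<kappa> (l - i) * B_coeff \<beta> i l)
            - real l * (2 * real l - 1) * (\<alpha> - of_int \<delta> / 2 + real \<beta> * real n) * \<kappa> l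
            - real l * (real l - 1) * (real l - 2) * \<kappa> (l - 1)
            = \<rho> * real l * (real l - 1) * (real l - 2) * \<mu> (l - 3)"
proof -
  obtain k where k: "l = Suc (Suc (Suc k))" using l by (metis Suc_le_D numeral_3_eq_3 Suc_le_mono)
  define y where "y = fps_nth Y"
  define S0 where "S0 = (\<Sum>i\<in>{0..l-1}. y i * y (l - 1 - i))"
  define S2 where "S2 = (\<Sum>i\<in>{0..l-1}. real i * y i * (real (l - 1 - i) * y (l - 1 - i)))"
  define W where "W = fps_X * fps_deriv U - U"
  have Un: "fps_nth U (Suc m) = - y m - c1 * y (Suc m)" for m
    by (simp add: U_def y_def algebra_simps)
  have Wn: "fps_nth W m = (real m - 1) * fps_nth U m" for m
    unfolding W_def fps_sub_nth fps_X_deriv_nth by (simp add: algebra_simps)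
  have Vn: "fps_nth V l = fps_nth U (Suc (Suc k)) + (c1 + 1 - real \<beta> / 2) * fps_nth U l
      + (\<alpha> + 2 + real \<beta> * (real n - 1)) * y (Suc (Suc k)) + real \<beta> / 2 * (real l * y l + S0)"
    unfolding V_def k by (simp add: y_def S0_def k fps_square_nth algebra_simps)
  have Y3: "fps_nth (fps_X ^ 3 * fps_deriv (fps_deriv (fps_deriv Y))) l = real l * (real l - 1) * (real l - 2) * y l"
    unfolding fps_X_power_mult_nth k by (simp add: y_def algebra_simps)
  have Y2: "fps_nth (fps_X ^ 3 * (fps_deriv Y)\<^sup>2) l = S2"
  proof -
    have "S2 = (\<Sum>i\<in>{0..k}. real (Suc i) * y (Suc i) * (real (Suc k - i) * y (Suc k - i)))"
      unfolding S2_def k diff_Suc_1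
      by (subst sum.atLeast0_atMost_Suc_shift, subst sum.atLeast0_atMost_Suc) simp
    also have "\<dots> = (\<Sum>i\<in>{0..k}. fps_nth (fps_deriv Y) i * fps_nth (fps_deriv Y) (k - i))"
      by (rule sum.cong) (auto simp: y_def Suc_diff_le)
    finally show ?thesis unfolding fps_X_power_mult_nth k by (simp add: fps_square_nth)
  qed
  have "fps_const (eta \<beta>) * fps_X ^ 3 * (fps_deriv (fps_deriv (fps_deriv Y)) + 6 * (fps_deriv Y) ^ 2)
      + 3 * (- (fps_X + fps_const c1) * W - 2 * fps_X * U + 2 * V) + 4 * (fps_X * fps_deriv V - 2 * V)
     = fps_const (eta \<beta>) * (fps_X ^ 3 * fps_deriv (fps_deriv (fps_deriv Y)))
       + fps_const (eta \<beta>) * (fps_const 6 * (fps_X ^ 3 * (fps_deriv Y)\<^sup>2))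
       - fps_const 3 * (fps_X * W) - fps_const 3 * (fps_const c1 * W) - fps_const 6 * (fps_X * U) - fps_const 2 * V
       + fps_const 4 * (fps_X * fps_deriv V)"
    by (simp add: algebra_simps numeral_fps_const[symmetric] del: fps_const_neg)
  then have "fps_nth (fps_const (eta \<beta>) * (fps_X ^ 3 * fps_deriv (fps_deriv (fps_deriv Y)))
       + fps_const (eta \<beta>) * (fps_const 6 * (fps_X ^ 3 * (fps_deriv Y)\<^sup>2))
       - fps_const 3 * (fps_X * W) - fps_const 3 * (fps_const c1 * W) - fps_const 6 * (fps_X * U) - fps_const 2 * V
       + fps_const 4 * (fps_X * fps_deriv V)) l = fps_nth (fps_X ^ 3 * (fps_const \<rho> * R)) l"
    using ode unfolding W_def[symmetric] by simp
  \<comment> \<open>The coefficient of V enters with 4 l - 2, which is the origin of the factor 2 l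
    - 1 in the recurrence.\<close>
  then have c: "eta \<beta> * (real l * (real l - 1) * (real l - 2) * y l) + eta \<beta> * (6 * S2)
       - 3 * ((real l - 2) * fps_nth U (Suc (Suc k))) - 3 * (c1 * ((real l - 1) * fps_nth U l))
       - 6 * fps_nth U (Suc (Suc k)) - 2 * fps_nth V l + 4 * (real l * fps_nth V l) = \<rho> * fps_nth R k"
    unfolding fps_add_nth fps_sub_nth fps_mult_left_const_nth Y2 Y3 Wn fps_X_deriv_nth
    by (simp add: k Wn fps_X_power_mult_nth)
  have U1: "fps_nth U (Suc (Suc k)) = - y (Suc k) - c1 * y (Suc (Suc k))"
    and U2: "fps_nth U l = - y (Suc (Suc k)) - c1 * y l"
    using Un[of "Suc k"] Un[of "Suc (Suc k)"] by (simp_all add: k)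
  have main: "A_coeff \<beta> \<alpha> \<delta> n l * y l + (6 * eta \<beta> * S2 + (2 * real l - 1) * real \<beta> * S0)
      + (2 * real l - 1) * (\<alpha> - of_int \<delta> / 2 + real \<beta> * real n) * y (Suc (Suc k))
      - (real l - 2) * y (Suc k) = \<rho> * fps_nth R k"
    unfolding c[symmetric] Vn U1 U2 A_coeff_def c1_def by (simp add: field_simps)
  define s where "s = ((-1) ^ (l + 1) * fact l :: real)"
  have k1: "\<kappa> (l + 1) = s * y l" by (simp add: \<kappa> s_def y_def)
  have k2: "real l * \<kappa> l = - s * y (Suc (Suc k))" by (simp add: \<kappa> s_def y_def k)
  have k3: "real l * (real l - 1) * \<kappa> (l - 1) = s * y (Suc k)"
    by (simp add: \<kappa> s_def y_def k algebra_simps)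
  have k4: "real l * (real l - 1) * (real l - 2) * \<mu> (l - 3) = s * fps_nth R k"
    by (simp add: \<mu> s_def k algebra_simps)
  have conv: "eta \<beta> * (\<Sum>i\<in>{0..l-1}. real (l choose i) * \<kappa> (i + 1) * \<kappa> (l - i) * B_coeff \<beta> i l)
      = s * (6 * eta \<beta> * S2 + (2 * real l - 1) * real \<beta> * S0)"
    unfolding s_def S0_def S2_def by (rule cumulant_convolution) (use \<kappa> \<beta> l y_def in auto)
  have "A_coeff \<beta> \<alpha> \<delta> n l * \<kappa> (l + 1)
            + eta \<beta> * (\<Sum>i\<in>{0..l-1}. real (l choose i) * \<kappa> (i + 1) * \<kappa> (l - i) * B_coeff \<beta> i l)
            - real l * (2 * real l - 1) * (\<alpha> - of_int \<delta> / 2 + real \<beta> * real n) * \<kappa> l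
            - real l * (real l - 1) * (real l - 2) * \<kappa> (l - 1)
     = A_coeff \<beta> \<alpha> \<delta> n l * (s * y l) + s * (6 * eta \<beta> * S2 + (2 * real l - 1) * real \<beta> * S0)
       - (2 * real l - 1) * (\<alpha> - of_int \<delta> / 2 + real \<beta> * real n) * (- s * y (Suc (Suc k)))
       - (real l - 2) * (s * y (Suc k))"
    unfolding conv k1 k2[symmetric] k3[symmetric] by (simp only: mult_ac)
  also have "\<dots> = s * (\<rho> * fps_nth R k)" unfolding main[symmetric] by (simp add: algebra_simps)
  also have "\<dots> = \<rho> * (real l * (real l - 1) * (real l - 2) * \<mu> (l - 3))" unfolding k4 by simp
  finally show ?thesis by (simp only: mult.assoc)
qed

text \<open>The recursion of the reduced moments is R' = S R read coefficientwise, as in the passage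
  from cumulants to moments.\<close>

lemma reduced_moment_fps:
  fixes R :: "real fps"
  assumes R0: "fps_nth R 0 = 1" and R': "fps_deriv R = S * R"
    and S: "\<And>k. r_coeff \<beta> \<alpha> \<delta> n (Suc k) = (-1) ^ Suc k * fact k * fps_nth S k"
  shows "reduced_moment \<beta> \<alpha> \<delta> n k = (-1) ^ k * fact k * fps_nth R k"
proof (induction k rule: less_induct)
  case (less k)
  show ?case
  proof (cases k)
    case (Suc l)
    have "reduced_moment \<beta> \<alpha> \<delta> n (Suc l) = (\<Sum>j\<in>{0..l}. (-1) ^ Suc l * fact l * (fps_nth R j * fps_nth S (l - j)))"
      unfolding reduced_moment.simps
    proof (rule sum.cong[OF refl])
      fix j assume j: "j \<in> {0..l}"
      have e: "Suc l - j = Suc (l - j)" using j by auto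
      have m: "reduced_moment \<beta> \<alpha> \<delta> n j = (-1) ^ j * fact j * fps_nth R j" by (rule less) (use j Suc in auto)
      have sg: "(-1::real) ^ Suc (l - j) * (-1) ^ j = (-1) ^ Suc l"
        using j by (simp flip: power_add)
      have "real (l choose j) * r_coeff \<beta> \<alpha> \<delta> n (Suc l - j) * reduced_moment \<beta> \<alpha> \<delta> n j
          = ((-1) ^ Suc (l - j) * (-1) ^ j) * (real (l choose j) * fact j * fact (l - j)) * (fps_nth R j * fps_nth S (l - j))"
        unfolding e m S by (simp only: mult_ac)
      also have "real (l choose j) * fact j * fact (l - j) = fact l"
        using binomial_fact[of j l, where 'a = real] j by simp
      finally show "real (l choose j) * r_coeff \<beta> \<alpha> \<delta> n (Suc l - j) * reduced_moment \<beta> \<alpha> \<delta> n j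
          = (-1) ^ Suc l * fact l * (fps_nth R j * fps_nth S (l - j))" unfolding sg .
    qed
    also have "\<dots> = (-1) ^ Suc l * fact l * fps_nth (R * S) l"
      unfolding fps_mult_nth sum_distrib_left ..
    also have "R * S = fps_deriv R" unfolding R' by (rule mult.commute)
    also have "fps_nth (fps_deriv R) l = real (Suc l) * fps_nth R (Suc l)" by simp
    finally show ?thesis by (simp add: Suc mult_ac del: reduced_moment.simps)
  qed (simp add: R0)
qed

subsection \<open>Cumulants of the ensemble\<close>

context jacobi_measure
begin

lemma integral_PiM_nu:
  assumes "finite I" and [measurable]: "f \<in> borel_measurable (PiM I (\<lambda>_. lborel))"
  shows "(\<integral>x. f x \<partial>PiM I (\<lambda>_. nu z)) = (\<integral>x. (\<Prod>i\<in>I. jacobi_weight a d z (x i)) * f x \<partial>PiM I (\<lambda>_. lborel))"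
  unfolding PiM_nu[OF assms(1)] by (subst integral_density) (auto intro!: AE_I2 prod_nonneg)

lemma cube_bounded_measurable: "cube_bounded I f \<Longrightarrow> f \<in> borel_measurable (PiM I (\<lambda>_. lborel))"
  by (simp add: cube_bounded_def)

text \<open>The measures for different z differ by the factor exp (- z p1) only. Over the fixed
  measure at z = 0 that factor can be expanded under the integral.\<close>

lemma ensemble_exp:
  assumes "cube_bounded {1..n} g"
  shows "ensemble \<beta> n z g = ensemble \<beta> n 0 (\<lambda>x. exp (- z * power_sum n 1 x) * g x)"
proof -
  have "(\<Prod>i\<in>{1..n}. jacobi_weight a d z (x i)) = (\<Prod>i\<in>{1..n}. jacobi_weight a d 0 (x i)) * exp (- z * power_sum n 1 x)" for x
    by (simp add: jacobi_weight_def power_sum_def sum_distrib_left exp_sum prod.distrib flip: sum_negf)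
  moreover have "cube_bounded {1..n} (\<lambda>x. g x * ensemble_weight \<beta> n x)"
    "cube_bounded {1..n} (\<lambda>x. exp (- z * power_sum n 1 x) * g x * ensemble_weight \<beta> n x)"
    by (intro cube_intros assms)+
  ultimately show ?thesis unfolding ensemble_def
    by (subst (1 2) integral_PiM_nu) (auto intro: cube_bounded_measurable simp: mult.assoc)
qed

definition ensemble_fps :: "nat \<Rightarrow> nat \<Rightarrow> ((nat \<Rightarrow> real) \<Rightarrow> real) \<Rightarrow> real fps" where
  "ensemble_fps \<beta> n g = Abs_fps (\<lambda>k. (-1) ^ k / fact k * ensemble \<beta> n 0 (\<lambda>x. power_sum n 1 x ^ k * g x))"

text \<open>On the cube p1 is bounded, so the exponential series has summable norms and may be
  integrated term by term; it converges for every z.\<close>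

lemma ensemble_has_fps_expansion:
  assumes g: "cube_bounded {1..n} g"
  shows "(\<lambda>z. ensemble \<beta> n z g) has_fps_expansion ensemble_fps \<beta> n g"
proof (rule has_fps_expansionI, rule always_eventually, rule allI)
  fix z :: real
  let ?M = "PiM {1..n} (\<lambda>_. nu 0)"
  let ?p = "power_sum n 1"
  define G where "G = (\<lambda>x. g x * ensemble_weight \<beta> n x)"
  define f where "f = (\<lambda>k x. (- z * ?p x) ^ k / fact k * G x)"
  have cG: "cube_bounded {1..n} G" unfolding G_def by (intro cube_intros g)
  have cf: "cube_bounded {1..n} (f k)" for k
  proof -
    have "cube_bounded {1..n} (\<lambda>x. (1 / fact k) * ((- z * ?p x) ^ k * G x))"
      by (intro cube_intros cG)
    then show ?thesis by (simp add: f_def)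
  qed
  obtain B where B: "\<And>x. in_cube {1..n} x \<Longrightarrow> \<bar>G x\<bar> \<le> B"
    using cG unfolding cube_bounded_def by auto
  obtain C where C: "\<And>x. in_cube {1..n} x \<Longrightarrow> \<bar>?p x\<bar> \<le> C"
    using cube_bounded_power_sum[of n 1] unfolding cube_bounded_def by auto
  have fm: "finite_measure ?M" by (rule finite_measure_PiM_nu) simp
  have bound: "AE x in ?M. norm (f k x) \<le> (\<bar>z\<bar> * C) ^ k / fact k * B" for k
  proof (rule AE_mp[OF AE_in_cube[of "{1..n}" 0] AE_I2], simp, rule impI)
    fix x assume elim: "in_cube {1..n} x"
    have "norm (f k x) = (\<bar>z\<bar> * \<bar>?p x\<bar>) ^ k / fact k * \<bar>G x\<bar>"
      by (simp add: f_def abs_mult power_abs)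
    also have "\<dots> \<le> (\<bar>z\<bar> * C) ^ k / fact k * B"
      using B[OF elim] C[OF elim] by (intro mult_mono divide_right_mono power_mono mult_left_mono) auto
    finally show "norm (f k x) \<le> (\<bar>z\<bar> * C) ^ k / fact k * B" .
  qed
  have int: "integrable ?M (f k)" for k by (rule integrable_cube_bounded, simp, rule cf)
  have s: "(\<lambda>k. integral\<^sup>L ?M (f k)) sums (\<integral>x. (\<Sum>k. f k x) \<partial>?M)"
  proof (rule sums_integral[OF int])
    show "AE x in ?M. summable (\<lambda>k. norm (f k x))"
    proof (rule AE_I2)
      fix x
      have "summable (\<lambda>k. inverse (fact k) * \<bar>- z * ?p x\<bar> ^ k * \<bar>G x\<bar>)"
        by (intro summable_mult2 summable_exp)
      then show "summable (\<lambda>k. norm (f k x))"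
        by (simp add: f_def abs_mult power_abs field_simps)
    qed
    show "summable (\<lambda>k. \<integral>x. norm (f k x) \<partial>?M)"
    proof (rule summable_comparison_test')
      show "summable (\<lambda>k. inverse (fact k) * (\<bar>z\<bar> * C) ^ k * (B * measure ?M (space ?M)))"
        by (intro summable_mult2 summable_exp)
      fix k :: nat
      have "(\<integral>x. norm (f k x) \<partial>?M) \<le> (\<integral>x. (\<bar>z\<bar> * C) ^ k / fact k * B \<partial>?M)"
        by (rule integral_mono_AE[OF integrable_norm[OF int] finite_measure.integrable_const[OF fm] bound])
      also have "\<dots> = inverse (fact k) * (\<bar>z\<bar> * C) ^ k * (B * measure ?M (space ?M))"
        by (simp add: field_simps)
      finally show "norm (\<integral>x. norm (f k x) \<partial>?M) \<le> inverse (fact k) * (\<bar>z\<bar> * C) ^ k * (B * measure ?M (space ?M))"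
        by simp
    qed
  qed
  have "(\<Sum>k. f k x) = exp (- z * ?p x) * G x" for x
  proof -
    have "(\<lambda>k. (- z * ?p x) ^ k / fact k * G x) sums (exp (- z * ?p x) * G x)"
      using exp_converges[of "- z * ?p x"] by (intro sums_mult2) (simp add: field_simps)
    then show ?thesis unfolding f_def by (rule sums_unique[symmetric])
  qed
  then have "(\<integral>x. (\<Sum>k. f k x) \<partial>?M) = ensemble \<beta> n z g"
    unfolding ensemble_exp[OF g] by (simp add: ensemble_def G_def mult.assoc)
  moreover have "integral\<^sup>L ?M (f k) = fps_nth (ensemble_fps \<beta> n g) k * z ^ k" for k
  proof -
    have "f k = (\<lambda>x. ((-1) ^ k / fact k * z ^ k) * (?p x ^ k * g x * ensemble_weight \<beta> n x))"
    proof
      fix x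
      have "(- z * ?p x) ^ k = (-1) ^ k * z ^ k * ?p x ^ k"
        by (metis mult_minus1 power_mult_distrib)
      then show "f k x = ((-1) ^ k / fact k * z ^ k) * (?p x ^ k * g x * ensemble_weight \<beta> n x)"
        unfolding f_def G_def by simp
    qed
    then have "integral\<^sup>L ?M (f k)
        = ((-1) ^ k / fact k * z ^ k) * (\<integral>x. ?p x ^ k * g x * ensemble_weight \<beta> n x \<partial>?M)"
      by (simp only: integral_mult_right_zero)
    then show ?thesis by (simp add: ensemble_fps_def ensemble_def)
  qed
  ultimately show "(\<lambda>k. fps_nth (ensemble_fps \<beta> n g) k * z ^ k) sums ensemble \<beta> n z g"
    using s by simp
qed

lemma fps_deriv_ensemble_fps:
  "fps_deriv (ensemble_fps \<beta> n g) = - ensemble_fps \<beta> n (\<lambda>x. power_sum n 1 x * g x)"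
proof (rule fps_ext)
  fix k
  have "(\<lambda>x. power_sum n 1 x ^ Suc k * g x) = (\<lambda>x. power_sum n 1 x ^ k * (power_sum n 1 x * g x))"
    by (simp add: mult_ac)
  then have "fps_nth (fps_deriv (ensemble_fps \<beta> n g)) k = (real (Suc k) * ((-1) ^ Suc k / fact (Suc k)))
      * ensemble \<beta> n 0 (\<lambda>x. power_sum n 1 x ^ k * (power_sum n 1 x * g x))"
    by (simp add: ensemble_fps_def)
  also have "real (Suc k) * ((-1) ^ Suc k / fact (Suc k)) = - ((-1) ^ k / fact k)"
    by (simp add: divide_simps)
  finally show "fps_nth (fps_deriv (ensemble_fps \<beta> n g)) k
      = fps_nth (- ensemble_fps \<beta> n (\<lambda>x. power_sum n 1 x * g x)) k"
    by (simp add: ensemble_fps_def)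
qed

section \<open>Positivity of the normalization and comparison with the given integrals\<close>

lemma nu_interval_pos:
  assumes "0 \<le> l" "l < u" "u \<le> 1"
  shows "emeasure (nu z) {l<..<u} \<noteq> 0"
proof
  assume "emeasure (nu z) {l<..<u} = 0"
  then have "{l<..<u} \<in> null_sets (nu z)" by (simp add: null_sets_def)
  then have "AE x in nu z. x \<notin> {l<..<u}" by (subst (asm) AE_iff_null_sets) auto
  then have "AE x in lborel. 0 < ennreal (jacobi_weight a d z x) \<longrightarrow> x \<notin> {l<..<u}"
    unfolding nu_def by (subst (asm) AE_density) auto
  then have "AE x in lborel. x \<notin> {l<..<u}"
    by eventually_elim (use assms in \<open>auto simp: jacobi_weight_def\<close>)
  then have "{l<..<u} \<in> null_sets lborel" by (subst AE_iff_null_sets) auto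
  then show False using assms by (auto simp: null_sets_def)
qed

lemma ensemble_pos: "ensemble \<beta> n z (\<lambda>x. 1) > 0"
proof -
  let ?M = "PiM {1..n} (\<lambda>_. nu z)"
  \<comment> \<open>Consecutive intervals of length 1 / (n + 1). On their product the coordinates
    increase strictly, so the weight is nonzero on a box of positive measure.\<close>
  let ?A = "\<lambda>i::nat. {(real i - 1) / (real n + 1) <..< real i / (real n + 1)}"
  have nonneg: "ensemble_weight \<beta> n x \<ge> 0" for x by (simp add: ensemble_weight_def)
  have int: "integrable ?M (\<lambda>x. 1 * ensemble_weight \<beta> n x)"
    by (rule integrable_ensemble) (rule cube_bounded_const)
  have "ensemble \<beta> n z (\<lambda>x. 1) \<noteq> 0"
  proof
    assume "ensemble \<beta> n z (\<lambda>x. 1) = 0"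
    then have "AE x in ?M. 1 * ensemble_weight \<beta> n x = 0"
      unfolding ensemble_def using integral_nonneg_eq_0_iff_AE[OF int] nonneg by auto
    then have "AE x in ?M. x \<notin> Pi\<^sub>E {1..n} ?A"
    proof eventually_elim
      case (elim x)
      have "ensemble_weight \<beta> n x \<noteq> 0" if "x \<in> Pi\<^sub>E {1..n} ?A"
      proof -
        have pos: "x k - x i > 0" if "k \<in> {1..n}" "i < k" "i \<in> {1..n}" for i k
        proof -
          have xi: "x i < real i / (real n + 1)" and xk: "x k > (real k - 1) / (real n + 1)"
            using \<open>x \<in> Pi\<^sub>E {1..n} ?A\<close> that by (auto simp: PiE_iff)
          have "real i / (real n + 1) \<le> (real k - 1) / (real n + 1)"
            using that(2) by (intro divide_right_mono) auto
          then show ?thesis using xi xk by linarith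
        qed
        have "vandermonde_set {1..n} x > 0"
          unfolding vandermonde_set_def
        proof (intro prod_pos)
          fix k i assume "k \<in> {1..n}" "i \<in> {i \<in> {1..n}. i < k}"
          then show "0 < \<bar>x k - x i\<bar>" using pos[of k i] by simp
        qed
        then show ?thesis unfolding ensemble_weight_set by simp
      qed
      then show ?case using elim by auto
    qed
    moreover have "Pi\<^sub>E {1..n} ?A \<in> sets ?M" by (rule sets_PiM_I_finite) auto
    ultimately have "emeasure ?M (Pi\<^sub>E {1..n} ?A) = 0"
      using AE_iff_null_sets by blast
    moreover have "emeasure ?M (Pi\<^sub>E {1..n} ?A) = (\<Prod>i\<in>{1..n}. emeasure (nu z) (?A i))"
      by (rule nu.emeasure_PiM) auto
    moreover have "emeasure (nu z) (?A i) \<noteq> 0" if "i \<in> {1..n}" for i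
    proof (rule nu_interval_pos)
      show "0 \<le> (real i - 1) / (real n + 1)" using that by (intro divide_nonneg_nonneg) auto
      show "(real i - 1) / (real n + 1) < real i / (real n + 1)" by (intro divide_strict_right_mono) auto
      show "real i / (real n + 1) \<le> 1" using that by (simp add: divide_le_eq)
    qed
    ultimately show False by (auto simp: prod_zero_iff)
  qed
  moreover have "ensemble \<beta> n z (\<lambda>x. 1) \<ge> 0"
    unfolding ensemble_def by (rule integral_nonneg_AE) (simp add: nonneg)
  ultimately show ?thesis by simp
qed

lemma jacobi_integral_eq_ensemble:
  assumes "d = of_int \<delta> / 2"
  shows "jacobi_integral \<beta> a \<delta> n z = ensemble \<beta> n z (\<lambda>x. 1)"
proof -
  have w: "(\<Prod>k\<in>{1..n}. \<Prod>j\<in>{1..<k}. \<bar>T k - T j\<bar> ^ \<beta>) = ensemble_weight \<beta> n T" for T :: "nat \<Rightarrow> real"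
  proof -
    have "{i \<in> {1..n}. i < k} = {1..<k}" if "k \<in> {1..n}" for k using that by auto
    then show ?thesis unfolding ensemble_weight_set vandermonde_set_def
      by (simp add: prod_power_distrib)
  qed
  have "ensemble \<beta> n z (\<lambda>x. 1) = (\<integral>T. (\<Prod>i\<in>{1..n}. jacobi_weight a d z (T i)) * (1 * ensemble_weight \<beta> n T) \<partial>PiM {1..n} (\<lambda>_. lborel))"
    unfolding ensemble_def
    by (rule integral_PiM_nu, simp, rule cube_bounded_measurable, intro cube_intros)
  also have "\<dots> = jacobi_integral \<beta> a \<delta> n z"
    unfolding jacobi_integral_def set_lebesgue_integral_def w
  proof (rule Bochner_Integration.integral_cong[OF refl])
    fix T :: "nat \<Rightarrow> real" assume "T \<in> space (PiM {1..n} (\<lambda>_. lborel))"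
    then have ext: "T \<in> extensional {1..n}" by (simp add: space_PiM PiE_def)
    have "(\<Prod>i\<in>{1..n}. jacobi_weight a d z (T i))
       = indicator ({1..n} \<rightarrow>\<^sub>E {0..1}) T * (\<Prod>j\<in>{1..n}. T j powr a * (1 - T j) powr (of_int \<delta> / 2) * exp (- z * T j))"
    proof (cases "T \<in> {1..n} \<rightarrow>\<^sub>E {0..1}")
      case True
      have "jacobi_weight a d z (T i) = T i powr a * (1 - T i) powr (of_int \<delta> / 2) * exp (- z * T i)"
        if "i \<in> {1..n}" for i
      proof -
        have "T i \<in> {0..1}" using True that by (auto simp: PiE_iff)
        \<comment> \<open>At the endpoints both sides are 0, because 0 powr x is 0 for every
          exponent x.\<close>
        then show ?thesis by (cases "T i = 0 \<or> T i = 1") (auto simp: jacobi_weight_def assms)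
      qed
      then show ?thesis using True by simp
    next
      case False
      then have "\<not> (\<forall>i\<in>{1..n}. T i \<in> {0..1})" using ext by (simp add: PiE_iff)
      then obtain i where i: "i \<in> {1..n}" "T i \<notin> {0..1}" by blast
      then have "jacobi_weight a d z (T i) = 0" by (auto simp: jacobi_weight_def)
      then have "(\<Prod>i\<in>{1..n}. jacobi_weight a d z (T i)) = 0" using i(1) by (intro prod_zero) auto
      then show ?thesis using False by simp
    qed
    then show "(\<Prod>i\<in>{1..n}. jacobi_weight a d z (T i)) * (1 * ensemble_weight \<beta> n T)
      = indicat_real ({1..n} \<rightarrow>\<^sub>E {0..1}) T *\<^sub>R
        ((\<Prod>j\<in>{1..n}. T j powr a * (1 - T j) powr (of_int \<delta> / 2) * exp (- z * T j)) * ensemble_weight \<beta> n T)"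
      by simp
  qed
  finally show ?thesis ..
qed

lemma norm_const_eq_ensemble:
  assumes "d = of_int \<delta> / 2"
  shows "norm_const \<beta> a \<delta> n = ensemble \<beta> n 0 (\<lambda>x. 1)"
  using jacobi_integral_eq_ensemble[OF assms, of \<beta> n 0] by (simp add: norm_const_def jacobi_integral_def)

definition tau_fps :: "nat \<Rightarrow> nat \<Rightarrow> real fps" where
  "tau_fps \<beta> n = ensemble_fps \<beta> n (\<lambda>x. 1)"

definition log_deriv_fps :: "nat \<Rightarrow> nat \<Rightarrow> real fps" where
  "log_deriv_fps \<beta> n = fps_deriv (tau_fps \<beta> n) * inverse (tau_fps \<beta> n)"

lemma tau_has_fps_expansion: "(\<lambda>z. ensemble \<beta> n z (\<lambda>x. 1)) has_fps_expansion tau_fps \<beta> n"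
  unfolding tau_fps_def by (rule ensemble_has_fps_expansion) (rule cube_bounded_const)

lemma tau_fps_nth_0: "fps_nth (tau_fps \<beta> n) 0 = ensemble \<beta> n 0 (\<lambda>x. 1)"
  by (simp add: tau_fps_def ensemble_fps_def)

lemma tau_fps_nonzero: "fps_nth (tau_fps \<beta> n) 0 \<noteq> 0" "tau_fps \<beta> n \<noteq> 0"
  using ensemble_pos[of \<beta> n 0] tau_fps_nth_0[of \<beta> n] by auto

lemma tau_inverse: "inverse (tau_fps \<beta> n) * tau_fps \<beta> n = 1"
  by (rule inverse_mult_eq_1) (rule tau_fps_nonzero)

lemma deriv_tau: "fps_deriv (tau_fps \<beta> n) = log_deriv_fps \<beta> n * tau_fps \<beta> n"
  unfolding log_deriv_fps_def by (simp add: mult.assoc tau_inverse)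

text \<open>The normalizing constant cancels in the logarithmic derivative. The series there is that
  of (log M)', which shifts the index by one.\<close>

lemma cumulant_eq:
  assumes "d = of_int \<delta> / 2"
  shows "cumulant \<beta> a \<delta> n (Suc k) = (-1) ^ Suc k * fact k * fps_nth (log_deriv_fps \<beta> n) k"
proof -
  define c where "c = 1 / ensemble \<beta> n 0 (\<lambda>x. 1)"
  let ?M = "mgf_conductance \<beta> a \<delta> n"
  have M: "?M = (\<lambda>z. c * ensemble \<beta> n z (\<lambda>x. 1))"
    unfolding mgf_conductance_def jacobi_integral_eq_ensemble[OF assms] norm_const_eq_ensemble[OF assms] c_def by auto
  have c: "c \<noteq> 0" using ensemble_pos[of \<beta> n 0] by (simp add: c_def)
  have "?M has_fps_expansion fps_const c * tau_fps \<beta> n"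
    unfolding M by (intro fps_expansion_intros tau_has_fps_expansion)
  moreover have "?M 0 > 0" unfolding M c_def using ensemble_pos[of \<beta> n 0] by simp
  ultimately have "(deriv ^^ Suc k) (\<lambda>z. ln (?M z)) 0
      = fact k * fps_nth (fps_deriv (fps_const c * tau_fps \<beta> n) / (fps_const c * tau_fps \<beta> n)) k"
    by (rule deriv_ln_coeff)
  also have "fps_deriv (fps_const c * tau_fps \<beta> n) = log_deriv_fps \<beta> n * (fps_const c * tau_fps \<beta> n)"
    by (simp add: deriv_tau mult.left_commute)
  also have "\<dots> / (fps_const c * tau_fps \<beta> n) = log_deriv_fps \<beta> n"
    using c tau_fps_nonzero(2) by (intro nonzero_mult_div_cancel_right) simp
  finally show ?thesis by (simp add: cumulant_def)
qed

definition plucker_coeff :: "nat \<Rightarrow> nat \<Rightarrow> real" where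
  "plucker_coeff \<beta> n = (if \<beta> = 1 then real n * (real n - 1) / ((real n + 1) * (real n + 2))
     else if \<beta> = 4 then real n / (real n + 1) else 0)"

lemma plucker_defect_eq:
  assumes "\<beta> \<in> {1, 2, 4}" "1 \<le> n"
  shows "plucker_defect \<beta> n (if \<beta> = 4 then 2 else 1) z
     = 12 * plucker_coeff \<beta> n * (ensemble \<beta> (n - shift \<beta>) z (\<lambda>x. 1) * ensemble \<beta> (n + shift \<beta>) z (\<lambda>x. 1))"
proof -
  consider "\<beta> = 4" | "\<beta> \<noteq> 4 \<and> n = 1" | "\<beta> = 1 \<and> 2 \<le> n" | "\<beta> = 2 \<and> 2 \<le> n"
    using assms by (cases "n = 1") auto
  then show ?thesis
  proof cases
    case 1
    then show ?thesis using plucker_defect_quaternion[OF assms(2), of z] by (simp add: plucker_coeff_def shift_def)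
  next
    case 2
    then show ?thesis using plucker_defect_single[of \<beta> z] by (simp add: plucker_coeff_def)
  next
    case 3
    then show ?thesis using plucker_defect_orthogonal[of n z] by (simp add: plucker_coeff_def shift_def)
  next
    case 4
    then have "n = (n - 2) + 2" by presburger
    with 4 show ?thesis using plucker_defect_unitary[of "n - 2" z] by (simp add: plucker_coeff_def)
  qed
qed

end

text \<open>Here y0, y1, y2 stand for -kappa1, kappa2, -kappa3 / 2, while u0, u1 and v0 are the
  lowest coefficients of e2 and e3. Eliminating the latter leaves one linear equation for y1 and one
  for y2; the factor c1 - b stays on the left because it may vanish.\<close>

lemma initial_cumulants:
  fixes a' b c0 c1 dd y0 y1 y2 u0 u1 v0 :: real
  assumes r1: "c1 * y0 = - c0" "u0 = - y0 - c1 * y1" "u1 = - y1 - c1 * y2"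
    and r2: "c1 * u1 + 2 * u0 = 2 * v0"
    and r3: "dd * u0 + a' * y0 + b / 2 * (y1 + y0\<^sup>2) = 0"
      "v0 = u0 + dd * u1 + a' * y1 + b / 2 * (2 * y2 + 2 * y0 * y1)"
    and dd: "dd = c1 + 1 - b / 2"
  shows "(c1 + 1) * (c1 - b / 2) * y1 = - y0 * (dd - a') + b / 2 * y0\<^sup>2"
    and "(c1 + 2) * (c1 - b) * (- 2 * y2) = 2 * y1 * (2 * dd - c1 - 2 * a' - 2 * b * y0)"
proof -
  have "dd * (- y0 - c1 * y1) + a' * y0 + b / 2 * (y1 + y0\<^sup>2) = 0" using r3(1) r1(2) by simp
  then show "(c1 + 1) * (c1 - b / 2) * y1 = - y0 * (dd - a') + b / 2 * y0\<^sup>2"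
    unfolding dd by (simp add: field_simps)
  have "c1 * u1 = 2 * (dd * u1 + a' * y1 + b / 2 * (2 * y2 + 2 * y0 * y1))"
    using r2 r3(2) by simp
  then have "(2 * dd - c1) * u1 + 2 * a' * y1 + 2 * b * (y2 + y0 * y1) = 0"
    by (simp add: algebra_simps)
  then show "(c1 + 2) * (c1 - b) * (- 2 * y2) = 2 * y1 * (2 * dd - c1 - 2 * a' - 2 * b * y0)"
    unfolding r1(3) dd by (simp add: field_simps)
qed

context jacobi_measure
begin

lemma ensemble_fps_powers:
  fixes \<beta> n :: nat
  defines "F \<equiv> tau_fps \<beta> n" and "p \<equiv> power_sum n"
  shows "ensemble_fps \<beta> n (p 1) = - fps_deriv F"
    and "ensemble_fps \<beta> n (\<lambda>x. p 1 x ^ 2) = fps_deriv (fps_deriv F)"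
    and "ensemble_fps \<beta> n (\<lambda>x. p 1 x ^ 3) = - fps_deriv (fps_deriv (fps_deriv F))"
    and "ensemble_fps \<beta> n (\<lambda>x. p 1 x ^ 4) = fps_deriv (fps_deriv (fps_deriv (fps_deriv F)))"
  unfolding F_def tau_fps_def p_def
  by (simp_all add: fps_deriv_ensemble_fps power2_eq_square power3_eq_cube power4_eq_xxxx mult.assoc)

lemma virasoro_fps:
  fixes \<beta> n :: nat
  defines "G \<equiv> ensemble_fps \<beta> n" and "p \<equiv> power_sum n" and "F \<equiv> tau_fps \<beta> n"
    and "c0 \<equiv> loop_c0 \<beta> n" and "c1 \<equiv> loop_c1 \<beta> n"
  assumes b: "1 \<le> \<beta>"
  shows "fps_X * G (p 2) = - (fps_X + fps_const c1) * fps_deriv F - fps_const c0 * F"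
    and "fps_X * G (\<lambda>x. p 2 x ^ 2) = - (fps_X + fps_const c1) * fps_deriv (G (p 2)) - fps_const (c0 + 2) * G (p 2) + 2 * G (p 3)"
    and "fps_X * G (p 3) = (fps_X + fps_const (c1 + 1 - real \<beta> / 2)) * G (p 2)
       + fps_const (a + 2 + real \<beta> * (real n - 1)) * fps_deriv F + fps_const (real \<beta> / 2) * fps_deriv (fps_deriv F)"
proof -
  have cb: "cube_bounded {1..n} (p k)" for k unfolding p_def by (rule cube_bounded_power_sum)
  have e: "(\<lambda>z. ensemble \<beta> n z g) has_fps_expansion G g" if "cube_bounded {1..n} g" for g
    unfolding G_def by (rule ensemble_has_fps_expansion[OF that])
  have eF: "(\<lambda>z. ensemble \<beta> n z (\<lambda>x. 1)) has_fps_expansion F"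
    unfolding F_def by (rule tau_has_fps_expansion)
  note vc = virasoro_constraints[OF b, of _ n, folded p_def c0_def c1_def]
  have d12: "fps_deriv (G (p 2)) = - G (\<lambda>x. p 1 x * p 2 x)"
    unfolding G_def p_def by (rule fps_deriv_ensemble_fps)
  have "fps_X * G (p 2) = (fps_X + fps_const c1) * G (p 1) - fps_const c0 * F"
  proof (rule has_fps_expansion_unique_real)
    show "(\<lambda>z. z * ensemble \<beta> n z (p 2)) has_fps_expansion fps_X * G (p 2)"
      by (intro fps_expansion_intros e cb)
    show "(\<lambda>z. z * ensemble \<beta> n z (p 2)) has_fps_expansion (fps_X + fps_const c1) * G (p 1) - fps_const c0 * F"
      unfolding vc(1) by (intro fps_expansion_intros e eF cb)
  qed
  then show "fps_X * G (p 2) = - (fps_X + fps_const c1) * fps_deriv F - fps_const c0 * F"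
    unfolding G_def p_def ensemble_fps_powers F_def by (simp add: algebra_simps del: fps_const_neg)
  have "fps_X * G (\<lambda>x. p 2 x ^ 2) = (fps_X + fps_const c1) * G (\<lambda>x. p 1 x * p 2 x) - fps_const (c0 + 2) * G (p 2) + fps_const 2 * G (p 3)"
  proof (rule has_fps_expansion_unique_real)
    show "(\<lambda>z. z * ensemble \<beta> n z (\<lambda>x. p 2 x ^ 2)) has_fps_expansion fps_X * G (\<lambda>x. p 2 x ^ 2)"
      by (intro fps_expansion_intros e cube_intros cb)
    show "(\<lambda>z. z * ensemble \<beta> n z (\<lambda>x. p 2 x ^ 2)) has_fps_expansion
       (fps_X + fps_const c1) * G (\<lambda>x. p 1 x * p 2 x) - fps_const (c0 + 2) * G (p 2) + fps_const 2 * G (p 3)"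
      unfolding vc(2) by (intro fps_expansion_intros e cube_intros cb)
  qed
  then show "fps_X * G (\<lambda>x. p 2 x ^ 2) = - (fps_X + fps_const c1) * fps_deriv (G (p 2)) - fps_const (c0 + 2) * G (p 2) + 2 * G (p 3)"
    unfolding d12 by (simp add: numeral_fps_const algebra_simps del: fps_const_neg)
  have "fps_X * G (p 3) = (fps_X + fps_const c1 + fps_const 1 - fps_const (real \<beta> / 2)) * G (p 2)
       - fps_const (a + 2 + real \<beta> * (real n - 1)) * G (p 1) + fps_const (real \<beta> / 2) * G (\<lambda>x. p 1 x ^ 2)"
  proof (rule has_fps_expansion_unique_real)
    show "(\<lambda>z. z * ensemble \<beta> n z (p 3)) has_fps_expansion fps_X * G (p 3)"
      by (intro fps_expansion_intros e cb)
    show "(\<lambda>z. z * ensemble \<beta> n z (p 3)) has_fps_expansion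
       (fps_X + fps_const c1 + fps_const 1 - fps_const (real \<beta> / 2)) * G (p 2)
       - fps_const (a + 2 + real \<beta> * (real n - 1)) * G (p 1) + fps_const (real \<beta> / 2) * G (\<lambda>x. p 1 x ^ 2)"
      unfolding vc(3) by (intro has_fps_expansion_add has_fps_expansion_diff has_fps_expansion_mult
          has_fps_expansion_const has_fps_expansion_fps_X e cube_intros cb)
  qed
  moreover have "fps_X + fps_const c1 + fps_const 1 - fps_const (real \<beta> / 2) = fps_X + fps_const (c1 + 1 - real \<beta> / 2)"
    by (simp add: add_diff_eq flip: fps_const_add fps_const_sub)
  ultimately show "fps_X * G (p 3) = (fps_X + fps_const (c1 + 1 - real \<beta> / 2)) * G (p 2)
       + fps_const (a + 2 + real \<beta> * (real n - 1)) * fps_deriv F + fps_const (real \<beta> / 2) * fps_deriv (fps_deriv F)"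
    unfolding G_def p_def ensemble_fps_powers F_def by simp
qed

text \<open>The quotient of the outer partition functions by the squared middle one, scaled to
  constant term 1. Its logarithmic derivative is a second difference in n, so its coefficients are
  the reduced moments.\<close>

definition tau_ratio :: "nat \<Rightarrow> nat \<Rightarrow> real fps" where
  "tau_ratio \<beta> n = fps_const ((ensemble \<beta> n 0 (\<lambda>x. 1))\<^sup>2
       / (ensemble \<beta> (n - shift \<beta>) 0 (\<lambda>x. 1) * ensemble \<beta> (n + shift \<beta>) 0 (\<lambda>x. 1)))
     * (tau_fps \<beta> (n - shift \<beta>) * tau_fps \<beta> (n + shift \<beta>)) * (inverse (tau_fps \<beta> n))\<^sup>2"

lemma tau_ratio_mult:
  "tau_ratio \<beta> n * (tau_fps \<beta> n)\<^sup>2 = fps_const ((ensemble \<beta> n 0 (\<lambda>x. 1))\<^sup>2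
       / (ensemble \<beta> (n - shift \<beta>) 0 (\<lambda>x. 1) * ensemble \<beta> (n + shift \<beta>) 0 (\<lambda>x. 1)))
     * (tau_fps \<beta> (n - shift \<beta>) * tau_fps \<beta> (n + shift \<beta>))"
proof -
  have "(inverse (tau_fps \<beta> n))\<^sup>2 * (tau_fps \<beta> n)\<^sup>2 = 1"
    by (simp add: tau_inverse flip: power_mult_distrib)
  then show ?thesis unfolding tau_ratio_def by (simp add: mult.assoc)
qed

lemma tau_ratio_nth_0: "fps_nth (tau_ratio \<beta> n) 0 = 1"
  using ensemble_pos[of \<beta> n 0] ensemble_pos[of \<beta> "n - shift \<beta>" 0] ensemble_pos[of \<beta> "n + shift \<beta>" 0]
  by (simp add: tau_ratio_def tau_fps_nth_0 fps_power_zeroth field_simps power2_eq_square)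

lemma tau_ratio_deriv:
  "fps_deriv (tau_ratio \<beta> n)
     = (log_deriv_fps \<beta> (n - shift \<beta>) + log_deriv_fps \<beta> (n + shift \<beta>) - 2 * log_deriv_fps \<beta> n) * tau_ratio \<beta> n"
proof -
  let ?R = "tau_ratio \<beta> n" and ?F = "tau_fps \<beta> n" and ?Y = "log_deriv_fps \<beta>"
  let ?S = "?Y (n - shift \<beta>) + ?Y (n + shift \<beta>)"
  have "fps_deriv (?R * ?F\<^sup>2) = ?S * (?R * ?F\<^sup>2)"
    unfolding tau_ratio_mult by (simp add: deriv_tau algebra_simps)
  moreover have "fps_deriv (?R * ?F\<^sup>2) = (fps_deriv ?R + 2 * ?Y n * ?R) * ?F\<^sup>2"
    by (simp add: deriv_tau power2_eq_square algebra_simps)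
  ultimately have "(fps_deriv ?R + 2 * ?Y n * ?R) * ?F\<^sup>2 = (?S * ?R) * ?F\<^sup>2" by (simp only: mult.assoc)
  then have "fps_deriv ?R + 2 * ?Y n * ?R = ?S * ?R" using tau_fps_nonzero(2)[of \<beta> n] by simp
  then show ?thesis by (simp add: algebra_simps)
qed

text \<open>Division of the bilinear relation by h^2 = eta explains \<rho>: eta is \<beta> for
  \<beta> = 1 and 4, and for \<beta> = 2 the coefficient is 0. The second claim retains e2 and e3
  for the initial conditions; only the lowest coefficient of the middle constraint is wanted, so it
  is stated modulo X and e22 disappears.\<close>

lemma cumulant_ode:
  fixes \<beta> n :: nat
  assumes \<beta>: "\<beta> \<in> {1, 2, 4}" and n: "1 \<le> n"
  defines "Y \<equiv> log_deriv_fps \<beta> n" and "c0 \<equiv> loop_c0 \<beta> n" and "c1 \<equiv> loop_c1 \<beta> n"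
  defines "\<rho> \<equiv> 12 / real \<beta> * plucker_coeff \<beta> n * (ensemble \<beta> (n - shift \<beta>) 0 (\<lambda>x. 1)
      * ensemble \<beta> (n + shift \<beta>) 0 (\<lambda>x. 1) / (ensemble \<beta> n 0 (\<lambda>x. 1))\<^sup>2)"
  defines "U \<equiv> - (fps_X + fps_const c1) * Y - fps_const c0"
  defines "V \<equiv> (fps_X + fps_const (c1 + 1 - real \<beta> / 2)) * U
      + fps_const (a + 2 + real \<beta> * (real n - 1)) * fps_X * Y
      + fps_const (real \<beta> / 2) * fps_X * (fps_deriv Y + Y ^ 2)"
  shows "fps_const (eta \<beta>) * fps_X ^ 3 * (fps_deriv (fps_deriv (fps_deriv Y)) + 6 * (fps_deriv Y) ^ 2)
      + 3 * (- (fps_X + fps_const c1) * (fps_X * fps_deriv U - U) - 2 * fps_X * U + 2 * V)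
      + 4 * (fps_X * fps_deriv V - 2 * V)
     = fps_X ^ 3 * (fps_const \<rho> * tau_ratio \<beta> n)"
    and "\<exists>e2 e3. fps_X * e2 = - (fps_X + fps_const c1) * Y - fps_const c0
      \<and> fps_const c1 * fps_deriv e2 + 2 * e2 - 2 * e3 \<in> range (\<lambda>f. fps_X * f)
      \<and> fps_X * e3 = (fps_X + fps_const (c1 + 1 - real \<beta> / 2)) * e2
           + fps_const (a + 2 + real \<beta> * (real n - 1)) * Y + fps_const (real \<beta> / 2) * (fps_deriv Y + Y ^ 2)
      \<and> (n = 1 \<longrightarrow> e2 = fps_deriv Y + Y ^ 2)"
proof -
  define F where "F = tau_fps \<beta> n"
  define G where "G = ensemble_fps \<beta> n"
  define p where "p = power_sum n"
  define h where "h = (if \<beta> = 4 then 2 else 1 :: real)"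
  define e2 where "e2 = G (p 2) * inverse F"
  define e3 where "e3 = G (p 3) * inverse F"
  define e22 where "e22 = G (\<lambda>x. p 2 x ^ 2) * inverse F"
  have b: "1 \<le> \<beta>" using \<beta> by auto
  have iF: "inverse F * F = 1" unfolding F_def by (rule tau_inverse)
  have F0: "F \<noteq> 0" unfolding F_def by (rule tau_fps_nonzero)
  have YF: "fps_deriv F = Y * F" unfolding F_def Y_def by (rule deriv_tau)
  have g: "G (p 2) = e2 * F" "G (p 3) = e3 * F" "G (\<lambda>x. p 2 x ^ 2) = e22 * F"
    by (simp_all add: e2_def e3_def e22_def mult.assoc iF)
  have F2: "fps_deriv (fps_deriv F) = (fps_deriv Y + Y ^ 2) * F"
    by (simp add: YF power2_eq_square algebra_simps)
  note vf = virasoro_fps[OF b, of n, folded G_def p_def F_def c0_def c1_def]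
  have cancel: "A = B" if "A * F = B * F" for A B using that F0 by simp
  have r1: "fps_X * e2 = - (fps_X + fps_const c1) * Y - fps_const c0"
    by (rule cancel) (use vf(1) in \<open>simp add: g YF algebra_simps del: fps_const_neg\<close>)
  have r2: "fps_X * e22 = - (fps_X + fps_const c1) * (fps_deriv e2 + Y * e2) - (fps_const c0 + 2) * e2 + 2 * e3"
    by (rule cancel) (use vf(2) in \<open>simp add: g YF algebra_simps numeral_fps_const del: fps_const_neg flip: fps_const_add\<close>)
  have r3: "fps_X * e3 = (fps_X + fps_const (c1 + 1 - real \<beta> / 2)) * e2
      + fps_const (a + 2 + real \<beta> * (real n - 1)) * Y + fps_const (real \<beta> / 2) * (fps_deriv Y + Y ^ 2)"
  proof (rule cancel)
    have "fps_X * e3 * F = fps_X * G (p 3)" by (simp add: g)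
    then show "fps_X * e3 * F = ((fps_X + fps_const (c1 + 1 - real \<beta> / 2)) * e2
      + fps_const (a + 2 + real \<beta> * (real n - 1)) * Y + fps_const (real \<beta> / 2) * (fps_deriv Y + Y ^ 2)) * F"
      unfolding vf(3) F2 unfolding YF g by (simp only: distrib_right mult.assoc)
  qed
  have h: "h \<noteq> 0" "h\<^sup>2 = eta \<beta>" by (auto simp: h_def eta_def)
  have cb: "cube_bounded {1..n} (p k)" for k unfolding p_def by (rule cube_bounded_power_sum)
  have e: "(\<lambda>z. ensemble \<beta> n z g) has_fps_expansion G g" if "cube_bounded {1..n} g" for g
    unfolding G_def by (rule ensemble_has_fps_expansion[OF that])
  have eF: "(\<lambda>z. ensemble \<beta> n z (\<lambda>x. 1)) has_fps_expansion F"
    unfolding F_def by (rule tau_has_fps_expansion)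
  have d13: "G (\<lambda>x. p 1 x * p 3 x) = - fps_deriv (G (p 3))"
    unfolding G_def p_def fps_deriv_ensemble_fps by simp
  note pw = ensemble_fps_powers[of \<beta> n, folded G_def p_def F_def]
  let ?C = "fps_const :: real \<Rightarrow> real fps"
  have kp0: "(?C (h ^ 4) * G (\<lambda>x. p 1 x ^ 4) + ?C (3 * h\<^sup>2) * G (\<lambda>x. p 2 x ^ 2) - ?C (4 * h\<^sup>2) * G (\<lambda>x. p 1 x * p 3 x)) * F
      - ?C (4 * h) * G (p 1) * (?C (h ^ 3) * G (\<lambda>x. p 1 x ^ 3) - ?C h * G (p 3))
      + ?C 3 * (?C (h\<^sup>2) * G (\<lambda>x. p 1 x ^ 2) + ?C h * G (p 2)) * (?C (h\<^sup>2) * G (\<lambda>x. p 1 x ^ 2) - ?C h * G (p 2))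
     = ?C (12 * plucker_coeff \<beta> n) * (tau_fps \<beta> (n - shift \<beta>) * tau_fps \<beta> (n + shift \<beta>))"
  proof (rule has_fps_expansion_unique_real)
    show "(\<lambda>z. plucker_defect \<beta> n h z) has_fps_expansion
       (?C (h ^ 4) * G (\<lambda>x. p 1 x ^ 4) + ?C (3 * h\<^sup>2) * G (\<lambda>x. p 2 x ^ 2) - ?C (4 * h\<^sup>2) * G (\<lambda>x. p 1 x * p 3 x)) * F
      - ?C (4 * h) * G (p 1) * (?C (h ^ 3) * G (\<lambda>x. p 1 x ^ 3) - ?C h * G (p 3))
      + ?C 3 * (?C (h\<^sup>2) * G (\<lambda>x. p 1 x ^ 2) + ?C h * G (p 2)) * (?C (h\<^sup>2) * G (\<lambda>x. p 1 x ^ 2) - ?C h * G (p 2))"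
      unfolding plucker_defect_def Let_def p_def[symmetric]
      by (intro has_fps_expansion_add has_fps_expansion_diff has_fps_expansion_mult
          has_fps_expansion_const e eF cube_intros cb)
    show "(\<lambda>z. plucker_defect \<beta> n h z) has_fps_expansion
       ?C (12 * plucker_coeff \<beta> n) * (tau_fps \<beta> (n - shift \<beta>) * tau_fps \<beta> (n + shift \<beta>))"
      unfolding plucker_defect_eq[OF \<beta> n, folded h_def]
      by (intro has_fps_expansion_mult has_fps_expansion_const tau_has_fps_expansion)
  qed
  have rhs: "?C (12 * plucker_coeff \<beta> n) * (tau_fps \<beta> (n - shift \<beta>) * tau_fps \<beta> (n + shift \<beta>))
      = ?C h ^ 2 * ((?C \<rho> * tau_ratio \<beta> n) * F ^ 2)"
  proof -
    let ?E = "\<lambda>n. ensemble \<beta> n 0 (\<lambda>x. 1)"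
    have "12 * plucker_coeff \<beta> n = h\<^sup>2 * (\<rho> * ((?E n)\<^sup>2 / (?E (n - shift \<beta>) * ?E (n + shift \<beta>))))"
    proof -
      have "?E n \<noteq> 0" "?E (n - shift \<beta>) \<noteq> 0" "?E (n + shift \<beta>) \<noteq> 0"
        using ensemble_pos less_irrefl by metis+
      then have "\<rho> * ((?E n)\<^sup>2 / (?E (n - shift \<beta>) * ?E (n + shift \<beta>))) = 12 / real \<beta> * plucker_coeff \<beta> n"
        unfolding \<rho>_def by (simp add: field_simps)
      moreover have "plucker_coeff 2 n = 0" by (simp add: plucker_coeff_def)
      ultimately show ?thesis using \<beta> unfolding h(2) by (auto simp: eta_def)
    qed
    then show ?thesis unfolding F_def mult.assoc tau_ratio_mult
      by (simp add: mult.assoc[symmetric] fps_const_power)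
  qed
  have kp: "(?C h ^ 4 * fps_deriv (fps_deriv (fps_deriv (fps_deriv F))) + 3 * ?C h ^ 2 * (e22 * F)
        + 4 * ?C h ^ 2 * ((fps_deriv e3 + Y * e3) * F)) * F
      + 4 * ?C h * fps_deriv F * (- (?C h ^ 3) * fps_deriv (fps_deriv (fps_deriv F)) - ?C h * (e3 * F))
      + 3 * (?C h ^ 2 * fps_deriv (fps_deriv F) + ?C h * (e2 * F)) * (?C h ^ 2 * fps_deriv (fps_deriv F) - ?C h * (e2 * F))
     = ?C h ^ 2 * ((?C \<rho> * tau_ratio \<beta> n) * F ^ 2)"
  proof -
    have d3: "fps_deriv (G (p 3)) = (fps_deriv e3 + Y * e3) * F"
      unfolding g by (simp add: YF algebra_simps)
    have C: "?C (h ^ 4) = ?C h ^ 4" "?C (3 * h\<^sup>2) = 3 * ?C h ^ 2" "?C (4 * h\<^sup>2) = 4 * ?C h ^ 2"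
      "?C (4 * h) = 4 * ?C h" "?C (h ^ 3) = ?C h ^ 3" "?C (h\<^sup>2) = ?C h ^ 2" "?C 3 = 3"
      by (simp_all add: fps_const_power numeral_fps_const)
    show ?thesis
      using kp0[unfolded d13 d3 C pw rhs, unfolded g] by (simp del: fps_const_neg)
  qed
  show "fps_const (eta \<beta>) * fps_X ^ 3 * (fps_deriv (fps_deriv (fps_deriv Y)) + 6 * (fps_deriv Y) ^ 2)
      + 3 * (- (fps_X + fps_const c1) * (fps_X * fps_deriv U - U) - 2 * fps_X * U + 2 * V)
      + 4 * (fps_X * fps_deriv V - 2 * V)
     = fps_X ^ 3 * (fps_const \<rho> * tau_ratio \<beta> n)"
    using hirota_reduction[OF F0 YF r1 r2 r3 kp h(1)] unfolding U_def V_def h(2)[symmetric]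
    by (simp add: fps_const_power)
  have "fps_const c1 * fps_deriv e2 + 2 * e2 - 2 * e3
      = fps_X * (- fps_deriv e2 - (e22 - e2 ^ 2))"
  proof -
    have "fps_X * (e22 - e2 ^ 2) = fps_X * e22 - (fps_X * e2) * e2" by (simp add: power2_eq_square algebra_simps)
    also have "\<dots> = - (fps_X + fps_const c1) * fps_deriv e2 - 2 * e2 + 2 * e3"
      unfolding r2 r1 by (simp add: algebra_simps del: fps_const_neg)
    finally show ?thesis by (simp add: algebra_simps del: fps_const_neg)
  qed
  moreover have "e2 = fps_deriv Y + Y ^ 2" if "n = 1"
  proof (rule cancel)
    have "p 2 = (\<lambda>x. p 1 x ^ 2)" using that by (auto simp: p_def power_sum_def)
    then have "G (p 2) = fps_deriv (fps_deriv F)" using pw(2) by simp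
    then show "e2 * F = (fps_deriv Y + Y ^ 2) * F" unfolding g F2 .
  qed
  ultimately show "\<exists>e2 e3. fps_X * e2 = - (fps_X + fps_const c1) * Y - fps_const c0
      \<and> fps_const c1 * fps_deriv e2 + 2 * e2 - 2 * e3 \<in> range (\<lambda>f. fps_X * f)
      \<and> fps_X * e3 = (fps_X + fps_const (c1 + 1 - real \<beta> / 2)) * e2
           + fps_const (a + 2 + real \<beta> * (real n - 1)) * Y + fps_const (real \<beta> / 2) * (fps_deriv Y + Y ^ 2)
      \<and> (n = 1 \<longrightarrow> e2 = fps_deriv Y + Y ^ 2)"
    using r1 r3 by (intro exI[of _ e2] exI[of _ e3] conjI) auto
qed

text \<open>The coefficients 0, 1, 2 of the first constraint, 0 of the second, and 0, 1 of the
  third. The relation for n = 1 comes from p2 = p1^2 and stays informative when c1 =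
  \<beta>.\<close>

lemma low_order_relations:
  fixes \<beta> n :: nat
  assumes \<beta>: "\<beta> \<in> {1, 2, 4}" and n: "1 \<le> n"
  defines "y \<equiv> fps_nth (log_deriv_fps \<beta> n)" and "c0 \<equiv> loop_c0 \<beta> n" and "c1 \<equiv> loop_c1 \<beta> n"
  defines "dd \<equiv> c1 + 1 - real \<beta> / 2" and "a' \<equiv> a + 2 + real \<beta> * (real n - 1)"
  shows "c1 * y 0 = - c0"
    and "(c1 + 1) * (c1 - real \<beta> / 2) * y 1 = - y 0 * (dd - a') + real \<beta> / 2 * (y 0)\<^sup>2"
    and "(c1 + 2) * (c1 - real \<beta>) * (- 2 * y 2) = 2 * y 1 * (2 * dd - c1 - 2 * a' - 2 * real \<beta> * y 0)"
    and "n = 1 \<Longrightarrow> (c1 + 2) * (- 2 * y 2) = 2 * y 1 * (1 + 2 * y 0)"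
proof -
  let ?Y = "log_deriv_fps \<beta> n"
  obtain e2 e3 f where e: "fps_X * e2 = - (fps_X + fps_const c1) * ?Y - fps_const c0"
      "fps_const c1 * fps_deriv e2 + 2 * e2 - 2 * e3 = fps_X * f"
      "fps_X * e3 = (fps_X + fps_const dd) * e2 + fps_const a' * ?Y + fps_const (real \<beta> / 2) * (fps_deriv ?Y + ?Y ^ 2)"
      "n = 1 \<longrightarrow> e2 = fps_deriv ?Y + ?Y ^ 2"
    using cumulant_ode(2)[OF \<beta> n] unfolding c0_def c1_def dd_def a'_def by blast
  have 1: "c1 * y 0 = - c0" using arg_cong[OF e(1), of "\<lambda>f. fps_nth f 0"] by (simp add: y_def)
  have 2: "fps_nth e2 0 = - y 0 - c1 * y 1"
    using arg_cong[OF e(1), of "\<lambda>f. fps_nth f 1"] by (simp add: y_def algebra_simps)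
  have 3: "fps_nth e2 1 = - y 1 - c1 * y 2"
    using arg_cong[OF e(1), of "\<lambda>f. fps_nth f 2"] by (simp add: y_def algebra_simps numeral_2_eq_2)
  have 4: "c1 * fps_nth e2 1 + 2 * fps_nth e2 0 = 2 * fps_nth e3 0"
    using arg_cong[OF e(2), of "\<lambda>f. fps_nth f 0"] by (simp add: numeral_fps_const)
  have 5: "dd * fps_nth e2 0 + a' * y 0 + real \<beta> / 2 * (y 1 + (y 0)\<^sup>2) = 0"
    using arg_cong[OF e(3), of "\<lambda>f. fps_nth f 0"] by (simp add: y_def fps_power_zeroth)
  have sq1: "fps_nth (?Y ^ 2) 1 = 2 * y 0 * y 1"
    by (simp add: fps_square_nth y_def)
  have 6: "fps_nth e3 0 = fps_nth e2 0 + dd * fps_nth e2 1 + a' * y 1 + real \<beta> / 2 * (2 * y 2 + 2 * y 0 * y 1)"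
    using arg_cong[OF e(3), of "\<lambda>f. fps_nth f 1"] sq1 by (simp add: y_def algebra_simps numeral_2_eq_2)
  note ic = initial_cumulants[OF 1 2 3 4 5 6 dd_def[THEN meta_eq_to_obj_eq]]
  show "c1 * y 0 = - c0" by (rule 1)
  show "(c1 + 1) * (c1 - real \<beta> / 2) * y 1 = - y 0 * (dd - a') + real \<beta> / 2 * (y 0)\<^sup>2" by (rule ic(1))
  show "(c1 + 2) * (c1 - real \<beta>) * (- 2 * y 2) = 2 * y 1 * (2 * dd - c1 - 2 * a' - 2 * real \<beta> * y 0)" by (rule ic(2))
  show "(c1 + 2) * (- 2 * y 2) = 2 * y 1 * (1 + 2 * y 0)" if "n = 1"
  proof -
    have "fps_nth e2 1 = 2 * y 2 + 2 * y 0 * y 1"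
      using e(4) that sq1 by (simp add: y_def numeral_2_eq_2)
    then show ?thesis using 3 by (simp add: algebra_simps)
  qed
qed

end

text \<open>For n = 1 the numerator has the factor s - \<beta> in common with the denominator, where
  s is the value of c1.\<close>

lemma kappa3_formula_single:
  fixes a :: real and \<delta> :: int and \<beta> :: nat
  defines "s \<equiv> a + of_int \<delta> / 2 + 2"
  assumes "s \<noteq> 0" "s \<noteq> real \<beta>"
  shows "kappa3_formula \<beta> a \<delta> 1 = 2 * kappa2_formula \<beta> a \<delta> 1 * (1 - 2 * kappa1_formula \<beta> a \<delta> 1) / (s + 2)"
proof -
  have k1: "kappa1_formula \<beta> a \<delta> 1 = (a + 1) / s" by (simp add: kappa1_formula_def s_def)
  have num: "of_int \<delta> / 2 - a + 2 * real \<beta> * ((a + 1) / s) - real \<beta> * real 1 = (1 - 2 * ((a + 1) / s)) * (s - real \<beta>)"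
    using assms(2) by (simp add: s_def field_simps)
  have den: "a + of_int \<delta> / 2 + 4 + real \<beta> * (real 1 - 1) = s + 2"
    "a + of_int \<delta> / 2 + 2 + real \<beta> * (real 1 - 2) = s - real \<beta>"
    by (simp_all add: s_def)
  have "kappa3_formula \<beta> a \<delta> 1
      = 2 * kappa2_formula \<beta> a \<delta> 1 * ((1 - 2 * ((a + 1) / s)) * (s - real \<beta>)) / ((s + 2) * (s - real \<beta>))"
    unfolding kappa3_formula_def k1 num den ..
  then show ?thesis unfolding k1 using assms(3) by simp
qed

theorem lemma4p1:
  fixes m n \<beta> :: nat and \<delta> :: int and \<alpha> :: real and \<kappa> \<mu> :: "nat \<Rightarrow> real"
  assumes "1 \<le> n" and "n \<le> m"
    and "(\<beta>, \<delta>) \<in> {(1, 0), (2, 0), (4, 0), (4, 2), (2, 1), (1, -1), (2, -1)}"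
    and "\<alpha> = real \<beta> / 2 * (real m - real n + 1) - 1"
    and "\<kappa> = cumulant \<beta> \<alpha> \<delta> n"
    and "\<mu> = reduced_moment \<beta> \<alpha> \<delta> n"
  shows "(\<forall>l\<ge>3.
            A_coeff \<beta> \<alpha> \<delta> n l * \<kappa> (l + 1)
            + eta \<beta> * (\<Sum>i\<in>{0..l-1}. real (l choose i) * \<kappa> (i + 1) * \<kappa> (l - i) * B_coeff \<beta> i l)
            - real l * (2 * real l - 1) * (\<alpha> - of_int \<delta> / 2 + real \<beta> * real n) * \<kappa> l
            - real l * (real l - 1) * (real l - 2) * \<kappa> (l - 1)
            = 12 * b_coeff \<beta> \<alpha> \<delta> n / real \<beta> * real l * (real l - 1) * (real l - 2) * \<mu> (l - 3))
       \<and> \<kappa> 1 = kappa1_formula \<beta> \<alpha> \<delta> n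
       \<and> \<kappa> 2 = kappa2_formula \<beta> \<alpha> \<delta> n
       \<and> (\<alpha> + of_int \<delta> / 2 + 2 + real \<beta> * (real n - 2) \<noteq> 0 \<longrightarrow> \<kappa> 3 = kappa3_formula \<beta> \<alpha> \<delta> n)
       \<and> ((\<lambda>a. kappa3_formula \<beta> a \<delta> n) \<longlongrightarrow> \<kappa> 3) (at \<alpha>)"
proof -
  have \<beta>: "\<beta> \<in> {1, 2, 4}" and \<delta>: "\<delta> \<ge> -1" using assms(3) by auto
  \<comment> \<open>With \<delta> \<ge> -1 the resulting bound on \<alpha> puts both exponents above
    -1 and makes every denominator positive except possibly c1 - \<beta>.\<close>
  have "real \<beta> / 2 * 1 \<le> real \<beta> / 2 * (real m - real n + 1)"
    using assms(2) by (intro mult_left_mono) auto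
  then have \<alpha>: "\<alpha> \<ge> real \<beta> / 2 - 1" using assms(4) by simp
  define d where "d = (of_int \<delta> / 2 :: real)"
  have d: "d \<ge> -1/2" using \<delta> by (simp add: d_def)
  interpret jacobi_measure \<alpha> d
    by standard (use \<alpha> d \<beta> in auto)
  define y where "y = fps_nth (log_deriv_fps \<beta> n)"
  have \<kappa>: "\<kappa> (Suc k) = (-1) ^ Suc k * fact k * y k" for k
    unfolding assms(5) y_def by (rule cumulant_eq) (rule d_def)
  define c0 where "c0 = loop_c0 \<beta> n"
  define c1 where "c1 = loop_c1 \<beta> n"
  have c0: "c0 = real n * (\<alpha> + 1 + real \<beta> * (real n - 1) / 2)" unfolding c0_def loop_c0_def ..
  have c1: "c1 = \<alpha> + of_int \<delta> / 2 + 2 + real \<beta> * (real n - 1)" unfolding c1_def loop_c1_def d_def[symmetric] ..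
  have bn: "real \<beta> * (real n - 1) \<ge> 0" using assms(1) by simp
  have c1_pos: "c1 - real \<beta> / 2 > 0" "c1 > 0" using \<alpha> d bn unfolding c1 d_def by auto
  note low = low_order_relations[OF \<beta> assms(1), folded y_def c0_def c1_def]
  have k1: "\<kappa> 1 = - y 0" and k2: "\<kappa> 2 = y 1" and k3: "\<kappa> 3 = - 2 * y 2"
    using \<kappa>[of 0] \<kappa>[of 1] \<kappa>[of 2] by (simp_all add: numeral_2_eq_2 numeral_3_eq_3)
  have "12 * b_coeff \<beta> \<alpha> \<delta> n / real \<beta> = 12 / real \<beta> * plucker_coeff \<beta> n * (ensemble \<beta> (n - shift \<beta>) 0 (\<lambda>x. 1)
      * ensemble \<beta> (n + shift \<beta>) 0 (\<lambda>x. 1) / (ensemble \<beta> n 0 (\<lambda>x. 1))\<^sup>2)"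
    using \<beta> by (auto simp: b_coeff_def plucker_coeff_def shift_def norm_const_eq_ensemble[OF d_def])
  note ode = cumulant_ode(1)[OF \<beta> assms(1), folded this, unfolded c0[unfolded c0_def] c1[unfolded c1_def]]
  have \<mu>: "\<mu> k = (-1) ^ k * fact k * fps_nth (tau_ratio \<beta> n) k" for k
    unfolding assms(6)
  proof (rule reduced_moment_fps[OF tau_ratio_nth_0 tau_ratio_deriv])
    fix k
    have "fps_nth (2 * log_deriv_fps \<beta> n) k = 2 * fps_nth (log_deriv_fps \<beta> n) k"
      by (simp add: numeral_fps_const)
    then show "r_coeff \<beta> \<alpha> \<delta> n (Suc k) = (-1) ^ Suc k * fact k
        * fps_nth (log_deriv_fps \<beta> (n - shift \<beta>) + log_deriv_fps \<beta> (n + shift \<beta>) - 2 * log_deriv_fps \<beta> n) k"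
      unfolding r_coeff_def cumulant_eq[OF d_def] fps_sub_nth fps_add_nth by (simp add: algebra_simps)
  qed
  have "\<forall>l\<ge>3. A_coeff \<beta> \<alpha> \<delta> n l * \<kappa> (l + 1)
            + eta \<beta> * (\<Sum>i\<in>{0..l-1}. real (l choose i) * \<kappa> (i + 1) * \<kappa> (l - i) * B_coeff \<beta> i l)
            - real l * (2 * real l - 1) * (\<alpha> - of_int \<delta> / 2 + real \<beta> * real n) * \<kappa> l
            - real l * (real l - 1) * (real l - 2) * \<kappa> (l - 1)
            = 12 * b_coeff \<beta> \<alpha> \<delta> n / real \<beta> * real l * (real l - 1) * (real l - 2) * \<mu> (l - 3)"
    using recurrence_from_ode[OF ode \<kappa>[unfolded y_def] \<mu> \<beta>] by blast
  moreover have K1: "\<kappa> 1 = kappa1_formula \<beta> \<alpha> \<delta> n"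
  proof -
    have "\<kappa> 1 = c0 / c1" using low(1) c1_pos unfolding k1 by (simp add: field_simps)
    then show ?thesis unfolding kappa1_formula_def c0 c1 by simp
  qed
  moreover have K2: "\<kappa> 2 = kappa2_formula \<beta> \<alpha> \<delta> n"
  proof -
    have y0: "y 0 = - (c0 / c1)" using low(1) c1_pos by (simp add: field_simps)
    define Z where "Z = c1 - real \<beta> / 2"
    define P where "P = of_int \<delta> + 2 + real \<beta> * (real n - 1)"
    define Q where "Q = of_int \<delta> + 2 * \<alpha> + 4 + real \<beta> * (real n - 2)"
    \<comment> \<open>This factorization is what gives the second cumulant its product form.\<close>
    have PQ: "c1 * (c1 + 1 - real \<beta> / 2 - (\<alpha> + 2 + real \<beta> * (real n - 1))) + real \<beta> / 2 * c0 = P * Q / 4"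
      unfolding c0 c1 P_def Q_def by (simp add: field_simps)
    have "(c1 + 1) * (c1 - real \<beta> / 2) * y 1 * c1\<^sup>2
        = (c0 / c1 * (c1 + 1 - real \<beta> / 2 - (\<alpha> + 2 + real \<beta> * (real n - 1))) + real \<beta> / 2 * (c0 / c1)\<^sup>2) * c1\<^sup>2"
      using low(2) unfolding y0 by simp
    also have "\<dots> = c0 * (c1 * (c1 + 1 - real \<beta> / 2 - (\<alpha> + 2 + real \<beta> * (real n - 1))) + real \<beta> / 2 * c0)"
      using c1_pos(2) by (simp add: field_simps power2_eq_square)
    also have "\<dots> = c0 * (P * Q / 4)" unfolding PQ ..
    finally have y1: "y 1 = c0 * (P * Q / 4) / (c1\<^sup>2 * (c1 + 1) * (c1 - real \<beta> / 2))"
      using c1_pos by (subst eq_divide_eq) (auto simp: mult_ac)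
    have e: "2 * \<alpha> + of_int \<delta> + 4 + real \<beta> * (2 * real n - 3) = 2 * (c1 - real \<beta> / 2)"
      "\<alpha> + of_int \<delta> / 2 + 3 + real \<beta> * (real n - 1) = c1 + 1"
      "real n * (2 * \<alpha> + 2 + real \<beta> * (real n - 1)) = 2 * c0"
      by (simp_all add: c0 c1 field_simps)
    show ?thesis
      unfolding k2 kappa2_formula_def P_def[symmetric] Q_def[symmetric] c1[symmetric] e y1
      unfolding Z_def[symmetric] by simp
  qed
  moreover have c1b: "\<alpha> + of_int \<delta> / 2 + 2 + real \<beta> * (real n - 2) = c1 - real \<beta>"
    "\<alpha> + of_int \<delta> / 2 + 4 + real \<beta> * (real n - 1) = c1 + 2"
    by (simp_all add: c1 algebra_simps)
  moreover have K3: "\<kappa> 3 = kappa3_formula \<beta> \<alpha> \<delta> n" if "c1 - real \<beta> \<noteq> 0"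
  proof -
    have X: "2 * (c1 + 1 - real \<beta> / 2) - c1 - 2 * (\<alpha> + 2 + real \<beta> * (real n - 1)) = of_int \<delta> / 2 - \<alpha> - real \<beta> * real n"
      unfolding c1 by (simp add: algebra_simps)
    have "(c1 + 2) * (c1 - real \<beta>) * \<kappa> 3 = 2 * \<kappa> 2 * (of_int \<delta> / 2 - \<alpha> - real \<beta> * real n - 2 * real \<beta> * y 0)"
      unfolding k2 k3 by (rule low(3)[unfolded X])
    moreover have "(c1 + 2) * (c1 - real \<beta>) \<noteq> 0" using that c1_pos by simp
    ultimately have "\<kappa> 3 = 2 * \<kappa> 2 * (of_int \<delta> / 2 - \<alpha> - real \<beta> * real n - 2 * real \<beta> * y 0) / ((c1 + 2) * (c1 - real \<beta>))"
      by (metis nonzero_mult_div_cancel_left)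
    also have "of_int \<delta> / 2 - \<alpha> - real \<beta> * real n - 2 * real \<beta> * y 0
        = of_int \<delta> / 2 - \<alpha> + 2 * real \<beta> * \<kappa> 1 - real \<beta> * real n"
      unfolding k1 by (simp add: algebra_simps)
    finally show ?thesis unfolding kappa3_formula_def c1b K1 K2 .
  qed
  moreover have "((\<lambda>a. kappa3_formula \<beta> a \<delta> n) \<longlongrightarrow> \<kappa> 3) (at \<alpha>)"
  proof -
    have nz: "\<alpha> + of_int \<delta> / 2 + 2 + real \<beta> * (real n - 1) \<noteq> 0" "\<alpha> + of_int \<delta> / 2 + 3 + real \<beta> * (real n - 1) \<noteq> 0"
      "2 * \<alpha> + of_int \<delta> + 4 + real \<beta> * (2 * real n - 3) \<noteq> 0" "\<alpha> + of_int \<delta> / 2 + 4 + real \<beta> * (real n - 1) \<noteq> 0"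
      using c1_pos by (auto simp: c1 field_simps)
    have t1: "((\<lambda>a. kappa1_formula \<beta> a \<delta> n) \<longlongrightarrow> \<kappa> 1) (at \<alpha>)"
      unfolding K1 kappa1_formula_def by (intro tendsto_intros nz)
    have t2: "((\<lambda>a. kappa2_formula \<beta> a \<delta> n) \<longlongrightarrow> \<kappa> 2) (at \<alpha>)"
      unfolding K2 kappa2_formula_def by (intro tendsto_intros) (use nz in auto)
    show ?thesis
    proof (cases "c1 - real \<beta> = 0")
      case False
      have nzd: "(\<alpha> + of_int \<delta> / 2 + 4 + real \<beta> * (real n - 1))
          * (\<alpha> + of_int \<delta> / 2 + 2 + real \<beta> * (real n - 2)) \<noteq> 0"
        unfolding c1b using False c1_pos(2) by simp
      show ?thesis unfolding K3[OF False] unfolding kappa3_formula_def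
        by (intro tendsto_intros t1[unfolded K1] t2[unfolded K2] nzd)
    next
      case True
      \<comment> \<open>For n \<ge> 2 the bounds on \<alpha> and \<delta> force c1 > \<beta>. The
        exceptional case does occur, for instance for \<beta> = 2, \<delta> = 0 and m = n =
        1.\<close>
      have n: "n = 1"
      proof (rule ccontr)
        assume "n \<noteq> 1"
        then have "real \<beta> * (real n - 2) \<ge> 0" using assms(1) by simp
        then have "c1 - real \<beta> > 0" using \<alpha> d unfolding c1b[symmetric] d_def by auto
        then show False using True by simp
      qed
      have cs: "c1 = \<alpha> + of_int \<delta> / 2 + 2" using n by (simp add: c1)
      have c2: "\<alpha> + of_int \<delta> / 2 + 2 + 2 \<noteq> 0" using c1_pos(2) unfolding cs by linarith
      have "1 - 2 * \<kappa> 1 = 1 + 2 * y 0" unfolding k1 by linarith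
      then have "(\<alpha> + of_int \<delta> / 2 + 2 + 2) * \<kappa> 3 = 2 * \<kappa> 2 * (1 - 2 * \<kappa> 1)"
        using low(4)[OF n, unfolded cs] by (simp only: k2 k3)
      then have k: "\<kappa> 3 = 2 * \<kappa> 2 * (1 - 2 * \<kappa> 1) / (\<alpha> + of_int \<delta> / 2 + 2 + 2)"
        using c2 by (metis nonzero_mult_div_cancel_left)
      have "((\<lambda>a. 2 * kappa2_formula \<beta> a \<delta> n * (1 - 2 * kappa1_formula \<beta> a \<delta> n) / (a + of_int \<delta> / 2 + 2 + 2)) \<longlongrightarrow> \<kappa> 3) (at \<alpha>)"
        unfolding k by (intro tendsto_intros t1 t2 c2)
      \<comment> \<open>For a near \<alpha> but different from it the common factor is nonzero and
        cancels, so the formula agrees with the reduced one, whose limit has just been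
        computed.\<close>
      moreover have "eventually (\<lambda>a. 2 * kappa2_formula \<beta> a \<delta> n * (1 - 2 * kappa1_formula \<beta> a \<delta> n) / (a + of_int \<delta> / 2 + 2 + 2)
          = kappa3_formula \<beta> a \<delta> n) (at \<alpha>)"
      proof -
        have "eventually (\<lambda>a. a \<noteq> - (of_int \<delta> / 2 + 2)) (at \<alpha>)"
          by (rule eventually_neq_at_within)
        moreover have "eventually (\<lambda>a. a \<noteq> \<alpha>) (at \<alpha>)" by (rule eventually_neq_at_within)
        ultimately show ?thesis
        proof eventually_elim
          case (elim a)
          have "a + of_int \<delta> / 2 + 2 \<noteq> 0" "a + of_int \<delta> / 2 + 2 \<noteq> real \<beta>"
            using elim True cs by auto
          from kappa3_formula_single[OF this] show ?case unfolding n by simp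
        qed
      qed
      ultimately show ?thesis by (rule Lim_transform_eventually)
    qed
  qed
  ultimately show ?thesis by simp
qed

end
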